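(* Let $p=(x^{(0)};\xi)=(x^{(0)};\xi^{(1)},\dots,\xi^{(m)})\in S_\chi$ be such that $\xi^{(k)}=0$ whenever the $k$-th column of $A_\chi$ is zero, and let $Z$ be a subset of $X$. Then the following conditions are equivalent. (i) $p\notin C_\chi(Z)$. (ii) There exist $V\in C(\xi)$ and an open neighborhood $U$ of $\pi(p)$ in $X$ such that $Z\cap V\cap U=\emptyset$. (iii) There exist $V\in C(\xi,F^q)$ and an open neighborhood $U$ of $\pi(p)$ in $X$ such that $Z\cap V\cap U=\emptyset$.
   Context: **Local model.** $\mathbb R^+$ denotes the positive reals. $X=\mathbb R^n$ with coordinates divided into blocks $x=(x^{(0)},x^{(1)},\dots,x^{(m)})$, $x^{(k)}\in\mathbb R^{n_k}$. $A_\chi=(a_{jk})$ is an $\ell\times m$ matrix with entries in $\mathbb Q_{\ge 0}$; $\sigma>0$ is the rational number such that all $\sigma a_{jk}$ are integers with no common divisor. $\chi=\{M_1,\dots,M_\ell\}$ with $M_j=\{x^{(k)}=0\text{ for all }k\text{ with }a_{jk}\neq0\}$. Put $\varphi_k(t)=\prod_{j=1}^\ell t_j^{a_{jk}}$, $\widetilde X=\mathbb R^n\times\mathbb R^\ell$, $p(x;t)=(x^{(0)},\varphi_1(t)^\sigma x^{(1)},\dots,\varphi_m(t)^\sigma x^{(m)})$ as a map $\widetilde X\to X$, $\Omega=\{t_1,\dots,t_\ell>0\}\subset\widetilde X$, $\widetilde p=p|_\Omega$, $S_\chi=\{t=0\}\subset\widetilde X$ with coordinates $(x^{(0)};\xi^{(1)},\dots,\xi^{(m)})$.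 For $Z\subset X$ the multi-normal cone is $C_\chi(Z)=\overline{\widetilde p^{-1}(Z)}\cap S_\chi$ (closure in $\widetilde X$). $\pi(x^{(0)};\xi)=(x^{(0)},0,\dots,0)\in X$. **Semigroups.** Let $L=\operatorname{rank}A_\chi$; rows and columns are ordered so that the submatrix formed by the first $L$ rows and first $L$ columns of $A_\chi$ is invertible. Let $J_Z(\xi)=\{k\in\{1,\dots,m\}:\xi^{(k)}=0\}$ and $J_Z(\xi)\cap\{1,\dots,L\}=\{k_1<\dots<k_q\}$ ($q\ge0$). Write $\tau=(\tau_1,\dots,\tau_m)$, $\tau'=(\tau_1,\dots,\tau_L)$, $\lambda=(\lambda',\lambda'')$ with $\lambda'=(\lambda_1,\dots,\lambda_L)$, $\lambda''=(\lambda_{L+1},\dots,\lambda_\ell)$. Let $\lambda'=\varphi^{-1}(\tau',\lambda'')=(\varphi_1^{-1},\dots,\varphi_L^{-1})$ be the solution (consisting of monomials with rational exponents) of $\tau_k=\varphi_k(\lambda',\lambda'')$, $1\le k\le L$. For $L<k\le m$ put $\psi_k(\tau)=\tau_k/\varphi_k(\varphi^{-1}(\tau',\lambda''),\lambda'')$ (independent of $\lambda''$). $\mathcal H_\tau$ (resp. $\mathcal H_{\tau,\lambda}$) is the set of monomials with coefficient $1$ and rational exponents in $\tau$ (resp. in $\tau,\lambda$); $\nu_k(f)$, $\nu^\lambda_j(f)$ are the exponents of $\tau_k$, $\lambda_j$ in $f$. $\mathcal H_\tau\times\mathbb R_{\ge0}\subset\mathcal H_{\tau,\lambda}\times\mathbb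 R_{\ge0}$ are semigroups for $(f,v)(g,w)=(fg,vw)$. For a subset $A$: $Q(A)=A\cup\{(f^{-1},v^{-1}):(f,v)\in A,\ v\ne0\}$; $[A]$ is the set of all finite products of elements of $A$, including $(1,1)$; $A_{\ge}=\{(f,v)\in A\cap(\mathcal H_\tau\times\mathbb R_{\ge0}):\nu_{k_i}(f)\ge0,\ 1\le i\le q\}$; $A_{=}$ is the same with $\nu_{k_i}(f)=0$ for all $i$; $A_>=A_\ge\setminus A_=$. For semigroups $\mathcal A\vee\mathcal B=\{f,g,fg:f\in\mathcal A,g\in\mathcal B\}$, $\mathcal A*\mathcal B=\{fg:f\in\mathcal A,g\in\mathcal B\}$. Put $n_k(\xi)=\psi_k(r_1,\dots,r_m)$ with $r_i=1$ if $i\in J_Z(\xi)\cap\{1,\dots,L\}$ and $r_i=|\xi^{(i)}|$ otherwise, $$G=Q\big(\{(\varphi_j^{-1},0)\}_{1\le j\le L}\cup\{(\psi_k,n_k(\xi))\}_{L<k\le m}\cup\{(\lambda_j,0)\}_{L<j\le\ell}\big),\quad \mathcal G=[G]_=\vee([G]_>*\{(1,0)\}).$$ Semigroups $\mathcal A,\mathcal B\subset\mathcal H_\tau\times\mathbb R_{\ge0}$ are equivalent if $\langle\mathcal A\rangle_{N_1}\subset\langle\mathcal B\rangle_{N_2}\subset\mathcal A$ for some $N_1,N_2\in\mathbb N$, where $\langle\mathcal A\rangle_N=\{(f,v)^N:(f,v)\in\mathcal A\}$. **The finite set $F^q$.** For a finite set $F\subset\mathcal H_{\tau,\lambda}\times\mathbb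 R_{\ge0}$, $\mathcal L_k(F)$ consists of: (F1) $(f,v)\in F$ with $\nu_k(f)=0$; (F2) $(f,0)$ for $(f,v)\in F$ with $\nu_k(f)>0$; (F3) $(f^ag^b,v^aw^b)$ for $(f,v),(g,w)\in F$ with $\nu_k(f)>0>\nu_k(g)$, where $a,b$ are coprime natural numbers with $a|\nu_k(f)|=b|\nu_k(g)|$. $\mathcal L_j^\lambda(F)$ consists of the elements (F1) and (F3) with $\nu_k$ replaced by $\nu^\lambda_j$. Then $F^0=(\mathcal L^\lambda_\ell\circ\cdots\circ\mathcal L^\lambda_{L+1})(G)$ and $F^q=(\mathcal L_{k_q}\circ\cdots\circ\mathcal L_{k_1})(F^0)$, finite subsets of $\mathcal H_\tau\times\mathbb R_{\ge0}$. **Multicones.** For a finite $H\subset\mathcal H_\tau\times\mathbb R_{\ge0}$, $C(\xi,H)$ is the family of sets $$\{x\in X:\ x^{(k)}\in W_k\ (1\le k\le m),\ v-\epsilon<g(|x^{(1)}|,\dots,|x^{(m)}|)<v+\epsilon\ \text{ for all }(g,v)\in H\},$$ where $\epsilon>0$, $W_k$ is an $\mathbb R^+$-conic open subset of $\mathbb R^{n_k}\setminus\{0\}$ containing $\xi^{(k)}$ if $k\notin J_Z(\xi)$, and $W_k=\mathbb R^{n_k}$ if $k\in J_Z(\xi)$. $C(\xi)=\bigcup_HC(\xi,H)$, $H$ running through finite subsets such that $[H]$ and $\mathcal G$ are equivalent. *)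

theory Defs
  imports "HOL-Analysis.Analysis" "Jordan_Normal_Form.DL_Rank_Submatrix"
begin

text \<open>
  \<open>X = \<real>\<^sup>n\<close> is \<open>real ^ 'n\<close>. A map \<open>blk\<close> from the coordinates to \<open>{0..m}\<close> divides them into
  blocks. The Euclidean space of the \<open>k\<close>-th block, of dimension \<open>n\<^sub>k = card {i. blk i = k}\<close>, is
  identified with the subspace \<open>block_space blk k\<close> of the vectors supported on that block, so that
  \<open>block blk k x\<close> is \<open>x\<^sup>(\<^sup>k\<^sup>)\<close>.
\<close>

definition block :: "('n \<Rightarrow> nat) \<Rightarrow> nat \<Rightarrow> real ^ 'n \<Rightarrow> real ^ 'n" where
  "block blk k x = (\<chi> i. if blk i = k then vec_nth x i else 0)"

definition block_space :: "('n \<Rightarrow> nat) \<Rightarrow> nat \<Rightarrow> (real ^ 'n) set" where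
  "block_space blk k = {x. \<forall>i. blk i \<noteq> k \<longrightarrow> vec_nth x i = 0}"

text \<open>
  The matrix \<open>A\<close> has \<open>\<ell> = dim_row A\<close> rows and \<open>m = dim_col A\<close> columns. Matrices of the
  library are indexed from 0, whereas the indices \<open>j\<close>, \<open>k\<close> below start at 1.
\<close>

definition entry :: "rat mat \<Rightarrow> nat \<Rightarrow> nat \<Rightarrow> rat" where
  "entry A j k = A $$ (j - 1, k - 1)"

definition mat_rank :: "rat mat \<Rightarrow> nat" where
  "mat_rank A = vec_space.rank (dim_row A) A"

definition normalizer :: "rat mat \<Rightarrow> rat \<Rightarrow> bool" where
  "normalizer A \<sigma> \<longleftrightarrow> \<sigma> > 0 \<and>
     (\<forall>j\<in>{1..dim_row A}. \<forall>k\<in>{1..dim_col A}. \<sigma> * entry A j k \<in> \<int>) \<and>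
     Gcd {\<lfloor>\<sigma> * entry A j k\<rfloor> | j k. j \<in> {1..dim_row A} \<and> k \<in> {1..dim_col A}} = 1"


section \<open>The multi-normal cone\<close>

text \<open>
  \<open>\<real>\<^sup>\<ell>\<close> is the product of copies of the real line indexed by \<open>{1..\<ell>}\<close>; its points are the
  extensional functions on \<open>{1..\<ell>}\<close>.
\<close>

definition Xtilde :: "rat mat \<Rightarrow> ((real ^ 'n) \<times> (nat \<Rightarrow> real)) topology" where
  "Xtilde A = prod_topology euclidean (powertop_real {1..dim_row A})"

text \<open>
  The factor of \<open>x\<^sup>(\<^sup>k\<^sup>)\<close> is the \<open>\<sigma>\<close>-th power of \<open>\<phi>\<^sub>k(t)\<close>; its exponents \<open>\<sigma> a\<^sub>j\<^sub>k\<close> are natural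
  numbers, so it makes sense for all real \<open>t\<close>.
\<close>

definition deform :: "rat mat \<Rightarrow> rat \<Rightarrow> ('n \<Rightarrow> nat) \<Rightarrow> (real ^ 'n) \<times> (nat \<Rightarrow> real) \<Rightarrow> real ^ 'n" where
  "deform A \<sigma> blk = (\<lambda>(x, t). \<chi> i.
     if blk i = 0 then vec_nth x i
     else (\<Prod>j = 1..dim_row A. t j ^ nat \<lfloor>\<sigma> * entry A j (blk i)\<rfloor>) * vec_nth x i)"

definition Omega :: "rat mat \<Rightarrow> ((real ^ 'n) \<times> (nat \<Rightarrow> real)) set" where
  "Omega A = {(x, t) \<in> topspace (Xtilde A). \<forall>j\<in>{1..dim_row A}. t j > 0}"

definition S_chi :: "rat mat \<Rightarrow> ((real ^ 'n) \<times> (nat \<Rightarrow> real)) set" where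
  "S_chi A = {(x, t) \<in> topspace (Xtilde A). \<forall>j\<in>{1..dim_row A}. t j = 0}"

definition multinormal_cone ::
  "rat mat \<Rightarrow> rat \<Rightarrow> ('n \<Rightarrow> nat) \<Rightarrow> (real ^ 'n) set \<Rightarrow> ((real ^ 'n) \<times> (nat \<Rightarrow> real)) set" where
  "multinormal_cone A \<sigma> blk Z =
     Xtilde A closure_of {q \<in> Omega A. deform A \<sigma> blk q \<in> Z} \<inter> S_chi A"

definition base_point :: "('n \<Rightarrow> nat) \<Rightarrow> (real ^ 'n) \<times> (nat \<Rightarrow> real) \<Rightarrow> real ^ 'n" where
  "base_point blk p = block blk 0 (fst p)"


section \<open>Monomials\<close>

text \<open>
  A monomial with coefficient 1 in the indeterminates \<open>\<tau>\<^sub>k\<close>, \<open>\<lambda>\<^sub>j\<close> is its family of rational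
  exponents: \<open>f (Tau k)\<close> is \<open>\<nu>\<^sub>k(f)\<close> and \<open>f (Lam j)\<close> is the exponent of \<open>\<lambda>\<^sub>j\<close> in \<open>f\<close>.
  Consequently products of monomials are pointwise sums.
\<close>

datatype indet = Tau nat | Lam nat

type_synonym monomial = "indet \<Rightarrow> rat"

definition mono_var :: "indet \<Rightarrow> monomial" where
  "mono_var w = (\<lambda>u. if u = w then 1 else 0)"

definition mono_one :: monomial where
  "mono_one = (\<lambda>u. 0)"

definition mono_mult :: "monomial \<Rightarrow> monomial \<Rightarrow> monomial" where
  "mono_mult f g = (\<lambda>u. f u + g u)"

definition mono_inv :: "monomial \<Rightarrow> monomial" where
  "mono_inv f = (\<lambda>u. - f u)"

definition mono_pow :: "monomial \<Rightarrow> nat \<Rightarrow> monomial" where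
  "mono_pow f N = (\<lambda>u. of_nat N * f u)"

definition H_tau :: "rat mat \<Rightarrow> monomial set" where
  "H_tau A = {f. \<forall>u. f u \<noteq> 0 \<longrightarrow> u \<in> Tau ` {1..dim_col A}}"

text \<open>
  The value of a monomial in \<open>\<tau>\<close> at \<open>\<tau> = r\<close>, where \<open>r \<ge> 0\<close>. Indeterminates with exponent 0 do
  not occur in the monomial; they are skipped because \<open>0 powr 0 = 0\<close>. A negative exponent at
  \<open>r k = 0\<close> is not meaningful; it does not arise for the families \<open>C(\<xi>)\<close> and \<open>C(\<xi>,F\<^sup>q)\<close>.
\<close>

definition mono_eval :: "rat mat \<Rightarrow> monomial \<Rightarrow> (nat \<Rightarrow> real) \<Rightarrow> real" where
  "mono_eval A f r =
     (\<Prod>k = 1..dim_col A. if f (Tau k) = 0 then 1 else r k powr real_of_rat (f (Tau k)))"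

text \<open>The monomial \<open>\<phi>\<^sub>k(u\<^sub>1,\<dots>,u\<^sub>\<ell>)\<close>, where monomials \<open>u\<^sub>j\<close> are substituted for the \<open>t\<^sub>j\<close>.\<close>

definition phi_subst :: "rat mat \<Rightarrow> nat \<Rightarrow> (nat \<Rightarrow> monomial) \<Rightarrow> monomial" where
  "phi_subst A k u = (\<lambda>i. \<Sum>j = 1..dim_row A. entry A j k * u j i)"

text \<open>
  The solution of \<open>\<tau>\<^sub>k = \<phi>\<^sub>k(\<lambda>',\<lambda>'')\<close>, \<open>1 \<le> k \<le> L\<close>, for \<open>\<lambda>'\<close> in monomials in \<open>\<tau>'\<close> and \<open>\<lambda>''\<close>,
  completed by \<open>\<lambda>''\<close>: \<open>phi_inv A j\<close> is \<open>\<phi>\<^sub>j\<close> inverse for \<open>1 \<le> j \<le> L\<close>, and \<open>\<lambda>\<^sub>j\<close> for \<open>j > L\<close>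
  (and, to make the description unique, for \<open>j = 0\<close>).
\<close>

definition phi_inv :: "rat mat \<Rightarrow> nat \<Rightarrow> monomial" where
  "phi_inv A = (THE u.
     (\<forall>j\<in>{1..mat_rank A}. \<forall>i. u j i \<noteq> 0 \<longrightarrow>
        i \<in> Tau ` {1..mat_rank A} \<union> Lam ` {mat_rank A<..dim_row A}) \<and>
     (\<forall>j. j \<notin> {1..mat_rank A} \<longrightarrow> u j = mono_var (Lam j)) \<and>
     (\<forall>k\<in>{1..mat_rank A}. phi_subst A k u = mono_var (Tau k)))"

definition psi :: "rat mat \<Rightarrow> nat \<Rightarrow> monomial" where
  "psi A k = mono_mult (mono_var (Tau k)) (mono_inv (phi_subst A k (phi_inv A)))"


section \<open>Semigroups of weighted monomials\<close>

type_synonym wmono = "monomial \<times> real"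

definition wmono_mult :: "wmono \<Rightarrow> wmono \<Rightarrow> wmono" where
  "wmono_mult = (\<lambda>(f, v) (g, w). (mono_mult f g, v * w))"

definition wmono_pow :: "nat \<Rightarrow> wmono \<Rightarrow> wmono" where
  "wmono_pow N = (\<lambda>(f, v). (mono_pow f N, v ^ N))"

definition Q_closure :: "wmono set \<Rightarrow> wmono set" where
  "Q_closure S = S \<union> {(mono_inv f, inverse v) | f v. (f, v) \<in> S \<and> v \<noteq> 0}"

definition generated :: "wmono set \<Rightarrow> wmono set" where
  "generated S = {foldr wmono_mult fs (mono_one, 1) | fs. set fs \<subseteq> S}"

text \<open>In the next three definitions \<open>K\<close> is the set \<open>{k\<^sub>1,\<dots>,k\<^sub>q}\<close>.\<close>

definition part_ge :: "rat mat \<Rightarrow> nat set \<Rightarrow> wmono set \<Rightarrow> wmono set" where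
  "part_ge A K S = {(f, v) \<in> S \<inter> (H_tau A \<times> {0..}). \<forall>k\<in>K. f (Tau k) \<ge> 0}"

definition part_eq :: "rat mat \<Rightarrow> nat set \<Rightarrow> wmono set \<Rightarrow> wmono set" where
  "part_eq A K S = {(f, v) \<in> S \<inter> (H_tau A \<times> {0..}). \<forall>k\<in>K. f (Tau k) = 0}"

definition part_gt :: "rat mat \<Rightarrow> nat set \<Rightarrow> wmono set \<Rightarrow> wmono set" where
  "part_gt A K S = part_ge A K S - part_eq A K S"

definition star :: "wmono set \<Rightarrow> wmono set \<Rightarrow> wmono set" where
  "star S T = {wmono_mult f g | f g. f \<in> S \<and> g \<in> T}"

text \<open>The union is also taken when one of the two sets is empty.\<close>

definition vee :: "wmono set \<Rightarrow> wmono set \<Rightarrow> wmono set" where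
  "vee S T = S \<union> T \<union> star S T"

text \<open>The exponents \<open>N\<^sub>1\<close>, \<open>N\<^sub>2\<close> are positive; exponent 0 would make any two semigroups equivalent.\<close>

definition equivalent :: "wmono set \<Rightarrow> wmono set \<Rightarrow> bool" where
  "equivalent S T \<longleftrightarrow>
     (\<exists>N1>0. \<exists>N2>0. wmono_pow N1 ` S \<subseteq> wmono_pow N2 ` T \<and> wmono_pow N2 ` T \<subseteq> S)"


section \<open>The semigroup and the finite set attached to a point\<close>

text \<open>The point \<open>\<xi>\<close> is given by a vector \<open>x\<close> of \<open>X\<close> whose blocks are \<open>(x\<^sup>(\<^sup>0\<^sup>); \<xi>)\<close>.\<close>

definition J_Z :: "rat mat \<Rightarrow> ('n \<Rightarrow> nat) \<Rightarrow> real ^ 'n \<Rightarrow> nat set" where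
  "J_Z A blk x = {k \<in> {1..dim_col A}. block blk k x = 0}"

definition J_L :: "rat mat \<Rightarrow> ('n \<Rightarrow> nat) \<Rightarrow> real ^ 'n \<Rightarrow> nat set" where
  "J_L A blk x = J_Z A blk x \<inter> {1..mat_rank A}"

definition n_xi :: "rat mat \<Rightarrow> ('n::finite \<Rightarrow> nat) \<Rightarrow> real ^ 'n \<Rightarrow> nat \<Rightarrow> real" where
  "n_xi A blk x k =
     mono_eval A (psi A k) (\<lambda>i. if i \<in> J_L A blk x then 1 else norm (block blk i x))"

definition G_set :: "rat mat \<Rightarrow> ('n::finite \<Rightarrow> nat) \<Rightarrow> real ^ 'n \<Rightarrow> wmono set" where
  "G_set A blk x = Q_closure (
     (\<lambda>j. (phi_inv A j, 0)) ` {1..mat_rank A} \<union>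
     (\<lambda>k. (psi A k, n_xi A blk x k)) ` {mat_rank A<..dim_col A} \<union>
     (\<lambda>j. (mono_var (Lam j), 0)) ` {mat_rank A<..dim_row A})"

definition G_semi :: "rat mat \<Rightarrow> ('n::finite \<Rightarrow> nat) \<Rightarrow> real ^ 'n \<Rightarrow> wmono set" where
  "G_semi A blk x =
     vee (part_eq A (J_L A blk x) (generated (G_set A blk x)))
         (star (part_gt A (J_L A blk x) (generated (G_set A blk x))) {(mono_one, 0)})"

definition elim_F1 :: "indet \<Rightarrow> wmono set \<Rightarrow> wmono set" where
  "elim_F1 u F = {(f, v) \<in> F. f u = 0}"

definition elim_F2 :: "indet \<Rightarrow> wmono set \<Rightarrow> wmono set" where
  "elim_F2 u F = {(f, 0) | f v. (f, v) \<in> F \<and> f u > 0}"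

definition elim_F3 :: "indet \<Rightarrow> wmono set \<Rightarrow> wmono set" where
  "elim_F3 u F = {wmono_mult (wmono_pow a (f, v)) (wmono_pow b (g, w)) | f v g w a b.
     (f, v) \<in> F \<and> (g, w) \<in> F \<and> f u > 0 \<and> 0 > g u \<and>
     coprime a b \<and> of_nat a * \<bar>f u\<bar> = of_nat b * \<bar>g u\<bar>}"

definition elim_tau :: "nat \<Rightarrow> wmono set \<Rightarrow> wmono set" where
  "elim_tau k F = elim_F1 (Tau k) F \<union> elim_F2 (Tau k) F \<union> elim_F3 (Tau k) F"

definition elim_lambda :: "nat \<Rightarrow> wmono set \<Rightarrow> wmono set" where
  "elim_lambda j F = elim_F1 (Lam j) F \<union> elim_F3 (Lam j) F"

definition F0_set :: "rat mat \<Rightarrow> ('n::finite \<Rightarrow> nat) \<Rightarrow> real ^ 'n \<Rightarrow> wmono set" where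
  "F0_set A blk x = fold elim_lambda [Suc (mat_rank A)..<Suc (dim_row A)] (G_set A blk x)"

definition Fq_set :: "rat mat \<Rightarrow> ('n::finite \<Rightarrow> nat) \<Rightarrow> real ^ 'n \<Rightarrow> wmono set" where
  "Fq_set A blk x = fold elim_tau (sorted_list_of_set (J_L A blk x)) (F0_set A blk x)"


section \<open>Multicones\<close>

text \<open>The predicate \<open>conic\<close> of the library asks for stability under scaling by 0 as well.\<close>

definition pos_conic :: "'a::real_vector set \<Rightarrow> bool" where
  "pos_conic W \<longleftrightarrow> (\<forall>w\<in>W. \<forall>c>0. c *\<^sub>R w \<in> W)"

definition cone_at :: "rat mat \<Rightarrow> ('n::finite \<Rightarrow> nat) \<Rightarrow> real ^ 'n \<Rightarrow> nat \<Rightarrow> (real ^ 'n) set \<Rightarrow> bool" where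
  "cone_at A blk x k W \<longleftrightarrow>
     (if k \<in> J_Z A blk x then W = block_space blk k
      else pos_conic W \<and> W \<subseteq> block_space blk k - {0} \<and>
           openin (top_of_set (block_space blk k)) W \<and> block blk k x \<in> W)"

definition multicones ::
  "rat mat \<Rightarrow> ('n::finite \<Rightarrow> nat) \<Rightarrow> real ^ 'n \<Rightarrow> wmono set \<Rightarrow> (real ^ 'n) set set" where
  "multicones A blk x H = {V. \<exists>\<epsilon>>0. \<exists>W. (\<forall>k\<in>{1..dim_col A}. cone_at A blk x k (W k)) \<and>
     V = {y. (\<forall>k\<in>{1..dim_col A}. block blk k y \<in> W k) \<and>
             (\<forall>(g, v)\<in>H. v - \<epsilon> < mono_eval A g (\<lambda>k. norm (block blk k y)) \<and>
                         mono_eval A g (\<lambda>k. norm (block blk k y)) < v + \<epsilon>)}}"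

definition all_multicones ::
  "rat mat \<Rightarrow> ('n::finite \<Rightarrow> nat) \<Rightarrow> real ^ 'n \<Rightarrow> (real ^ 'n) set set" where
  "all_multicones A blk x = \<Union> {multicones A blk x H | H.
     finite H \<and> H \<subseteq> H_tau A \<times> {0..} \<and> equivalent (generated H) (G_semi A blk x)}"

end

theory Submission
  imports Defs
begin

text \<open>
  Taking logarithms of the \<open>|x\<^sup>(\<^sup>k\<^sup>)|\<close> and of the \<open>t\<^sub>j\<close>, membership of \<open>p\<close> in the multi-normal cone asks for
  a sequence in \<open>Z\<close> along which a system of linear conditions in the unknowns \<open>ln t\<^sub>j\<close> is asymptotically
  solvable: each weighted monomial \<open>(f, v)\<close> of \<open>G\<close> stands for the condition \<open>f \<longlongrightarrow> v\<close>, where \<open>\<tau>\<^sub>k\<close> is an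
  unknown for \<open>k \<in> J\<^sub>Z(\<xi>)\<close>, \<open>k \<le> L\<close>, subject to \<open>|x\<^sup>(\<^sup>k\<^sup>)| / \<tau>\<^sub>k \<longlongrightarrow> 0\<close>. The rules (F1)-(F3) are the steps of
  Fourier-Motzkin elimination for this system, (F2) combining the upper bounds of \<open>\<tau>\<^sub>k\<close> with the lower
  bound \<open>|x\<^sup>(\<^sup>k\<^sup>)|\<close>. Hence the conditions of \<open>F\<^sup>q\<close> suffice for the unknowns to be recovered one by one,
  while conversely all elements of \<open>\<G>\<close> converge along a sequence that reaches \<open>p\<close>. Finally \<open>F\<^sup>q\<close>
  generates a semigroup equivalent to \<open>\<G>\<close>, because a product in which an indeterminate cancels is, up to a
  bounded power, a product of pairs in which it cancels.
\<close>

section \<open>Weighted monomials\<close>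

text \<open>A block that vanishes in the limit fixes nothing: it only bounds its scaling factor from
  below. For \<open>k > L\<close> this bound is the weight 0 of \<psi>_k; as that element has no
  inverse in G, \<tau>_k enters products only with nonnegative exponent. For
  \<open>k \<le> L\<close> no element of G expresses the bound, whence the unknown \<tau>_k, which
  stands for the scaling factor itself and therefore counts as 1 in the weights. A nonzero weight is
  an equation, a zero weight a one-sided bound. Closing G under inversion puts an equation on both
  sides of an elimination, and this has to persist through all steps so that an equation can be
  solved for the unknown. Logarithms fail where blocks of the sequence vanish. After finitely many
  terms this happens only where the limit block is 0. There all exponents involved are nonnegative,
  so monomials are continuous and zeros can be replaced by tiny positive numbers. Cancelling
  rational exponents forces powers to be taken; limits survive this because all values are
  nonnegative and roots are continuous.\<close>

lemma wmono_mult_pair [simp]: "wmono_mult (f, v) (g, w) = (mono_mult f g, v * w)"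
  by (simp add: wmono_mult_def)

lemma wmono_pow_pair [simp]: "wmono_pow N (f, v) = (mono_pow f N, v ^ N)"
  by (simp add: wmono_pow_def)

lemmas mono_defs = mono_mult_def mono_one_def mono_inv_def mono_pow_def

lemma fst_wmono_mult: "fst (wmono_mult x y) u = fst x u + fst y u"
  by (cases x; cases y) (simp add: mono_mult_def)

lemma fst_wmono_pow: "fst (wmono_pow N x) u = of_nat N * fst x u"
  by (cases x) (simp add: mono_pow_def)

lemma snd_wmono_mult: "snd (wmono_mult x y) = snd x * snd y"
  by (cases x; cases y) simp

lemma snd_wmono_pow: "snd (wmono_pow N x) = snd x ^ N"
  by (cases x) simp

lemma wmono_mult_assoc: "wmono_mult (wmono_mult x y) z = wmono_mult x (wmono_mult y z)"
  by (cases x; cases y; cases z) (simp add: mono_mult_def add.assoc mult.assoc)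

lemma wmono_mult_commute: "wmono_mult x y = wmono_mult y x"
  by (cases x; cases y) (simp add: mono_mult_def add.commute mult.commute)

lemma wmono_mult_left_commute: "wmono_mult x (wmono_mult y z) = wmono_mult y (wmono_mult x z)"
  by (metis wmono_mult_assoc wmono_mult_commute)

lemmas wmono_mult_ac = wmono_mult_assoc wmono_mult_commute wmono_mult_left_commute

lemma wmono_mult_one [simp]: "wmono_mult (mono_one, 1) x = x" "wmono_mult x (mono_one, 1) = x"
  by (cases x; simp add: mono_defs)+

lemma wmono_pow_0 [simp]: "wmono_pow 0 x = (mono_one, 1)"
  by (cases x) (simp add: mono_defs)

lemma wmono_pow_one [simp]: "wmono_pow N (mono_one, 1) = (mono_one, 1)"
  by (simp add: mono_defs)

lemma wmono_pow_Suc: "wmono_pow (Suc N) x = wmono_mult x (wmono_pow N x)"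
  by (cases x) (simp add: mono_defs algebra_simps)

lemma wmono_pow_mult: "wmono_pow (M * N) x = wmono_pow M (wmono_pow N x)"
  by (cases x) (simp add: mono_defs algebra_simps power_mult[symmetric])

lemma wmono_pow_distrib: "wmono_pow N (wmono_mult x y) = wmono_mult (wmono_pow N x) (wmono_pow N y)"
  by (cases x; cases y) (simp add: mono_defs algebra_simps power_mult_distrib)

abbreviation wmono_prod :: "wmono list \<Rightarrow> wmono" where
  "wmono_prod xs \<equiv> foldr wmono_mult xs (mono_one, 1)"

lemma generated_one: "(mono_one, 1) \<in> generated S"
  unfolding generated_def by (auto intro!: exI[of _ "[]"])

lemma generated_Cons:
  assumes "x \<in> S" "h \<in> generated S"
  shows "wmono_mult x h \<in> generated S"
proof -
  obtain fs where "h = wmono_prod fs" "set fs \<subseteq> S"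
    using assms(2) by (auto simp: generated_def)
  then show ?thesis
    unfolding generated_def using assms(1) by (auto intro!: exI[of _ "x # fs"])
qed

lemma generated_induct [consumes 1, case_names one mult]:
  assumes "h \<in> generated S"
    and "P (mono_one, 1)"
    and "\<And>x h. x \<in> S \<Longrightarrow> h \<in> generated S \<Longrightarrow> P h \<Longrightarrow> P (wmono_mult x h)"
  shows "P h"
proof -
  obtain fs where "h = wmono_prod fs" "set fs \<subseteq> S"
    using assms(1) by (auto simp: generated_def)
  then show ?thesis
  proof (induction fs arbitrary: h)
    case Nil
    then show ?case using assms(2) by simp
  next
    case (Cons x fs)
    then have "wmono_prod fs \<in> generated S"
      by (auto simp: generated_def)
    then show ?case using Cons assms(3) by auto
  qed
qed

lemma generated_base: "x \<in> S \<Longrightarrow> x \<in> generated S"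
  using generated_Cons[OF _ generated_one] by simp

lemma generated_mult:
  assumes "g \<in> generated S" "h \<in> generated S"
  shows "wmono_mult g h \<in> generated S"
  using assms by (induction rule: generated_induct) (auto simp: wmono_mult_assoc intro: generated_Cons)

lemma generated_pow: "h \<in> generated S \<Longrightarrow> wmono_pow N h \<in> generated S"
  by (induction N) (auto simp: generated_one wmono_pow_Suc intro: generated_mult)

lemma generated_subset:
  assumes "S \<subseteq> generated T"
  shows "generated S \<subseteq> generated T"
proof
  fix h assume "h \<in> generated S"
  then show "h \<in> generated T"
    using assms by (induction rule: generated_induct) (auto intro: generated_one generated_mult)
qed


section \<open>Elimination of one indeterminate\<close>

text \<open>Rule (F2) is tied to a flag because only a \<tau>_k has a lower bound from outside the
  set, the block norm. For a \<lambda>_j, an element without partner of opposite sign imposes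
  nothing on the others and is dropped.\<close>

definition elim :: "bool \<Rightarrow> indet \<Rightarrow> wmono set \<Rightarrow> wmono set" where
  "elim B u F = elim_F1 u F \<union> (if B then elim_F2 u F else {}) \<union> elim_F3 u F"

lemma elim_F1_iff: "x \<in> elim_F1 u F \<longleftrightarrow> x \<in> F \<and> fst x u = 0"
  by (cases x) (simp add: elim_F1_def)

lemma elim_tau_eq: "elim_tau k = elim True (Tau k)"
  by (rule ext) (simp add: elim_tau_def elim_def)

lemma elim_lambda_eq: "elim_lambda j = elim False (Lam j)"
  by (rule ext) (simp add: elim_lambda_def elim_def)

lemma commensurable:
  assumes "c > 0" "r > (0::rat)"
  obtains k e :: nat where "k > 0" "e > 0" "of_nat k * c = of_nat e * r"
proof -
  obtain p q where pq: "quotient_of (c / r) = (p, q)" by fastforce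
  have q: "q > 0" using pq by (rule quotient_of_denom_pos)
  have eq: "c / r = of_int p / of_int q" using pq by (rule quotient_of_div)
  have "of_int p > (0::rat)"
    using eq q assms by (metis divide_pos_pos of_int_0_less_iff zero_less_divide_iff order_less_asym)
  then have p: "p > 0" by simp
  have "of_nat (nat q) * c = of_nat (nat p) * r"
    using eq p q assms by (simp add: field_simps)
  with p q show thesis by (intro that[of "nat q" "nat p"]) auto
qed

text \<open>Serves to bring all nonzero exponents of one indeterminate to a common absolute value
  \<open>c\<close>, so that opposite factors cancel in pairs.\<close>

lemma common_multiple:
  assumes "finite R" "\<forall>r\<in>R. r > (0::rat)"
  shows "\<exists>c>0. \<exists>e::rat \<Rightarrow> nat. \<forall>r\<in>R. e r > 0 \<and> of_nat (e r) * r = c"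
  using assms
proof (induction R)
  case empty
  then show ?case by (auto intro!: exI[of _ 1])
next
  case (insert r R)
  then obtain c e where c: "c > 0" and e: "\<forall>r\<in>R. (e r :: nat) > 0 \<and> of_nat (e r) * r = c" by auto
  obtain k m :: nat where km: "k > 0" "m > 0" "of_nat k * c = of_nat m * r"
    using commensurable[of c r] c insert.prems by auto
  show ?case
    using c km(1,2) e insert.hyps
    by (intro exI[of _ "of_nat k * c"] conjI exI[of _ "\<lambda>s. if s = r then m else k * e s"])
      (auto simp: km(3)[symmetric])
qed

text \<open>The existential \<open>a\<close>, \<open>b\<close> of rule (F3) are determined by the
  ratio of the two exponents; hence a pair of elements contributes at most one product, and the rule
  preserves finiteness.\<close>

lemma coprime_pair_unique:
  assumes "of_nat a * r = of_nat b * s" "of_nat a' * r = of_nat b' * s" "r > 0" "s > (0::rat)"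
    and "coprime a b" "coprime a' b'"
  shows "a = a'" "b = b'"
proof -
  have *: "(of_nat a :: rat) = of_nat b * (s / r)" "(of_nat a' :: rat) = of_nat b' * (s / r)"
    using assms by (auto simp: field_simps)
  have "of_nat (a * b') = (of_nat (b * a') :: rat)" by (simp add: *)
  then have "a * b' = a' * b" by (simp only: of_nat_eq_iff mult.commute)
  then have "a = a' \<and> b = b'"
    using coprime_crossproduct_nat[of a b a' b'] assms(5,6) by (simp add: mult.commute)
  then show "a = a'" "b = b'" by auto
qed

text \<open>Both exponents of \<open>u\<close> are nonzero, so neither \<open>a\<close> nor
  \<open>b\<close> can be 0. This is recorded because a weight 0 has to stay 0 under these powers,
  while \<open>0 ^ 0 = 1\<close>.\<close>

lemma elim_F3E:
  assumes "z \<in> elim_F3 u F"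
  obtains x y a b where "x \<in> F" "y \<in> F" "fst x u > 0" "fst y u < 0" "coprime a b" "a > 0" "b > 0"
    "of_nat a * \<bar>fst x u\<bar> = of_nat b * \<bar>fst y u\<bar>"
    "z = wmono_mult (wmono_pow a x) (wmono_pow b y)"
proof -
  from assms obtain f v g w a b where *: "z = wmono_mult (wmono_pow a (f, v)) (wmono_pow b (g, w))"
     "(f, v) \<in> F" "(g, w) \<in> F" "f u > 0" "0 > g u" "coprime a b"
     "of_nat a * \<bar>f u\<bar> = of_nat b * \<bar>g u\<bar>"
    unfolding elim_F3_def by auto
  have "a > 0 \<and> b > 0"
    using *(4-7) by (cases "a = 0"; cases "b = 0") auto
  with * show thesis by (intro that[of "(f, v)" "(g, w)" a b]) auto
qed

lemma elim_F3E_pair: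
  assumes "(f, v) \<in> elim_F3 u F"
  obtains g v1 h v2 a b where "(g, v1) \<in> F" "(h, v2) \<in> F" "g u > 0" "h u < 0" "coprime a b"
    "a > 0" "b > 0" "of_nat a * \<bar>g u\<bar> = of_nat b * \<bar>h u\<bar>"
    "f = mono_mult (mono_pow g a) (mono_pow h b)" "v = v1 ^ a * v2 ^ b"
  using assms
proof (rule elim_F3E)
  fix x y :: wmono and a b
  assume *: "x \<in> F" "y \<in> F" "fst x u > 0" "fst y u < 0" "coprime a b" "a > 0" "b > 0"
    "of_nat a * \<bar>fst x u\<bar> = of_nat b * \<bar>fst y u\<bar>"
    "(f, v) = wmono_mult (wmono_pow a x) (wmono_pow b y)"
  show thesis
  proof (rule that)
    show "(fst x, snd x) \<in> F" "(fst y, snd y) \<in> F" using * by simp_all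
    show "f = mono_mult (mono_pow (fst x) a) (mono_pow (fst y) b)" "v = snd x ^ a * snd y ^ b"
      using arg_cong[OF *(9), of fst] arg_cong[OF *(9), of snd]
      by (simp_all add: wmono_mult_def wmono_pow_def case_prod_unfold)
    show "fst x u > 0" "fst y u < 0" "coprime a b" "a > 0" "b > 0"
      "of_nat a * \<bar>fst x u\<bar> = of_nat b * \<bar>fst y u\<bar>" by fact+
  qed
qed

lemma finite_elim_F3:
  assumes "finite F"
  shows "finite (elim_F3 u F)"
proof -
  let ?P = "\<lambda>x y. {(a, b). coprime a b \<and> fst x u > 0 \<and> 0 > fst y u \<and>
    of_nat a * \<bar>fst x u\<bar> = of_nat b * \<bar>fst y u\<bar>} :: (nat \<times> nat) set"
  have "finite (?P x y)" for x y :: wmono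
  proof (cases "?P x y = {}")
    case True
    then show ?thesis by (rule ssubst) simp
  next
    case False
    then obtain a b where ab: "(a, b) \<in> ?P x y" by blast
    have "?P x y \<subseteq> {(a, b)}"
      using ab coprime_pair_unique[of _ "\<bar>fst x u\<bar>" _ "\<bar>fst y u\<bar>" a b] by auto
    then show ?thesis by (rule finite_subset) simp
  qed
  moreover have "elim_F3 u F \<subseteq> (\<Union>x\<in>F. \<Union>y\<in>F.
      (\<lambda>(a, b). wmono_mult (wmono_pow a x) (wmono_pow b y)) ` ?P x y)"
  proof
    fix z assume "z \<in> elim_F3 u F"
    then obtain x y a b where *: "x \<in> F" "y \<in> F" "(a, b) \<in> ?P x y"
        "z = wmono_mult (wmono_pow a x) (wmono_pow b y)"
      by (elim elim_F3E) auto
    show "z \<in> (\<Union>x\<in>F. \<Union>y\<in>F. (\<lambda>(a, b). wmono_mult (wmono_pow a x) (wmono_pow b y)) ` ?P x y)"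
      by (rule UN_I[OF *(1)], rule UN_I[OF *(2)], rule image_eqI[OF _ *(3)]) (simp add: *(4))
  qed
  ultimately show ?thesis
    using assms by (meson finite_UN_I finite_imageI finite_subset)
qed

lemma finite_elim:
  assumes "finite F"
  shows "finite (elim B u F)"
proof -
  have "finite (elim_F1 u F)" using assms by (auto simp: elim_F1_def intro: finite_subset)
  moreover have "elim_F2 u F \<subseteq> (\<lambda>(f, v). (f, 0)) ` F" by (auto simp: elim_F2_def image_iff)
  then have "finite (elim_F2 u F)" using assms by (meson finite_imageI finite_subset)
  ultimately show ?thesis using finite_elim_F3[OF assms] by (simp add: elim_def)
qed

lemma elim_F3I:
  assumes "x \<in> F" "y \<in> F" "fst x u > 0" "fst y u < 0" "coprime a b"
    and "of_nat a * \<bar>fst x u\<bar> = of_nat b * \<bar>fst y u\<bar>"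
  shows "wmono_mult (wmono_pow a x) (wmono_pow b y) \<in> elim_F3 u F"
proof -
  obtain f v g w where "x = (f, v)" "y = (g, w)" by (cases x; cases y)
  with assms show ?thesis
    unfolding elim_F3_def by (intro CollectI exI[of _ f] exI[of _ v] exI[of _ g] exI[of _ w]
        exI[of _ a] exI[of _ b]) simp
qed

lemma fst_wmono_prod_const:
  assumes "\<forall>x\<in>set xs. fst x u = c"
  shows "fst (wmono_prod xs) u = of_nat (length xs) * c"
  using assms by (induction xs) (auto simp: fst_wmono_mult mono_one_def algebra_simps)

text \<open>Factors of opposite exponents are cancelled one by one while the product is read off.\<close>

lemma cancel_opposite:
  assumes T: "\<forall>x\<in>T. fst x u \<in> {c, - c, 0}" and h: "h \<in> generated T"
  shows "\<exists>g\<in>generated (elim_F1 u T \<union> {wmono_mult x y | x y. x \<in> T \<and> y \<in> T \<and> fst x u = c \<and> fst y u = - c}).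
    \<exists>xs. h = wmono_mult g (wmono_prod xs) \<and> set xs \<subseteq> T \<and>
      ((\<forall>x\<in>set xs. fst x u = c) \<or> (\<forall>x\<in>set xs. fst x u = - c))"
    (is "\<exists>g\<in>generated ?S. \<exists>xs. ?Q h g xs")
  using h
proof (induction rule: generated_induct)
  case one
  show ?case by (intro bexI[OF _ generated_one] exI[of _ "[]"]) simp
next
  case (mult x h)
  then obtain g xs where g: "g \<in> generated ?S" and h: "h = wmono_mult g (wmono_prod xs)"
    and xs: "set xs \<subseteq> T" "(\<forall>x\<in>set xs. fst x u = c) \<or> (\<forall>x\<in>set xs. fst x u = - c)"
    by blast
  have keep: ?case if "(\<forall>y\<in>set (x # xs). fst y u = c) \<or> (\<forall>y\<in>set (x # xs). fst y u = - c)"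
  proof (intro bexI[OF _ g] exI[of _ "x # xs"] conjI)
    show "wmono_mult x h = wmono_mult g (wmono_prod (x # xs))"
      unfolding h by (simp add: wmono_mult_left_commute)
    show "set (x # xs) \<subseteq> T" using xs(1) mult.hyps by simp
  qed (rule that)
  have cancel: ?case if "xs = y # ys" "wmono_mult x y \<in> ?S" for y ys
  proof (intro bexI[OF _ generated_Cons[OF that(2) g]] exI[of _ ys] conjI)
    show "wmono_mult x h = wmono_mult (wmono_mult (wmono_mult x y) g) (wmono_prod ys)"
      unfolding h that(1) by (simp add: wmono_mult_ac)
    show "set ys \<subseteq> T" using xs(1) that(1) by simp
    show "(\<forall>x\<in>set ys. fst x u = c) \<or> (\<forall>x\<in>set ys. fst x u = - c)" using xs(2) that(1) by auto
  qed
  show ?case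
  proof (cases "fst x u = 0")
    case True
    then have "x \<in> elim_F1 u T" using mult.hyps by (simp add: elim_F1_iff)
    then have "x \<in> ?S" by (rule UnI1)
    then have "wmono_mult x g \<in> generated ?S" using g by (rule generated_Cons)
    moreover have "wmono_mult x h = wmono_mult (wmono_mult x g) (wmono_prod xs)"
      unfolding h by (simp add: wmono_mult_assoc)
    ultimately show ?thesis using xs by blast
  next
    case False
    then have x: "fst x u = c \<or> fst x u = - c" using T mult.hyps by auto
    show ?thesis
    proof (cases xs)
      case Nil
      then show ?thesis using keep x by auto
    next
      case (Cons y ys)
      then have y: "y \<in> T" using xs by auto
      have "wmono_mult x y \<in> ?S" if "fst x u = c" "fst y u = - c"
        using that y mult.hyps by blast
      moreover have "wmono_mult x y \<in> ?S" if "fst y u = c" "fst x u = - c"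
        using that y mult.hyps wmono_mult_commute[of x y] by blast
      ultimately show ?thesis
        using x xs(2) Cons keep cancel[OF Cons] by auto
    qed
  qed
qed

text \<open>Up to the power \<open>M\<close>, a product splits into factors with
  \<open>u\<close>-exponent \<open>c\<close>, \<open>- c\<close> or 0. After pairwise cancellation
  only factors of one sign remain, and the exponent of the product tells how many: none if it is 0,
  positive ones if it is positive, and these rule (F2) supplies with weight 0. \<open>M\<close>
  depends on \<open>F\<close> and \<open>u\<close> alone, which equivalence of semigroups
  requires.\<close>

lemma generated_elim:
  assumes F: "finite F"
  shows "\<exists>M>0. \<forall>(f, v)\<in>generated F.
    (f u = 0 \<longrightarrow> wmono_pow M (f, v) \<in> generated (elim B u F)) \<and>
    (B \<longrightarrow> f u > 0 \<longrightarrow> (mono_pow f M, 0) \<in> generated (elim B u F))"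
proof -
  define R where "R = {\<bar>fst x u\<bar> | x. x \<in> F \<and> fst x u \<noteq> 0}"
  have "R \<subseteq> (\<lambda>x. \<bar>fst x u\<bar>) ` F" unfolding R_def by blast
  then have R: "finite R" using F by (meson finite_imageI finite_subset)
  have "\<forall>r\<in>R. r > 0" by (auto simp: R_def)
  then obtain c e where c: "c > 0" and e: "\<forall>r\<in>R. (e r :: nat) > 0 \<and> of_nat (e r) * r = c"
    using common_multiple[OF R] by blast
  define tok where "tok x = (if fst x u = 0 then x else wmono_pow (e \<bar>fst x u\<bar>) x)" for x :: wmono
  \<comment> \<open>Divisible by every \<open>e r\<close>, so the \<open>M\<close>-th power of each
    generator is a power of its \<open>tok\<close>.\<close>
  define M where "M = prod e R"
  let ?E = "generated (elim B u F)"
  let ?T = "tok ` F"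
  have M: "M > 0" unfolding M_def using e R by (intro prod_pos) auto
  have eR: "e \<bar>fst x u\<bar> > 0" "of_nat (e \<bar>fst x u\<bar>) * \<bar>fst x u\<bar> = c" if "x \<in> F" "fst x u \<noteq> 0" for x
  proof -
    have "\<bar>fst x u\<bar> \<in> R" using that unfolding R_def by blast
    then show "e \<bar>fst x u\<bar> > 0" "of_nat (e \<bar>fst x u\<bar>) * \<bar>fst x u\<bar> = c" using e by blast+
  qed
  have tok_u: "fst (tok x) u = (if fst x u > 0 then c else if fst x u < 0 then - c else 0)" if "x \<in> F" for x
  proof (cases "fst x u = 0")
    case False
    then have "fst (tok x) u = of_nat (e \<bar>fst x u\<bar>) * fst x u" by (simp add: tok_def fst_wmono_pow)
    also have "\<dots> = (if fst x u > 0 then c else - c)"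
    proof (cases "fst x u > 0")
      case True
      then show ?thesis using eR(2)[OF that False] by simp
    next
      case neg: False
      then have "\<bar>fst x u\<bar> = - fst x u" by simp
      then show ?thesis using eR(2)[OF that False] neg by simp
    qed
    finally show ?thesis using False by simp
  qed (simp add: tok_def)
  have pow_tok: "wmono_pow M h \<in> generated ?T" if "h \<in> generated F" for h
    using that
  proof (induction rule: generated_induct)
    case one
    then show ?case by (simp only: wmono_pow_one generated_one)
  next
    case (mult x h)
    have "wmono_pow M x \<in> generated ?T"
    proof (cases "fst x u = 0")
      case True
      then have "x = tok x" by (simp add: tok_def)
      then show ?thesis using mult.hyps by (metis generated_base generated_pow imageI)
    next
      case False
      then have "\<bar>fst x u\<bar> \<in> R" using mult.hyps unfolding R_def by blast
      then have "e \<bar>fst x u\<bar> dvd M" unfolding M_def using R by (intro dvd_prodI) auto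
      then obtain d where "M = d * e \<bar>fst x u\<bar>" by (metis dvd_def mult.commute)
      then have "wmono_pow M x = wmono_pow d (tok x)"
        using False by (simp add: tok_def wmono_pow_mult)
      then show ?thesis using mult.hyps by (metis generated_base generated_pow imageI)
    qed
    then show ?case using mult.IH by (simp add: wmono_pow_distrib generated_mult)
  qed
  let ?S = "elim_F1 u ?T \<union> {wmono_mult x y | x y. x \<in> ?T \<and> y \<in> ?T \<and> fst x u = c \<and> fst y u = - c}"
  have tok_c: "fst x u > 0" if "fst (tok x) u = c" "x \<in> F" for x
    using that tok_u[of x] c by (auto split: if_splits)
  have tok_mc: "fst x u < 0" if "fst (tok x) u = - c" "x \<in> F" for x
    using that tok_u[of x] c by (auto split: if_splits)
  have "?S \<subseteq> ?E"
  proof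
    fix z assume "z \<in> ?S"
    then consider x where "x \<in> F" "z = tok x" "fst (tok x) u = 0"
      | x y where "x \<in> F" "y \<in> F" "z = wmono_mult (tok x) (tok y)"
          "fst (tok x) u = c" "fst (tok y) u = - c"
      unfolding Un_iff elim_F1_iff by blast
    then show "z \<in> ?E"
    proof cases
      case 1
      then have "fst x u = 0" using tok_u[of x] c by (auto split: if_splits)
      then have "z = x" "x \<in> elim_F1 u F" using 1 by (simp_all add: tok_def elim_F1_iff)
      then show ?thesis by (intro generated_base) (simp add: elim_def)
    next
      case 2
      have pos: "fst x u > 0" "fst y u < 0" using 2 tok_c tok_mc by auto
      \<comment> \<open>The multipliers that produce \<open>c\<close> and \<open>- c\<close> need
        not be coprime. Dividing by their gcd gives the pair of rule (F3), and the cancelled product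
        is a power of that element.\<close>
      define a b where "a = e \<bar>fst x u\<bar>" and "b = e \<bar>fst y u\<bar>"
      have ab: "a > 0" "b > 0" "of_nat a * \<bar>fst x u\<bar> = of_nat b * \<bar>fst y u\<bar>"
        using eR[of x] eR[of y] 2(1,2) pos unfolding a_def b_def by simp_all
      obtain a' b' where ab': "a = a' * gcd a b" "b = b' * gcd a b" "coprime a' b'"
        using gcd_coprime_exists[of a b] ab by auto
      have "of_nat (gcd a b) * (of_nat a' * \<bar>fst x u\<bar>) = of_nat (gcd a b) * (of_nat b' * \<bar>fst y u\<bar>)"
      proof -
        have "of_nat (gcd a b) * (of_nat a' * \<bar>fst x u\<bar>) = of_nat (a' * gcd a b) * \<bar>fst x u\<bar>" by simp
        also have "\<dots> = of_nat (b' * gcd a b) * \<bar>fst y u\<bar>" using ab(3) ab'(1,2) by presburger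
        finally show ?thesis by (simp add: mult_ac)
      qed
      then have eq: "of_nat a' * \<bar>fst x u\<bar> = of_nat b' * \<bar>fst y u\<bar>"
        using ab by simp
      have "tok x = wmono_pow (gcd a b) (wmono_pow a' x)"
        using pos ab'(1) by (metis a_def less_irrefl mult.commute tok_def wmono_pow_mult)
      moreover have "tok y = wmono_pow (gcd a b) (wmono_pow b' y)"
        using pos ab'(2) by (metis b_def less_irrefl mult.commute tok_def wmono_pow_mult)
      ultimately have "z = wmono_pow (gcd a b) (wmono_mult (wmono_pow a' x) (wmono_pow b' y))"
        using 2 by (simp add: wmono_pow_distrib)
      moreover have "wmono_mult (wmono_pow a' x) (wmono_pow b' y) \<in> elim_F3 u F"
        using 2 pos ab'(3) eq by (intro elim_F3I)
      then have "wmono_mult (wmono_pow a' x) (wmono_pow b' y) \<in> ?E"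
        by (intro generated_base) (simp add: elim_def)
      ultimately show ?thesis using generated_pow by metis
    qed
  qed
  then have S: "generated ?S \<subseteq> ?E" by (rule generated_subset)
  have S0: "fst g u = 0" if "g \<in> generated ?S" for g
    using that
  proof (induction rule: generated_induct)
    case (mult x h)
    have "fst x u = 0"
      using mult.hyps(1) by (elim UnE CollectE exE conjE) (simp_all add: elim_F1_iff fst_wmono_mult)
    then show ?case using mult.IH by (simp add: fst_wmono_mult)
  qed (simp add: mono_one_def)
  have main: "(fst h u = 0 \<longrightarrow> wmono_pow M h \<in> ?E) \<and>
      (B \<longrightarrow> fst h u > 0 \<longrightarrow> (fst (wmono_pow M h), 0) \<in> ?E)" if h: "h \<in> generated F" for h
  proof -
    have "\<forall>x\<in>?T. fst x u \<in> {c, - c, 0}" using tok_u by auto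
    from cancel_opposite[OF this pow_tok[OF h]]
    obtain g xs where g: "g \<in> generated ?S" and h_eq: "wmono_pow M h = wmono_mult g (wmono_prod xs)"
      and xs: "set xs \<subseteq> ?T" "(\<forall>x\<in>set xs. fst x u = c) \<or> (\<forall>x\<in>set xs. fst x u = - c)"
      by blast
    have hu: "of_nat M * fst h u = fst (wmono_prod xs) u"
      using arg_cong[OF h_eq, of "\<lambda>z. fst z u"] S0[OF g] by (simp add: fst_wmono_pow fst_wmono_mult)
    have len: "fst (wmono_prod xs) u = of_nat (length xs) * c \<and> (\<forall>x\<in>set xs. fst x u = c)
       \<or> fst (wmono_prod xs) u = of_nat (length xs) * (- c)"
      using xs(2) fst_wmono_prod_const by blast
    show ?thesis
    proof (intro conjI impI)
      assume "fst h u = 0"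
      then have "xs = []" using hu len c by auto
      then show "wmono_pow M h \<in> ?E" using h_eq g S by auto
    next
      assume B: B and pos: "fst h u > 0"
      have "of_nat M * fst h u > 0" using pos M by simp
      then have gt: "fst (wmono_prod xs) u > 0" using hu by simp
      then have ne: "xs \<noteq> []" by (cases xs) (simp_all add: mono_one_def)
      have "\<not> fst (wmono_prod xs) u = of_nat (length xs) * (- c)"
        using gt c by (smt (verit, ccfv_SIG) mult_nonneg_nonpos neg_le_0_iff_le not_less of_nat_0_le_iff order_less_imp_le)
      then have xsc: "\<forall>x\<in>set xs. fst x u = c"
        using len by blast
      \<comment> \<open>The leftovers with their weights set to 0, the form in which (F2) yields
        them; the list is nonempty, so the whole product gets weight 0.\<close>
      define ys where "ys = map (\<lambda>x. (fst x, 0::real)) xs"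
      have ysE: "wmono_prod ys \<in> ?E"
      proof -
        have "set ys \<subseteq> ?E"
        proof
          fix y assume "y \<in> set ys"
          then obtain x where x: "x \<in> F" "y = (fst (tok x), 0)" "fst (tok x) u = c"
            using xs(1) xsc unfolding ys_def set_map by blast
          then have "fst x u > 0" using tok_c by auto
          then have "(fst x, 0) \<in> elim_F2 u F" using x(1) unfolding elim_F2_def by (cases x) auto
          then have "(fst x, 0) \<in> ?E" using B by (intro generated_base) (simp add: elim_def)
          moreover have "y = wmono_pow (e \<bar>fst x u\<bar>) (fst x, 0)"
            using x \<open>fst x u > 0\<close> eR(1)[of x] by (cases x) (auto simp: tok_def)
          ultimately show "y \<in> ?E" using generated_pow by metis
        qed
        then show ?thesis
          by (induction ys) (auto intro: generated_one generated_mult)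
      qed
      have "fst (wmono_prod (map (\<lambda>x. (fst x, 0::real)) zs)) = fst (wmono_prod zs)" for zs
        by (induction zs) (auto simp: fst_wmono_mult)
      then have "fst (wmono_prod ys) = fst (wmono_prod xs)" by (simp add: ys_def)
      moreover have "snd (wmono_prod ys) = 0"
        using ne by (cases xs) (auto simp: ys_def snd_wmono_mult)
      ultimately have "wmono_mult g (wmono_prod ys) = (fst (wmono_pow M h), 0)"
        using h_eq by (intro prod_eqI ext) (auto simp: fst_wmono_mult snd_wmono_mult)
      then show "(fst (wmono_pow M h), 0) \<in> ?E"
        using generated_mult[OF _ ysE, of g] g S by auto
    qed
  qed
  show ?thesis
  proof (intro exI[of _ M] conjI M ballI, clarify)
    fix f v assume "(f, v) \<in> generated F"
    from main[OF this] show "(f u = 0 \<longrightarrow> wmono_pow M (f, v) \<in> ?E) \<and>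
        (B \<longrightarrow> f u > 0 \<longrightarrow> (mono_pow f M, 0) \<in> ?E)"
      by simp
  qed
qed

section \<open>Iterated elimination\<close>

text \<open>
  In a list of pairs \<open>(B, u)\<close> the flag \<open>B\<close> tells whether rule (F2) is applied when \<open>u\<close> is eliminated,
  so that both \<open>F\<^sup>0\<close> and \<open>F\<^sup>q\<close> are instances.
\<close>

definition elims :: "(bool \<times> indet) list \<Rightarrow> wmono set \<Rightarrow> wmono set" where
  "elims us = fold (\<lambda>(B, u). elim B u) us"

lemma elims_Nil [simp]: "elims [] F = F"
  by (simp add: elims_def)

lemma elims_Cons [simp]: "elims ((B, u) # us) F = elims us (elim B u F)"
  by (simp add: elims_def)

text \<open>Nonnegativity for the \<tau>_k and absence of the \<lambda>_j in one predicate, so that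
  the induction over a list of eliminations need not treat the two kinds apart.\<close>

definition admissible :: "(bool \<times> indet) set \<Rightarrow> monomial \<Rightarrow> bool" where
  "admissible U f \<longleftrightarrow> (\<forall>B u. (B, u) \<in> U \<longrightarrow> f u \<ge> 0 \<and> (\<not> B \<longrightarrow> f u = 0))"

text \<open>Among admissible monomials this separates the analogue of \<open>part_gt\<close>, where
  weights become 0, from that of \<open>part_eq\<close>.\<close>

definition degenerate :: "(bool \<times> indet) set \<Rightarrow> monomial \<Rightarrow> bool" where
  "degenerate U f \<longleftrightarrow> (\<exists>u. (True, u) \<in> U \<and> f u > 0)"

lemma admissible_pow: "admissible U f \<Longrightarrow> admissible U (mono_pow f N)"
  unfolding admissible_def mono_pow_def by simp

lemma degenerate_pow: "N > 0 \<Longrightarrow> degenerate U (mono_pow f N) \<longleftrightarrow> degenerate U f"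
  by (simp add: degenerate_def mono_pow_def zero_less_mult_iff)

lemma admissible_mult: "admissible U f \<Longrightarrow> admissible U g \<Longrightarrow> admissible U (mono_mult f g)"
  unfolding admissible_def mono_mult_def by (metis add.right_neutral add_nonneg_nonneg)

text \<open>Nonnegative exponents cannot cancel.\<close>

lemma degenerate_mult:
  assumes "admissible U f" "admissible U g"
  shows "degenerate U (mono_mult f g) \<longleftrightarrow> degenerate U f \<or> degenerate U g"
proof -
  have "f u + g u > 0 \<longleftrightarrow> f u > 0 \<or> g u > 0" if "(True, u) \<in> U" for u
  proof -
    have "f u \<ge> 0" "g u \<ge> 0" using assms that by (auto simp: admissible_def)
    then show ?thesis by linarith
  qed
  then show ?thesis by (auto simp: degenerate_def mono_mult_def)
qed

lemma finite_elims: "finite F \<Longrightarrow> finite (elims us F)"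
proof (induction us arbitrary: F)
  case (Cons Bu us)
  then show ?case using finite_elim by (cases Bu) simp
qed simp

text \<open>Completeness of elimination: the powers needed in the single steps multiply, and a
  weight that has once become 0 stays 0 since the later powers are positive.\<close>

lemma generated_elims:
  assumes "finite F"
  shows "\<exists>M>0. \<forall>f v. (f, v) \<in> generated F \<longrightarrow> admissible (set us) f \<longrightarrow>
    (mono_pow f M, if degenerate (set us) f then 0 else v ^ M) \<in> generated (elims us F)"
  using assms
proof (induction us arbitrary: F)
  case Nil
  show ?case by (intro exI[of _ 1]) (simp add: degenerate_def mono_pow_def)
next
  case (Cons Bu us)
  obtain B u where Bu: "Bu = (B, u)" by (cases Bu)
  let ?F = "elim B u F"
  obtain M1 where M1: "M1 > 0" "\<And>f v. (f, v) \<in> generated F \<Longrightarrow> f u = 0 \<Longrightarrow> wmono_pow M1 (f, v) \<in> generated ?F"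
      "\<And>f v. (f, v) \<in> generated F \<Longrightarrow> B \<Longrightarrow> f u > 0 \<Longrightarrow> (mono_pow f M1, 0) \<in> generated ?F"
    using generated_elim[OF Cons.prems, of u B] by blast
  obtain M2 where M2: "M2 > 0" "\<And>f v. (f, v) \<in> generated ?F \<Longrightarrow> admissible (set us) f \<Longrightarrow>
      (mono_pow f M2, if degenerate (set us) f then 0 else v ^ M2) \<in> generated (elims us ?F)"
    using Cons.IH[OF finite_elim[OF Cons.prems]] by blast
  show ?case
  proof (intro exI[of _ "M1 * M2"] conjI allI impI)
    fix f v assume f: "(f, v) \<in> generated F" "admissible (set (Bu # us)) f"
    define v1 where "v1 = (if f u > 0 then 0 else v ^ M1)"
    have adm: "f u \<ge> 0" "\<not> B \<longrightarrow> f u = 0" "admissible (set us) f"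
      using f(2) by (auto simp: admissible_def Bu)
    have "(mono_pow f M1, v1) \<in> generated ?F"
    proof (cases "f u = 0")
      case True
      then show ?thesis using M1(2)[OF f(1)] by (simp add: v1_def)
    next
      case False
      then have "f u > 0" B using adm by auto
      then show ?thesis using M1(3)[OF f(1)] by (simp add: v1_def)
    qed
    from M2(2)[OF this admissible_pow[OF adm(3)]]
    have "(mono_pow (mono_pow f M1) M2, if degenerate (set us) f then 0 else v1 ^ M2) \<in> generated (elims us ?F)"
      by (simp add: degenerate_pow[OF M1(1)])
    moreover have "mono_pow (mono_pow f M1) M2 = mono_pow f (M1 * M2)"
      by (simp add: mono_pow_def mult_ac)
    moreover have "degenerate (set (Bu # us)) f \<longleftrightarrow> f u > 0 \<or> degenerate (set us) f"
      using adm by (auto simp: degenerate_def Bu)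
    ultimately show "(mono_pow f (M1 * M2), if degenerate (set (Bu # us)) f then 0 else v ^ (M1 * M2))
        \<in> generated (elims (Bu # us) F)"
      using M2(1) by (simp add: Bu v1_def power_mult zero_power split: if_splits)
  qed (use M1(1) M2(1) in simp)
qed

text \<open>Soundness of elimination as an invariant: (F2) may overwrite a weight, but only by 0 and
  only while a positive exponent of an eliminated \<tau>_k remains visible in the monomial.\<close>

definition descends :: "(bool \<times> indet) set \<Rightarrow> wmono set \<Rightarrow> wmono set \<Rightarrow> bool" where
  "descends U S F \<longleftrightarrow> (\<forall>f v. (f, v) \<in> F \<longrightarrow> admissible U f \<and>
     (\<exists>w. (f, w) \<in> generated S \<and> v = (if degenerate U f then 0 else w)))"

text \<open>In (F3) the exponents of previously eliminated indeterminates are nonnegative and cannot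
  cancel, so the product is degenerate exactly if a factor is. This matches its weight, a product of
  positive powers that vanishes as soon as one factor is degenerate.\<close>

lemma descends_elim:
  assumes F: "descends U S F"
  shows "descends (insert (B, u) U) S (elim B u F)"
  unfolding descends_def
proof (intro allI impI)
  fix f v assume "(f, v) \<in> elim B u F"
  then consider (F1) "(f, v) \<in> F" "f u = 0" | (F2) w where B "v = 0" "(f, w) \<in> F" "f u > 0"
    | (F3) "(f, v) \<in> elim_F3 u F"
    by (auto simp: elim_def elim_F1_def elim_F2_def split: if_splits)
  then show "admissible (insert (B, u) U) f \<and>
      (\<exists>w. (f, w) \<in> generated S \<and> v = (if degenerate (insert (B, u) U) f then 0 else w))"
  proof cases
    case F1
    then obtain w where w: "(f, w) \<in> generated S" "v = (if degenerate U f then 0 else w)" "admissible U f"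
      using F unfolding descends_def by blast
    have "admissible (insert (B, u) U) f" "degenerate (insert (B, u) U) f \<longleftrightarrow> degenerate U f"
      using w(3) F1 by (auto simp: admissible_def degenerate_def)
    then show ?thesis using w by auto
  next
    case F2
    then have "admissible U f" "\<exists>w. (f, w) \<in> generated S"
      using F unfolding descends_def by blast+
    then have "admissible (insert (B, u) U) f" "\<exists>w. (f, w) \<in> generated S"
      using F2 by (auto simp: admissible_def)
    moreover have "degenerate (insert (B, u) U) f"
      using F2 by (auto simp: degenerate_def)
    ultimately show ?thesis using F2 by auto
  next
    case F3
    then obtain g v1 h v2 a b where *: "(g, v1) \<in> F" "(h, v2) \<in> F" "g u > 0" "h u < 0"
      "a > 0" "b > 0" "of_nat a * \<bar>g u\<bar> = of_nat b * \<bar>h u\<bar>"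
      and f: "f = mono_mult (mono_pow g a) (mono_pow h b)" and v: "v = v1 ^ a * v2 ^ b"
      by (rule elim_F3E_pair)
    let ?g = "mono_pow g a" and ?h = "mono_pow h b"
    obtain w1 w2 where w: "(g, w1) \<in> generated S" "v1 = (if degenerate U g then 0 else w1)"
        "(h, w2) \<in> generated S" "v2 = (if degenerate U h then 0 else w2)"
      and adm: "admissible U g" "admissible U h"
      using F *(1,2) unfolding descends_def by blast
    have "f u = 0"
      using *(3,4,7) by (simp add: f mono_mult_def mono_pow_def)
    moreover have "admissible U f"
      unfolding f using adm by (intro admissible_mult admissible_pow)
    ultimately have "admissible (insert (B, u) U) f"
      by (auto simp: admissible_def)
    moreover have "degenerate (insert (B, u) U) f \<longleftrightarrow> degenerate U f"
      using \<open>f u = 0\<close> by (auto simp: degenerate_def)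
    moreover have "degenerate U f \<longleftrightarrow> degenerate U g \<or> degenerate U h"
      unfolding f using adm *(5,6) by (simp add: degenerate_mult admissible_pow degenerate_pow)
    moreover have "(f, w1 ^ a * w2 ^ b) \<in> generated S"
      using generated_mult[OF generated_pow[OF w(1), of a] generated_pow[OF w(3), of b]] by (simp add: f)
    ultimately show ?thesis
      using w(2,4) *(5,6) v by (auto simp: zero_power)
  qed
qed

lemma descends_elims:
  assumes "descends U S F"
  shows "descends (U \<union> set us) S (elims us F)"
  using assms
proof (induction us arbitrary: U F)
  case (Cons Bu us)
  then show ?case
    using Cons.IH[OF descends_elim] by (cases Bu) simp
qed simp

lemma descends_self: "descends {} S S"
  unfolding descends_def by (simp add: admissible_def degenerate_def generated_base)

section \<open>Invariants of elimination: inverses and signs of weights\<close>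

definition inv_closed :: "wmono set \<Rightarrow> bool" where
  "inv_closed F \<longleftrightarrow> (\<forall>f v. (f, v) \<in> F \<longrightarrow> v \<noteq> 0 \<longrightarrow> (mono_inv f, inverse v) \<in> F)"

lemma inv_closed_Q_closure: "inv_closed (Q_closure S)"
proof (unfold inv_closed_def, intro allI impI)
  fix f v assume "(f, v) \<in> Q_closure S" "v \<noteq> 0"
  then consider "(f, v) \<in> S" | g w where "(g, w) \<in> S" "w \<noteq> 0" "f = mono_inv g" "v = inverse w"
    by (auto simp: Q_closure_def)
  then show "(mono_inv f, inverse v) \<in> Q_closure S"
  proof cases
    case 1
    then show ?thesis using \<open>v \<noteq> 0\<close> unfolding Q_closure_def by blast
  next
    case 2
    then show ?thesis by (simp add: Q_closure_def mono_inv_def)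
  qed
qed

text \<open>A zero weight asks for no inverse, which settles (F2). A nonzero weight from (F3) comes
  from two factors of nonzero weight, and inverting them exchanges their signs at \<open>u\<close>,
  hence their roles and the order of the coprime powers.\<close>

lemma inv_closed_elim:
  assumes F: "inv_closed F"
  shows "inv_closed (elim B u F)"
  unfolding inv_closed_def
proof (intro allI impI)
  fix f v assume f: "(f, v) \<in> elim B u F" and v: "v \<noteq> 0"
  show "(mono_inv f, inverse v) \<in> elim B u F"
  proof (cases "(f, v) \<in> elim_F1 u F")
    case True
    then have "(mono_inv f, inverse v) \<in> elim_F1 u F"
      using F v by (simp add: elim_F1_def inv_closed_def mono_inv_def)
    then show ?thesis by (simp add: elim_def)
  next
    case False
    then have "(f, v) \<in> elim_F3 u F"
      using f v by (auto simp: elim_def elim_F2_def split: if_splits)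
    then obtain g v1 h v2 a b where *: "(g, v1) \<in> F" "(h, v2) \<in> F" "g u > 0" "h u < 0" "coprime a b"
      "a > 0" "b > 0" "of_nat a * \<bar>g u\<bar> = of_nat b * \<bar>h u\<bar>"
      "f = mono_mult (mono_pow g a) (mono_pow h b)" "v = v1 ^ a * v2 ^ b"
      by (rule elim_F3E_pair)
    have "v1 \<noteq> 0" "v2 \<noteq> 0" using *(6,7,10) v by (auto simp: zero_power)
    then have "(mono_inv g, inverse v1) \<in> F" "(mono_inv h, inverse v2) \<in> F"
      using F *(1,2) by (auto simp: inv_closed_def)
    then have "wmono_mult (wmono_pow b (mono_inv h, inverse v2)) (wmono_pow a (mono_inv g, inverse v1)) \<in> elim_F3 u F"
      using *(3-8) by (intro elim_F3I) (auto simp: mono_inv_def coprime_commute)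
    moreover have "wmono_mult (wmono_pow b (mono_inv h, inverse v2)) (wmono_pow a (mono_inv g, inverse v1))
        = (mono_inv f, inverse v)"
      using *(9,10) by (simp add: mono_defs power_inverse algebra_simps)
    ultimately show ?thesis by (simp add: elim_def)
  qed
qed

definition weights_nonneg :: "wmono set \<Rightarrow> bool" where
  "weights_nonneg F \<longleftrightarrow> (\<forall>x\<in>F. snd x \<ge> 0)"

lemma weights_nonneg_elim:
  assumes "weights_nonneg F"
  shows "weights_nonneg (elim B u F)"
proof -
  have "snd z \<ge> 0" if z: "z \<in> elim_F3 u F" for z
    using z
  proof (rule elim_F3E)
    fix x y :: wmono and a b assume "x \<in> F" "y \<in> F" "z = wmono_mult (wmono_pow a x) (wmono_pow b y)"
    then show ?thesis using assms by (simp add: weights_nonneg_def snd_wmono_mult snd_wmono_pow)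
  qed
  then show ?thesis
    using assms by (auto simp: weights_nonneg_def elim_def elim_F1_def elim_F2_def split: if_splits)
qed

lemma weights_nonneg_generated:
  assumes "weights_nonneg S" "x \<in> generated S"
  shows "snd x \<ge> 0"
  using assms(2)
proof (induction rule: generated_induct)
  case (mult x h)
  then show ?case using assms(1) by (simp add: snd_wmono_mult weights_nonneg_def)
qed simp

section \<open>Supports of monomials and the semigroup cut out by sign conditions\<close>

definition supported :: "indet set \<Rightarrow> monomial \<Rightarrow> bool" where
  "supported I f \<longleftrightarrow> (\<forall>u. f u \<noteq> 0 \<longrightarrow> u \<in> I)"

lemma supported_generated:
  assumes "\<forall>x\<in>S. supported I (fst x)" "x \<in> generated S"
  shows "supported I (fst x)"
  using assms(2)
proof (induction rule: generated_induct)
  case (mult x h)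
  have "u \<in> I" if "fst x u + fst h u \<noteq> 0" for u
  proof -
    have "fst x u \<noteq> 0 \<or> fst h u \<noteq> 0" using that by auto
    then show ?thesis using mult assms(1) unfolding supported_def by blast
  qed
  then show ?case by (simp add: supported_def fst_wmono_mult)
qed (simp add: supported_def mono_one_def)

text \<open>Brings \<open>vee\<close> and \<open>star\<close> into the form of a single weight rule:
  a product of an element of \<open>part_eq\<close> with one of the weight-zero copy of
  \<open>part_gt\<close> has a positive exponent at some \<open>k \<in> K\<close> and weight 0, so
  it obeys the same rule as its second factor.\<close>

lemma mem_semigroup_iff:
  "(f, v) \<in> vee (part_eq A K (generated S)) (star (part_gt A K (generated S)) {(mono_one, 0)}) \<longleftrightarrow>
    (\<exists>w\<ge>0. (f, w) \<in> generated S \<and> f \<in> H_tau A \<and> (\<forall>k\<in>K. f (Tau k) \<ge> 0) \<and>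
      v = (if \<exists>k\<in>K. f (Tau k) > 0 then 0 else w))"
    (is "_ \<in> vee ?E (star ?G ?Z) \<longleftrightarrow> ?R f v")
proof -
  have gt: "(f, w) \<in> ?G \<longleftrightarrow> (f, w) \<in> generated S \<and> f \<in> H_tau A \<and> w \<ge> 0 \<and> (\<forall>k\<in>K. f (Tau k) \<ge> 0) \<and>
      (\<exists>k\<in>K. f (Tau k) > 0)" for f w
    by (force simp: part_gt_def part_ge_def part_eq_def)
  have eq: "(f, w) \<in> ?E \<longleftrightarrow> (f, w) \<in> generated S \<and> f \<in> H_tau A \<and> w \<ge> 0 \<and> (\<forall>k\<in>K. f (Tau k) = 0)" for f w
    by (auto simp: part_eq_def)
  have star: "(f, v) \<in> star ?G ?Z \<longleftrightarrow> v = 0 \<and> (\<exists>w. (f, w) \<in> ?G)" for f v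
    by (force simp: star_def mono_defs)
  show ?thesis
  proof
    assume "(f, v) \<in> vee ?E (star ?G ?Z)"
    then consider "(f, v) \<in> ?E" | "(f, v) \<in> star ?G ?Z" | "(f, v) \<in> star ?E (star ?G ?Z)"
      by (auto simp: vee_def)
    then show "?R f v"
    proof cases
      case 1
      then show ?thesis unfolding eq by (intro exI[of _ v]) auto
    next
      case 2
      then obtain w where "v = 0" "(f, w) \<in> ?G" unfolding star by auto
      then show ?thesis unfolding gt by (intro exI[of _ w]) auto
    next
      case 3
      then obtain g w h where *: "(g, w) \<in> ?E" "(h, 0) \<in> star ?G ?Z" "(f, v) = wmono_mult (g, w) (h, 0)"
        unfolding star_def[of ?E] using star by auto
      then obtain w' where w': "(h, w') \<in> ?G" unfolding star by auto
      have "(f, w * w') \<in> generated S"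
        using generated_mult[of "(g, w)" S "(h, w')"] * w' by (simp add: eq gt)
      moreover have "f \<in> H_tau A"
        using * w' unfolding eq gt H_tau_def by (simp add: mono_mult_def) (metis add_0)
      ultimately show ?thesis
        using * w' unfolding eq gt by (intro exI[of _ "w * w'"]) (auto simp: mono_mult_def)
    qed
  next
    assume "?R f v"
    then obtain w where w: "w \<ge> 0" "(f, w) \<in> generated S" "f \<in> H_tau A" "\<forall>k\<in>K. f (Tau k) \<ge> 0"
      "v = (if \<exists>k\<in>K. f (Tau k) > 0 then 0 else w)" by blast
    show "(f, v) \<in> vee ?E (star ?G ?Z)"
    proof (cases "\<exists>k\<in>K. f (Tau k) > 0")
      case True
      then have "(f, v) \<in> star ?G ?Z" using w unfolding star gt by auto
      then show ?thesis by (simp add: vee_def)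
    next
      case False
      then have "\<forall>k\<in>K. f (Tau k) = 0" using w(4) by force
      then have "(f, v) \<in> ?E" using w False unfolding eq by auto
      then show ?thesis by (simp add: vee_def)
    qed
  qed
qed

locale elimination =
  fixes A :: "rat mat" and js ks :: "nat list" and S :: "wmono set"
  assumes fin: "finite S" and nonneg_weights: "weights_nonneg S"
    and supp: "\<forall>x\<in>S. supported (Tau ` {1..dim_col A} \<union> Lam ` set js) (fst x)"
begin

definition us :: "(bool \<times> indet) list" where
  "us = map (\<lambda>j. (False, Lam j)) js @ map (\<lambda>k. (True, Tau k)) ks"

definition semi :: "wmono set" where
  "semi = vee (part_eq A (set ks) (generated S)) (star (part_gt A (set ks) (generated S)) {(mono_one, 0)})"

lemma distinct_us: "distinct js \<Longrightarrow> distinct ks \<Longrightarrow> distinct (map snd us)"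
  by (auto simp: us_def distinct_map inj_on_def comp_def)

lemma snd_us: "snd ` set us = Lam ` set js \<union> Tau ` set ks"
  by (simp add: us_def image_Un image_image)

lemma True_mem_us: "(True, Tau k) \<in> set us \<longleftrightarrow> k \<in> set ks"
  by (auto simp: us_def)

lemma admissible_iff:
  "admissible (set us) f \<longleftrightarrow> (\<forall>j\<in>set js. f (Lam j) = 0) \<and> (\<forall>k\<in>set ks. f (Tau k) \<ge> 0)"
  by (auto simp: admissible_def us_def)

lemma degenerate_iff: "degenerate (set us) f \<longleftrightarrow> (\<exists>k\<in>set ks. f (Tau k) > 0)"
  by (auto simp: degenerate_def us_def)

lemma H_tau_iff:
  assumes "(f, w) \<in> generated S"
  shows "f \<in> H_tau A \<longleftrightarrow> (\<forall>j\<in>set js. f (Lam j) = 0)"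
proof
  assume "f \<in> H_tau A"
  then show "\<forall>j\<in>set js. f (Lam j) = 0" by (auto simp: H_tau_def)
next
  assume *: "\<forall>j\<in>set js. f (Lam j) = 0"
  have "u \<in> Tau ` {1..dim_col A}" if "f u \<noteq> 0" for u
  proof -
    have "u \<in> Tau ` {1..dim_col A} \<union> Lam ` set js"
      using supported_generated[OF supp assms] that by (simp add: supported_def)
    then show ?thesis using * that by auto
  qed
  then show "f \<in> H_tau A" by (simp add: H_tau_def)
qed

text \<open>Inside \<open>generated S\<close>, membership in \<open>H_tau A\<close> is the vanishing
  of the \<lambda>-exponents; so the semigroup is described by the two predicates that govern
  elimination.\<close>

lemma mem_semi_iff:
  "(f, v) \<in> semi \<longleftrightarrow> (\<exists>w. (f, w) \<in> generated S \<and> admissible (set us) f \<and>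
    v = (if degenerate (set us) f then 0 else w))"
proof -
  have "w \<ge> 0" if "(f, w) \<in> generated S" for w
    using weights_nonneg_generated[OF nonneg_weights that] by simp
  then show ?thesis
    unfolding semi_def mem_semigroup_iff admissible_iff degenerate_iff using H_tau_iff by blast
qed

lemma semi_mult:
  assumes "x \<in> semi" "y \<in> semi"
  shows "wmono_mult x y \<in> semi"
proof -
  obtain f v g w where [simp]: "x = (f, v)" "y = (g, w)" by (cases x; cases y)
  obtain v' w' where *: "(f, v') \<in> generated S" "admissible (set us) f"
      "v = (if degenerate (set us) f then 0 else v')"
      "(g, w') \<in> generated S" "admissible (set us) g" "w = (if degenerate (set us) g then 0 else w')"
    using assms unfolding mem_semi_iff \<open>x = (f, v)\<close> \<open>y = (g, w)\<close> by blast
  have "(mono_mult f g, v' * w') \<in> generated S" using generated_mult[OF *(1,4)] by simp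
  then show ?thesis
    using * by (auto simp: mem_semi_iff admissible_mult degenerate_mult)
qed

lemma one_semi: "(mono_one, 1) \<in> semi"
  unfolding mem_semi_iff
  by (intro exI[of _ 1]) (simp add: generated_one admissible_iff degenerate_iff, simp add: mono_one_def)

lemma elims_subset_semi: "elims us S \<subseteq> semi"
proof
  fix x assume x: "x \<in> elims us S"
  obtain f v where "x = (f, v)" by (cases x)
  with x have "(f, v) \<in> elims us S" by simp
  moreover have "descends (set us) S (elims us S)"
    using descends_elims[OF descends_self, of us S] by simp
  ultimately show "x \<in> semi"
    unfolding descends_def \<open>x = (f, v)\<close> mem_semi_iff by blast
qed

lemma elims_subset_H_tau: "elims us S \<subseteq> H_tau A \<times> {0..}"
proof
  fix x assume "x \<in> elims us S"
  then have "x \<in> semi" using elims_subset_semi by blast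
  then show "x \<in> H_tau A \<times> {0..}"
    unfolding semi_def by (cases x) (auto simp: mem_semigroup_iff)
qed

text \<open>The same \<open>M\<close> serves as both exponents: soundness gives an inclusion that is
  raised to the power \<open>M\<close>, completeness gives the other one.\<close>

lemma equivalent_elims: "equivalent (generated (elims us S)) semi"
proof -
  obtain M where M: "M > 0" "\<And>f v. (f, v) \<in> generated S \<Longrightarrow> admissible (set us) f \<Longrightarrow>
      (mono_pow f M, if degenerate (set us) f then 0 else v ^ M) \<in> generated (elims us S)"
    using generated_elims[OF fin, of us] by blast
  have "generated (elims us S) \<subseteq> semi"
  proof
    fix h assume "h \<in> generated (elims us S)"
    then show "h \<in> semi"
      using elims_subset_semi by (induction rule: generated_induct) (auto intro: one_semi semi_mult)
  qed
  moreover have "wmono_pow M ` semi \<subseteq> generated (elims us S)"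
  proof
    fix x assume "x \<in> wmono_pow M ` semi"
    then obtain f v where x: "x = wmono_pow M (f, v)" and "(f, v) \<in> semi" by force
    then obtain w where "(f, w) \<in> generated S" "admissible (set us) f"
        "v = (if degenerate (set us) f then 0 else w)"
      unfolding mem_semi_iff by blast
    with M(2)[of f w] M(1) show "x \<in> generated (elims us S)"
      by (simp add: x zero_power split: if_splits)
  qed
  ultimately show ?thesis
    unfolding equivalent_def using M(1) by blast
qed

end

section \<open>Undoing an elimination along a sequence\<close>

lemma exp_tendsto_0_iff:
  fixes f :: "'a \<Rightarrow> real"
  shows "((\<lambda>x. exp (f x)) \<longlongrightarrow> 0) F \<longleftrightarrow> filterlim f at_bot F"
proof
  assume "((\<lambda>x. exp (f x)) \<longlongrightarrow> 0) F"
  then have "filterlim (\<lambda>x. exp (f x)) (at_right 0) F"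
    by (intro tendsto_imp_filterlim_at_right) auto
  from filterlim_compose[OF ln_at_0 this] show "filterlim f at_bot F" by simp
next
  assume "filterlim f at_bot F"
  from filterlim_compose[OF exp_at_bot this] show "((\<lambda>x. exp (f x)) \<longlongrightarrow> 0) F" .
qed

text \<open>The \<open>b i\<close> with \<open>i \<in> P\<close> act as upper bounds, the
  \<open>b j\<close> with \<open>j \<in> N\<close> as lower bounds. The midpoint between the
  sharpest bounds keeps half of the gap on either side; if one side is empty, \<open>c\<close> is
  moved beyond the sum of all absolute values on the other, and by a further
  \<open>n\<close>.\<close>

lemma separating_sequence:
  fixes b :: "'i \<Rightarrow> nat \<Rightarrow> real"
  assumes fin: "finite P" "finite N"
    and gap: "\<And>i j. i \<in> P \<Longrightarrow> j \<in> N \<Longrightarrow> filterlim (\<lambda>n. b i n - b j n) at_top sequentially"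
  shows "\<exists>c. (\<forall>i\<in>P. filterlim (\<lambda>n. b i n - c n) at_top sequentially) \<and>
             (\<forall>j\<in>N. filterlim (\<lambda>n. c n - b j n) at_top sequentially)"
proof -
  have nat_le: "filterlim f at_top sequentially" if "\<And>n. real n \<le> f n" for f :: "nat \<Rightarrow> real"
    using filterlim_real_sequentially by (rule filterlim_at_top_mono) (simp add: that)
  consider "P = {}" | "N = {}" | "P \<noteq> {}" "N \<noteq> {}" by blast
  then show ?thesis
  proof cases
    case 1
    have "filterlim (\<lambda>n. ((\<Sum>i\<in>N. \<bar>b i n\<bar>) + real n) - b j n) at_top sequentially" if "j \<in> N" for j
    proof (rule nat_le)
      fix n
      have "\<bar>b j n\<bar> \<le> (\<Sum>i\<in>N. \<bar>b i n\<bar>)" using fin that by (intro member_le_sum) auto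
      then show "real n \<le> ((\<Sum>i\<in>N. \<bar>b i n\<bar>) + real n) - b j n" by linarith
    qed
    then show ?thesis using 1 by (intro exI[of _ "\<lambda>n. (\<Sum>i\<in>N. \<bar>b i n\<bar>) + real n"]) auto
  next
    case 2
    have "filterlim (\<lambda>n. b j n - (- (\<Sum>i\<in>P. \<bar>b i n\<bar>) - real n)) at_top sequentially" if "j \<in> P" for j
    proof (rule nat_le)
      fix n
      have "\<bar>b j n\<bar> \<le> (\<Sum>i\<in>P. \<bar>b i n\<bar>)" using fin that by (intro member_le_sum) auto
      then show "real n \<le> b j n - (- (\<Sum>i\<in>P. \<bar>b i n\<bar>) - real n)" by linarith
    qed
    then show ?thesis using 2 by (intro exI[of _ "\<lambda>n. - (\<Sum>i\<in>P. \<bar>b i n\<bar>) - real n"]) auto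
  next
    case 3
    define lo where "lo n = Max ((\<lambda>j. b j n) ` N)" for n
    define up where "up n = Min ((\<lambda>i. b i n) ` P)" for n
    have gap': "filterlim (\<lambda>n. (up n - lo n) / 2) at_top sequentially"
      unfolding filterlim_at_top
    proof
      fix K :: real
      have "\<forall>\<^sub>F n in sequentially. \<forall>i\<in>P. \<forall>j\<in>N. 2 * K \<le> b i n - b j n"
        using gap fin by (intro eventually_ball_finite ballI) (auto simp: filterlim_at_top)
      then show "\<forall>\<^sub>F n in sequentially. K \<le> (up n - lo n) / 2"
      proof (rule eventually_mono)
        fix n assume *: "\<forall>i\<in>P. \<forall>j\<in>N. 2 * K \<le> b i n - b j n"
        have "up n \<in> (\<lambda>i. b i n) ` P" "lo n \<in> (\<lambda>j. b j n) ` N"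
          unfolding up_def lo_def using fin 3 by (auto intro: Min_in Max_in)
        then obtain i j where "i \<in> P" "up n = b i n" "j \<in> N" "lo n = b j n" by blast
        with * have "2 * K \<le> up n - lo n" by simp
        then show "K \<le> (up n - lo n) / 2" by simp
      qed
    qed
    define c where "c n = (up n + lo n) / 2" for n
    have "filterlim (\<lambda>n. b i n - c n) at_top sequentially" if "i \<in> P" for i
    proof (rule filterlim_at_top_mono[OF gap'], rule always_eventually, rule allI)
      fix n
      have "up n \<le> b i n" unfolding up_def using fin that by simp
      then show "(up n - lo n) / 2 \<le> b i n - c n" by (simp add: c_def field_simps)
    qed
    moreover have "filterlim (\<lambda>n. c n - b j n) at_top sequentially" if "j \<in> N" for j
    proof (rule filterlim_at_top_mono[OF gap'], rule always_eventually, rule allI)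
      fix n
      have "b j n \<le> lo n" unfolding lo_def using fin that by simp
      then show "(up n - lo n) / 2 \<le> c n - b j n" by (simp add: c_def field_simps)
    qed
    ultimately show ?thesis by blast
  qed
qed

text \<open>
  The unknown \<open>c\<close> is subject to the constraints \<open>exp (\<nu> i * c + l i) \<longrightarrow> v i\<close>. A constraint with
  \<open>v i \<noteq> 0\<close> determines \<open>c\<close>; otherwise all of them are one-sided, and any \<open>c\<close> far from the upper and
  from the lower bounds will do.
\<close>

lemma fourier_motzkin_limit:
  fixes \<nu> v :: "'i \<Rightarrow> real" and l :: "'i \<Rightarrow> nat \<Rightarrow> real"
  assumes fin: "finite X" and v: "\<And>i. i \<in> X \<Longrightarrow> v i \<ge> 0"
    and pairs: "\<And>i j. i \<in> X \<Longrightarrow> j \<in> X \<Longrightarrow> \<nu> i > 0 \<Longrightarrow> \<nu> j < 0 \<Longrightarrow>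
      (\<lambda>n. exp (- \<nu> j * l i n + \<nu> i * l j n)) \<longlonglongrightarrow> v i powr (- \<nu> j) * v j powr \<nu> i"
    and inv: "\<And>i. i \<in> X \<Longrightarrow> v i \<noteq> 0 \<Longrightarrow> \<nu> i \<noteq> 0 \<Longrightarrow>
      \<exists>j\<in>X. \<nu> j = - \<nu> i \<and> (\<forall>n. l j n = - l i n) \<and> v j = inverse (v i)"
  shows "\<exists>c. \<forall>i\<in>X. \<nu> i \<noteq> 0 \<longrightarrow> (\<lambda>n. exp (\<nu> i * c n + l i n)) \<longlonglongrightarrow> v i"
proof (cases "\<exists>i\<in>X. v i \<noteq> 0 \<and> \<nu> i \<noteq> 0")
  case True
  then obtain i where i: "i \<in> X" "v i \<noteq> 0" "\<nu> i \<noteq> 0" by blast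
  obtain i' where i': "i' \<in> X" "\<nu> i' = - \<nu> i" "\<forall>n. l i' n = - l i n" "v i' = inverse (v i)"
    using inv[OF i] by blast
  obtain p q where pq: "p \<in> X" "q \<in> X" "\<nu> p > 0" "v p > 0" "\<nu> q = - \<nu> p" "\<forall>n. l q n = - l p n" "v q = inverse (v p)"
  proof (cases "\<nu> i > 0")
    case True
    then show thesis using i i' v[OF i(1)] by (intro that[of i i']) auto
  next
    case False
    then show thesis using i i' v[OF i(1)] by (intro that[of i' i]) auto
  qed
  \<comment> \<open>With this \<open>c\<close> the constraint \<open>p\<close> reads
    \<open>exp (\<nu> p * c n + l p n) = v p\<close> for every \<open>n\<close>. Any other
    constraint is compared with \<open>q\<close> or \<open>p\<close>, whichever has the opposite
    sign.\<close>
  define c where "c n = (ln (v p) - l p n) / \<nu> p" for n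
  have "(\<lambda>n. exp (\<nu> i * c n + l i n)) \<longlonglongrightarrow> v i" if i: "i \<in> X" "\<nu> i \<noteq> 0" for i
  proof -
    have "(\<lambda>n. exp (\<nu> p * l i n - \<nu> i * l p n)) \<longlonglongrightarrow> v i powr \<nu> p * v p powr (- \<nu> i)"
    proof (cases "\<nu> i > 0")
      case True
      then show ?thesis
        using pairs[OF i(1) pq(2)] pq by (simp add: inverse_powr powr_minus)
    next
      case False
      then show ?thesis
        using pairs[OF pq(1) i(1)] pq i by (simp add: mult.commute add.commute)
    qed
    then have "(\<lambda>n. exp (\<nu> p * l i n - \<nu> i * l p n) powr (1 / \<nu> p))
        \<longlonglongrightarrow> (v i powr \<nu> p * v p powr (- \<nu> i)) powr (1 / \<nu> p)"
      using pq(3) by (intro tendsto_powr' tendsto_const) auto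
    from tendsto_mult_right[OF this, of "exp (\<nu> i * ln (v p) / \<nu> p)"]
    have "(\<lambda>n. exp (\<nu> p * l i n - \<nu> i * l p n) powr (1 / \<nu> p) * exp (\<nu> i * ln (v p) / \<nu> p))
        \<longlonglongrightarrow> (v i powr \<nu> p * v p powr (- \<nu> i)) powr (1 / \<nu> p) * exp (\<nu> i * ln (v p) / \<nu> p)" .
    moreover have "exp (\<nu> p * l i n - \<nu> i * l p n) powr (1 / \<nu> p) * exp (\<nu> i * ln (v p) / \<nu> p)
        = exp (\<nu> i * c n + l i n)" for n
      using pq(3) by (simp add: powr_def exp_add[symmetric] c_def field_simps)
    moreover have "(v i powr \<nu> p * v p powr (- \<nu> i)) powr (1 / \<nu> p) * exp (\<nu> i * ln (v p) / \<nu> p) = v i"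
    proof (cases "v i = 0")
      case False
      then have "v i > 0" using v[OF i(1)] by simp
      then show ?thesis
        using pq(3,4) by (simp add: powr_def exp_add[symmetric] ln_mult field_simps)
    qed (use pq in simp)
    ultimately show ?thesis by simp
  qed
  then show ?thesis by blast
next
  case False
  then have v0: "v i = 0" if "i \<in> X" "\<nu> i \<noteq> 0" for i using that by blast
  define P N where "P = {i\<in>X. \<nu> i > 0}" and "N = {i\<in>X. \<nu> i < 0}"
  \<comment> \<open>The value of \<open>c\<close> at which \<open>\<nu> i * c + l i n\<close> is 0:
    an upper bound if \<open>\<nu> i > 0\<close>, a lower bound if
    \<open>\<nu> i < 0\<close>.\<close>
  define b where "b i n = - l i n / \<nu> i" for i n
  have "\<exists>c. (\<forall>i\<in>P. filterlim (\<lambda>n. b i n - c n) at_top sequentially) \<and>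
             (\<forall>j\<in>N. filterlim (\<lambda>n. c n - b j n) at_top sequentially)"
  proof (rule separating_sequence)
    fix i j assume "i \<in> P" "j \<in> N"
    then have ij: "i \<in> X" "j \<in> X" "\<nu> i > 0" "\<nu> j < 0" by (auto simp: P_def N_def)
    have "filterlim (\<lambda>n. - \<nu> j * l i n + \<nu> i * l j n) at_bot sequentially"
      using pairs[OF ij] v0[of i] ij by (simp add: exp_tendsto_0_iff)
    then have "filterlim (\<lambda>n. - (- \<nu> j * l i n + \<nu> i * l j n)) at_top sequentially"
      by (simp only: filterlim_uminus_at_bot)
    moreover have "- 1 / (\<nu> i * \<nu> j) > 0" using ij by (simp add: mult_pos_neg divide_neg_neg)
    ultimately have "filterlim (\<lambda>n. - 1 / (\<nu> i * \<nu> j) * - (- \<nu> j * l i n + \<nu> i * l j n)) at_top sequentially"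
      by (intro filterlim_tendsto_pos_mult_at_top[OF tendsto_const])
    moreover have "- 1 / (\<nu> i * \<nu> j) * - (- \<nu> j * l i n + \<nu> i * l j n) = b i n - b j n" for n
      using ij by (simp add: b_def field_simps)
    ultimately show "filterlim (\<lambda>n. b i n - b j n) at_top sequentially" by simp
  qed (use fin in \<open>auto simp: P_def N_def\<close>)
  then obtain c where c: "\<forall>i\<in>P. filterlim (\<lambda>n. b i n - c n) at_top sequentially"
    "\<forall>j\<in>N. filterlim (\<lambda>n. c n - b j n) at_top sequentially" by blast
  have "(\<lambda>n. exp (\<nu> i * c n + l i n)) \<longlonglongrightarrow> 0" if i: "i \<in> X" "\<nu> i \<noteq> 0" for i
    unfolding exp_tendsto_0_iff
  proof (cases "\<nu> i > 0")
    case True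
    then have "filterlim (\<lambda>n. - \<nu> i * (b i n - c n)) at_bot sequentially"
      using c(1) i by (intro filterlim_tendsto_neg_mult_at_bot[OF tendsto_const]) (auto simp: P_def)
    moreover have "- \<nu> i * (b i n - c n) = \<nu> i * c n + l i n" for n
      using i by (simp add: b_def field_simps)
    ultimately show "filterlim (\<lambda>n. \<nu> i * c n + l i n) at_bot sequentially" by simp
  next
    case False
    then have "filterlim (\<lambda>n. \<nu> i * (c n - b i n)) at_bot sequentially"
      using c(2) i by (intro filterlim_tendsto_neg_mult_at_bot[OF tendsto_const]) (auto simp: N_def)
    moreover have "\<nu> i * (c n - b i n) = \<nu> i * c n + l i n" for n
      using i by (simp add: b_def field_simps)
    ultimately show "filterlim (\<lambda>n. \<nu> i * c n + l i n) at_bot sequentially" by simp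
  qed
  then show ?thesis using v0 by (intro exI[of _ c]) auto
qed

section \<open>Logarithms of monomial values\<close>

definition logval :: "indet set \<Rightarrow> monomial \<Rightarrow> (indet \<Rightarrow> real) \<Rightarrow> real" where
  "logval I f L = (\<Sum>u\<in>I. real_of_rat (f u) * L u)"

lemma logval_mult: "logval I (mono_mult f g) L = logval I f L + logval I g L"
  by (simp add: logval_def mono_mult_def of_rat_add algebra_simps sum.distrib)

lemma logval_pow: "logval I (mono_pow f N) L = real N * logval I f L"
  by (simp add: logval_def mono_pow_def of_rat_mult sum_distrib_left mult.assoc)

lemma logval_inv: "logval I (mono_inv f) L = - logval I f L"
  by (simp add: logval_def mono_inv_def of_rat_minus sum_negf)

lemma logval_one: "logval I mono_one L = 0"
  by (simp add: logval_def mono_one_def)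

lemma logval_diff: "logval I f (\<lambda>u. L u - L' u) = logval I f L - logval I f L'"
  by (simp add: logval_def algebra_simps sum_subtractf)

lemma logval_fun_upd:
  assumes "finite I" "u \<in> I"
  shows "logval I f (L(u := c)) = real_of_rat (f u) * c + logval (I - {u}) f L"
proof -
  have "(\<Sum>w\<in>I - {u}. real_of_rat (f w) * (L(u := c)) w) = logval (I - {u}) f L"
    unfolding logval_def by (intro sum.cong) auto
  then show ?thesis
    unfolding logval_def sum.remove[OF assms] by simp
qed

lemma logval_remove:
  assumes "finite I" "u \<in> I"
  shows "logval I f L = real_of_rat (f u) * L u + logval (I - {u}) f L"
  using logval_fun_upd[OF assms, of f L "L u"] by simp

definition converges :: "indet set \<Rightarrow> wmono set \<Rightarrow> (nat \<Rightarrow> indet \<Rightarrow> real) \<Rightarrow> bool" where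
  "converges I F L \<longleftrightarrow> (\<forall>x\<in>F. (\<lambda>n. exp (logval I (fst x) (L n))) \<longlonglongrightarrow> snd x)"

lemma coprime_weights_exist:
  fixes r s :: rat
  assumes "r > 0" "s > 0"
  obtains a b :: nat where "coprime a b" "a > 0" "b > 0" "of_nat a * r = of_nat b * s"
proof -
  obtain k e :: nat where ke: "k > 0" "e > 0" "of_nat k * r = of_nat e * s"
    using commensurable assms by blast
  obtain a b where ab: "k = a * gcd k e" "e = b * gcd k e" "coprime a b"
    using gcd_coprime_exists[of k e] ke by auto
  have "of_nat (gcd k e) * (of_nat a * r) = of_nat (a * gcd k e) * r" by simp
  also have "\<dots> = of_nat (b * gcd k e) * s" using ke(3) ab(1,2) by presburger
  also have "\<dots> = of_nat (gcd k e) * (of_nat b * s)" by simp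
  finally have "of_nat a * r = of_nat b * s" using ke by simp
  moreover have "a > 0" "b > 0" using ab ke by (auto intro: Nat.gr0I)
  ultimately show thesis using that ab(3) by blast
qed

text \<open>The unknown is the new logarithm of \<open>u\<close>. That the former value of
  \<open>u\<close> be negligible against the new one is a further constraint, of exponent
  \<open>- 1\<close> and weight 0; pairing it with an element of positive exponent gives precisely
  what (F2) records.\<close>

lemma converges_undo_elim:
  assumes I: "finite I" "u \<in> I" and fin: "finite F" and F: "inv_closed F" "weights_nonneg F"
    and conv: "converges I (elim B u F) L"
  shows "\<exists>c. converges I F (\<lambda>n. (L n)(u := c n)) \<and> (B \<longrightarrow> (\<lambda>n. exp (L n u - c n)) \<longlonglongrightarrow> 0)"
proof -
  \<comment> \<open>\<open>None\<close> stands for the extra constraint that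
    \<open>exp (L n u - c n)\<close> tends to 0.\<close>
  define X where "X = Some ` F \<union> (if B then {None} else {})"
  define \<nu> where "\<nu> i = (case i of None \<Rightarrow> - 1 | Some x \<Rightarrow> real_of_rat (fst x u))" for i :: "wmono option"
  define v where "v i = (case i of None \<Rightarrow> 0 | Some x \<Rightarrow> snd x)" for i :: "wmono option"
  define l where "l i n = (case i of None \<Rightarrow> L n u | Some x \<Rightarrow> logval (I - {u}) (fst x) (L n))"
    for i :: "wmono option" and n
  have lim: "(\<lambda>n. exp (logval I (fst x) (L n))) \<longlonglongrightarrow> snd x" if "x \<in> elim B u F" for x
    using conv that by (simp add: converges_def)
  have "\<exists>c. \<forall>i\<in>X. \<nu> i \<noteq> 0 \<longrightarrow> (\<lambda>n. exp (\<nu> i * c n + l i n)) \<longlonglongrightarrow> v i"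
  proof (rule fourier_motzkin_limit)
    show "finite X" using fin by (simp add: X_def)
    show "v i \<ge> 0" if "i \<in> X" for i
      using that F(2) by (cases i) (auto simp: X_def v_def weights_nonneg_def split: if_splits)
  next
    fix i j assume ij: "i \<in> X" "j \<in> X" "\<nu> i > 0" "\<nu> j < 0"
    then obtain x where x: "x \<in> F" "i = Some x" "fst x u > 0"
      by (cases i) (auto simp: X_def \<nu>_def split: if_splits)
    show "(\<lambda>n. exp (- \<nu> j * l i n + \<nu> i * l j n)) \<longlonglongrightarrow> v i powr (- \<nu> j) * v j powr \<nu> i"
    proof (cases j)
      case None
      then have B using ij(2) by (auto simp: X_def split: if_splits)
      moreover have "(fst x, 0) \<in> elim_F2 u F" using x unfolding elim_F2_def by (cases x) auto
      ultimately have "(fst x, 0) \<in> elim B u F" by (simp add: elim_def)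
      from lim[OF this] show ?thesis
        using ij(3) x None by (simp add: \<nu>_def l_def v_def logval_remove[OF I] add.commute)
    next
      case (Some y)
      then have y: "y \<in> F" "fst y u < 0"
        using ij by (auto simp: X_def \<nu>_def split: if_splits)
      obtain a b where ab: "coprime a b" "a > 0" "b > 0" "of_nat a * \<bar>fst x u\<bar> = of_nat b * \<bar>fst y u\<bar>"
        using coprime_weights_exist[of "\<bar>fst x u\<bar>" "\<bar>fst y u\<bar>"] x y by auto
      let ?z = "wmono_mult (wmono_pow a x) (wmono_pow b y)"
      have "?z \<in> elim B u F"
        using elim_F3I[OF x(1) y(1) x(3) y(2) ab(1,4)] by (simp add: elim_def)
      from lim[OF this]
      have lim_z: "(\<lambda>n. exp (logval I (fst ?z) (L n))) \<longlonglongrightarrow> snd x ^ a * snd y ^ b"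
        by (simp add: snd_wmono_mult snd_wmono_pow)
      \<comment> \<open>Rule (F3) uses coprime integers, the limit lemma the exponents themselves;
        \<open>s\<close> is the factor of proportionality.\<close>
      define s where "s = - \<nu> j / real a"
      have \<nu>: "\<nu> i = real_of_rat (fst x u)" "\<nu> j = real_of_rat (fst y u)"
        by (simp_all add: \<nu>_def x Some)
      have "of_nat a * fst x u = - (of_nat b * fst y u)" using ab(4) x y by simp
      from arg_cong[OF this, of real_of_rat] have rel: "real a * \<nu> i = - (real b * \<nu> j)"
        by (simp add: \<nu> of_rat_mult of_rat_minus)
      have s: "s > 0" "real a * s = - \<nu> j" "real b * s = \<nu> i"
        using ab ij rel by (auto simp: s_def field_simps)
      have "logval I (fst ?z) (L n) * s = - \<nu> j * l i n + \<nu> i * l j n" for n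
      proof -
        have "logval I (fst ?z) (L n) = real a * logval I (fst x) (L n) + real b * logval I (fst y) (L n)"
          by (cases x; cases y) (simp add: logval_mult logval_pow)
        also have "\<dots> = (real a * \<nu> i + real b * \<nu> j) * L n u + real a * l i n + real b * l j n"
          unfolding \<nu> logval_remove[OF I] by (simp add: l_def x Some algebra_simps)
        also have "\<dots> = real a * l i n + real b * l j n" using rel by simp
        finally show ?thesis using s(2,3) by (metis distrib_right mult.assoc mult.commute)
      qed
      moreover have "(\<lambda>n. exp (logval I (fst ?z) (L n)) powr s) \<longlonglongrightarrow> (snd x ^ a * snd y ^ b) powr s"
        using s(1) by (intro tendsto_powr'[OF lim_z tendsto_const]) auto
      moreover have "(snd x ^ a * snd y ^ b) powr s = v i powr (- \<nu> j) * v j powr \<nu> i"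
      proof -
        have nn: "snd x \<ge> 0" "snd y \<ge> 0" using F(2) x y by (auto simp: weights_nonneg_def)
        have pow: "(w ^ N) powr s = w powr (real N * s)" if "w \<ge> 0" "N > 0" for w and N :: nat
          using that by (cases "w = 0") (simp_all add: zero_power powr_realpow[symmetric] powr_powr)
        show ?thesis
          using nn ab by (simp add: powr_mult pow s(2,3) v_def x Some)
      qed
      ultimately show ?thesis by (simp only: exp_powr_real)
    qed
  next
    fix i assume i: "i \<in> X" "v i \<noteq> 0" "\<nu> i \<noteq> 0"
    then obtain f w where x: "(f, w) \<in> F" "i = Some (f, w)" "w \<noteq> 0"
      by (cases i) (auto simp: v_def X_def split: if_splits)
    then have "(mono_inv f, inverse w) \<in> F" using F(1) by (auto simp: inv_closed_def)
    moreover have "mono_inv f u = - f u" by (simp add: mono_inv_def)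
    ultimately show "\<exists>j\<in>X. \<nu> j = - \<nu> i \<and> (\<forall>n. l j n = - l i n) \<and> v j = inverse (v i)"
      using x by (intro bexI[of _ "Some (mono_inv f, inverse w)"])
        (auto simp: \<nu>_def l_def v_def X_def logval_inv of_rat_minus)
  qed
  then obtain c where c: "\<And>i. i \<in> X \<Longrightarrow> \<nu> i \<noteq> 0 \<Longrightarrow> (\<lambda>n. exp (\<nu> i * c n + l i n)) \<longlonglongrightarrow> v i"
    by blast
  have "converges I F (\<lambda>n. (L n)(u := c n))"
    unfolding converges_def
  proof
    fix x assume x: "x \<in> F"
    show "(\<lambda>n. exp (logval I (fst x) ((L n)(u := c n)))) \<longlonglongrightarrow> snd x"
    proof (cases "fst x u = 0")
      case True
      then have "x \<in> elim B u F" using x by (simp add: elim_def elim_F1_iff)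
      from lim[OF this] show ?thesis
        unfolding logval_fun_upd[OF I] using True by (simp add: logval_remove[OF I])
    next
      case False
      then show ?thesis
        using c[of "Some x"] x by (simp add: logval_fun_upd[OF I] X_def \<nu>_def l_def v_def)
    qed
  qed
  moreover have "(\<lambda>n. exp (L n u - c n)) \<longlonglongrightarrow> 0" if B
    using c[of None] that by (simp add: X_def \<nu>_def l_def v_def)
  ultimately show ?thesis by blast
qed

text \<open>The last indeterminate eliminated is recovered first. Distinctness guarantees that
  \<open>u\<close> still has the given value \<open>L n u\<close> when its turn comes, so that the
  comparison is with the original sequence.\<close>

lemma converges_undo_elims:
  assumes I: "finite I" "snd ` set us \<subseteq> I" "distinct (map snd us)"
    and "finite F" "inv_closed F" "weights_nonneg F" "converges I (elims us F) L"
  shows "\<exists>L'. converges I F L' \<and> (\<forall>n u. u \<notin> snd ` set us \<longrightarrow> L' n u = L n u) \<and>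
    (\<forall>u. (True, u) \<in> set us \<longrightarrow> (\<lambda>n. exp (L n u - L' n u)) \<longlonglongrightarrow> 0)"
  using assms(2-)
proof (induction us arbitrary: F)
  case Nil
  then show ?case by (intro exI[of _ L]) simp
next
  case (Cons Bu us)
  obtain B u where Bu: "Bu = (B, u)" by (cases Bu)
  have "\<exists>L'. converges I (elim B u F) L' \<and> (\<forall>n u. u \<notin> snd ` set us \<longrightarrow> L' n u = L n u) \<and>
    (\<forall>u. (True, u) \<in> set us \<longrightarrow> (\<lambda>n. exp (L n u - L' n u)) \<longlonglongrightarrow> 0)"
    using Cons.prems by (intro Cons.IH) (auto simp: Bu intro: finite_elim inv_closed_elim weights_nonneg_elim)
  then obtain L' where L': "converges I (elim B u F) L'" "\<And>n u. u \<notin> snd ` set us \<Longrightarrow> L' n u = L n u"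
    "\<And>u. (True, u) \<in> set us \<Longrightarrow> (\<lambda>n. exp (L n u - L' n u)) \<longlonglongrightarrow> 0" by blast
  obtain c where c: "converges I F (\<lambda>n. (L' n)(u := c n))" "B \<longrightarrow> (\<lambda>n. exp (L' n u - c n)) \<longlonglongrightarrow> 0"
    using converges_undo_elim[OF I(1) _ Cons.prems(3,4,5) L'(1)] Cons.prems(1) by (auto simp: Bu)
  have u: "u \<notin> snd ` set us" using Cons.prems(2) by (simp add: Bu)
  have "(\<lambda>n. exp (L n w - ((L' n)(u := c n)) w)) \<longlonglongrightarrow> 0" if "(True, w) \<in> set (Bu # us)" for w
  proof (cases "w = u")
    case True
    then have B using that u by (force simp: Bu)
    then show ?thesis using c(2) L'(2)[OF u] True by simp
  next
    case False
    then show ?thesis using L'(3)[of w] that by (auto simp: Bu)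
  qed
  moreover have "\<forall>n w. w \<notin> snd ` set (Bu # us) \<longrightarrow> ((L' n)(u := c n)) w = L n w"
    using L'(2) by (auto simp: Bu)
  ultimately show ?case
    using c(1) by (intro exI[of _ "\<lambda>n. (L' n)(u := c n)"]) blast
qed

section \<open>Consequences of the ordering of rows and columns\<close>

declare One_nat_def [simp del]

lemma logval_mono_var: "finite I \<Longrightarrow> w \<in> I \<Longrightarrow> logval I (mono_var w) L = L w"
  by (simp add: logval_def mono_var_def if_distrib[of of_rat] if_distrib[of "\<lambda>x. x * _"] cong: if_cong)

lemma logval_phi_subst:
  "logval I (phi_subst A k u) L = (\<Sum>j = 1..dim_row A. real_of_rat (entry A j k) * logval I (u j) L)"
proof -
  have "logval I (phi_subst A k u) L
      = (\<Sum>w\<in>I. \<Sum>j = 1..dim_row A. real_of_rat (entry A j k) * (real_of_rat (u j w) * L w))"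
    by (simp add: logval_def phi_subst_def of_rat_sum of_rat_mult sum_distrib_right mult.assoc)
  also have "\<dots> = (\<Sum>j = 1..dim_row A. \<Sum>w\<in>I. real_of_rat (entry A j k) * (real_of_rat (u j w) * L w))"
    by (rule sum.swap)
  finally show ?thesis by (simp add: logval_def sum_distrib_left)
qed

lemma card_insert_lessThan:
  assumes "L \<le> (i::nat)" "i < n"
  shows "card {a. a < n \<and> a \<in> insert i {..<L}} = Suc L"
proof -
  have "{a. a < n \<and> a \<in> insert i {..<L}} = insert i {..<L}" using assms by auto
  then show ?thesis using assms by simp
qed

locale ordered_matrix =
  fixes A :: "rat mat"
  assumes ordered: "invertible_mat (submatrix A {..<mat_rank A} {..<mat_rank A})"
begin

abbreviation rk :: nat where "rk \<equiv> mat_rank A"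

lemma rank_le_col: "rk \<le> dim_col A"
  unfolding mat_rank_def by (rule vec_space.rank_le_nc) simp

text \<open>\<open>submatrix\<close> drops indices out of range, so squareness of the block equates
  two minima; the second one is \<open>rk\<close> because there are enough columns.\<close>

lemma rank_le_row: "rk \<le> dim_row A"
proof -
  have "{i. i < n \<and> i < rk} = {..<min n rk}" for n by auto
  then have *: "card {i. i < n \<and> i < rk} = min n rk" for n by simp
  have "square_mat (submatrix A {..<rk} {..<rk})" using ordered by (simp add: invertible_mat_def)
  then have "min (dim_row A) rk = min (dim_col A) rk"
    by (simp add: dim_submatrix *)
  then show ?thesis using rank_le_col by linarith
qed

lemma block_inverse0:
  obtains C :: "nat \<Rightarrow> nat \<Rightarrow> rat" where
    "\<And>i j. i < rk \<Longrightarrow> j < rk \<Longrightarrow> (\<Sum>k<rk. A $$ (i, k) * C k j) = (if i = j then 1 else 0)"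
    "\<And>i j. i < rk \<Longrightarrow> j < rk \<Longrightarrow> (\<Sum>k<rk. C i k * A $$ (k, j)) = (if i = j then 1 else 0)"
proof -
  let ?B = "submatrix A {..<rk} {..<rk}"
  have "{i. i < n \<and> i < rk} = {..<rk}" if "rk \<le> n" for n using that by auto
  then have dim: "dim_row ?B = rk" "dim_col ?B = rk"
    using rank_le_row rank_le_col by (simp_all add: dim_submatrix)
  have entry_B: "?B $$ (i, j) = A $$ (i, j)" if "i < rk" "j < rk" for i j
  proof -
    have "{a \<in> {..<rk}. a < i} = {..<i}" "{a \<in> {..<rk}. a < j} = {..<j}" using that by auto
    then show ?thesis
      using submatrix_index_card[of i A j "{..<rk}" "{..<rk}"] that rank_le_row rank_le_col by simp
  qed
  obtain D where D: "?B * D = 1\<^sub>m (dim_row ?B)" "D * ?B = 1\<^sub>m (dim_row D)"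
    using ordered unfolding invertible_mat_def inverts_mat_def by blast
  have "dim_col (?B * D) = rk" "dim_col (D * ?B) = dim_row D" using D dim by simp_all
  then have dimD: "dim_col D = rk" "dim_row D = rk" using dim by simp_all
  show thesis
  proof (rule that[of "\<lambda>i j. D $$ (i, j)"])
    fix i j assume ij: "i < rk" "j < rk"
    have "(\<Sum>k<rk. A $$ (i, k) * D $$ (k, j)) = (?B * D) $$ (i, j)"
      using ij dim dimD by (simp add: scalar_prod_def atLeast0LessThan entry_B)
    then show "(\<Sum>k<rk. A $$ (i, k) * D $$ (k, j)) = (if i = j then 1 else 0)"
      using D dim ij by simp
    have "(\<Sum>k<rk. D $$ (i, k) * A $$ (k, j)) = (D * ?B) $$ (i, j)"
      using ij dim dimD by (simp add: scalar_prod_def atLeast0LessThan entry_B)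
    then show "(\<Sum>k<rk. D $$ (i, k) * A $$ (k, j)) = (if i = j then 1 else 0)"
      using D dimD ij by simp
  qed
qed

text \<open>The coefficients are those forced by the first rows through the inverse block, so the
  same \<open>c\<close> serves all rows. For a further row the bordered minor of order
  \<open>rk + 1\<close> vanishes, as its order exceeds the rank, and a kernel vector carries the
  relation over to that row.\<close>

lemma column_in_span0:
  assumes k0: "rk \<le> k0" "k0 < dim_col A"
  shows "\<exists>c. \<forall>i<dim_row A. A $$ (i, k0) = (\<Sum>k<rk. A $$ (i, k) * c k)"
proof -
  obtain C :: "nat \<Rightarrow> nat \<Rightarrow> rat" where
    C: "\<And>i j. i < rk \<Longrightarrow> j < rk \<Longrightarrow> (\<Sum>k<rk. A $$ (i, k) * C k j) = (if i = j then 1 else 0)"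
      "\<And>i j. i < rk \<Longrightarrow> j < rk \<Longrightarrow> (\<Sum>k<rk. C i k * A $$ (k, j)) = (if i = j then 1 else 0)"
    by (rule block_inverse0) blast
  define c where "c k = (\<Sum>i<rk. C k i * A $$ (i, k0))" for k
  have "A $$ (i, k0) = (\<Sum>k<rk. A $$ (i, k) * c k)" if i: "i < dim_row A" for i
  proof (cases "i < rk")
    case True
    have "(\<Sum>k<rk. A $$ (i, k) * c k) = (\<Sum>k<rk. \<Sum>r<rk. A $$ (i, k) * C k r * A $$ (r, k0))"
      by (simp add: c_def sum_distrib_left mult.assoc)
    also have "\<dots> = (\<Sum>r<rk. (\<Sum>k<rk. A $$ (i, k) * C k r) * A $$ (r, k0))"
      by (subst sum.swap) (simp add: sum_distrib_right)
    also have "\<dots> = (\<Sum>r<rk. (if i = r then 1 else 0) * A $$ (r, k0))"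
      using True by (intro sum.cong) (simp_all add: C(1))
    also have "\<dots> = A $$ (i, k0)"
      using True by (simp add: if_distrib[of "\<lambda>x. x * _"] cong: if_cong)
    finally show ?thesis ..
  next
    case False
    then have ik: "rk \<le> i" by simp
    define M where "M = submatrix A (insert i {..<rk}) (insert k0 {..<rk})"
    have cards: "card {a. a < dim_row A \<and> a \<in> insert i {..<rk}} = Suc rk"
        "card {a. a < dim_col A \<and> a \<in> insert k0 {..<rk}} = Suc rk"
      using card_insert_lessThan ik i k0 by blast+
    have M: "M \<in> carrier_mat (Suc rk) (Suc rk)"
      unfolding M_def by (intro carrier_matI) (simp_all only: dim_submatrix cards)
    \<comment> \<open>The added index is at least \<open>rk\<close>, so it comes last, at position
      \<open>rk\<close>, in the submatrix.\<close>
    have pos: "card {a \<in> insert x {..<rk}. a < r} = (if r = x then rk else r)"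
      if "rk \<le> x" "r = x \<or> r < rk" for x r
    proof -
      have "{a \<in> insert x {..<rk}. a < r} = (if r = x then {..<rk} else {..<r})" using that by auto
      then show ?thesis by simp
    qed
    have M_entry: "M $$ (if r = i then rk else r, if k = k0 then rk else k) = A $$ (r, k)"
      if "r = i \<or> r < rk" "k = k0 \<or> k < rk" for r k
    proof -
      have "M $$ (card {a \<in> insert i {..<rk}. a < r}, card {a \<in> insert k0 {..<rk}. a < k}) = A $$ (r, k)"
        unfolding M_def using that i k0 rank_le_row rank_le_col by (intro submatrix_index_card) auto
      then show ?thesis using pos[OF ik that(1)] pos[OF k0(1) that(2)] by simp
    qed
    have "det M = 0"
    proof (rule ccontr)
      assume "det M \<noteq> 0"
      then have "card {j. j < dim_col A \<and> j \<in> insert k0 {..<rk}} \<le> vec_space.rank (dim_row A) A"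
        unfolding M_def by (intro vec_space.rank_gt_minor) auto
      then show False unfolding cards mat_rank_def[symmetric] by simp
    qed
    then obtain v where v: "v \<in> carrier_vec (Suc rk)" "v \<noteq> 0\<^sub>v (Suc rk)" "M *\<^sub>v v = 0\<^sub>v (Suc rk)"
      using det_0_iff_vec_prod_zero_field[OF M] by blast
    have row: "(\<Sum>k<rk. A $$ (r, k) * v $ k) + A $$ (r, k0) * v $ rk = 0" if r: "r = i \<or> r < rk" for r
    proof -
      let ?r = "if r = i then rk else r"
      have "?r < Suc rk" using r by auto
      then have "0 = (M *\<^sub>v v) $ ?r" using v by simp
      also have "\<dots> = (\<Sum>k<Suc rk. M $$ (?r, k) * v $ k)"
        using \<open>?r < Suc rk\<close> M v(1) by (auto simp: scalar_prod_def atLeast0LessThan)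
      also have "\<dots> = (\<Sum>k<rk. M $$ (?r, k) * v $ k) + M $$ (?r, rk) * v $ rk" by simp
      also have "M $$ (?r, rk) = A $$ (r, k0)" using M_entry[OF r, of k0] by simp
      also have "(\<Sum>k<rk. M $$ (?r, k) * v $ k) = (\<Sum>k<rk. A $$ (r, k) * v $ k)"
      proof (rule sum.cong[OF refl])
        fix k assume "k \<in> {..<rk}"
        then show "M $$ (?r, k) * v $ k = A $$ (r, k) * v $ k" using M_entry[OF r, of k] k0 by auto
      qed
      finally show ?thesis by simp
    qed
    have vk: "v $ k = - (c k * v $ rk)" if k: "k < rk" for k
    proof -
      have "v $ k = (\<Sum>k'<rk. (if k = k' then 1 else 0) * v $ k')"
        using k by (simp add: if_distrib[of "\<lambda>x. x * _"] cong: if_cong)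
      also have "\<dots> = (\<Sum>k'<rk. (\<Sum>r<rk. C k r * A $$ (r, k')) * v $ k')"
        using k by (intro sum.cong) (simp_all add: C(2))
      also have "\<dots> = (\<Sum>k'<rk. \<Sum>r<rk. C k r * (A $$ (r, k') * v $ k'))"
        by (simp add: sum_distrib_right mult.assoc)
      also have "\<dots> = (\<Sum>r<rk. C k r * (\<Sum>k'<rk. A $$ (r, k') * v $ k'))"
        by (subst sum.swap) (simp add: sum_distrib_left)
      also have "\<dots> = (\<Sum>r<rk. C k r * - (A $$ (r, k0) * v $ rk))"
      proof (rule sum.cong[OF refl])
        fix r assume "r \<in> {..<rk}"
        then have "(\<Sum>k'<rk. A $$ (r, k') * v $ k') = - (A $$ (r, k0) * v $ rk)"
          using row[of r] by (simp add: eq_neg_iff_add_eq_0)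
        then show "C k r * (\<Sum>k'<rk. A $$ (r, k') * v $ k') = C k r * - (A $$ (r, k0) * v $ rk)" by simp
      qed
      also have "\<dots> = - (c k * v $ rk)"
        by (simp add: c_def sum_distrib_right sum_negf mult.assoc)
      finally show ?thesis .
    qed
    \<comment> \<open>The other entries of \<open>v\<close> are multiples of this one, so its
      vanishing would make \<open>v\<close> zero.\<close>
    have "v $ rk \<noteq> 0"
    proof
      assume "v $ rk = 0"
      then have "v $ k = 0" if "k < Suc rk" for k
        using vk that by (cases "k = rk") auto
      then have "v = 0\<^sub>v (Suc rk)" using v(1) by (intro eq_vecI) auto
      then show False using v(2) by simp
    qed
    moreover have "(A $$ (i, k0) - (\<Sum>k<rk. A $$ (i, k) * c k)) * v $ rk = 0"
    proof -
      have "(\<Sum>k<rk. A $$ (i, k) * v $ k) = - ((\<Sum>k<rk. A $$ (i, k) * c k) * v $ rk)"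
        by (simp add: vk sum_negf sum_distrib_right mult.assoc)
      then show ?thesis using row[of i] by (simp add: algebra_simps)
    qed
    ultimately show ?thesis by simp
  qed
  then show ?thesis by blast
qed

lemma block_inverse:
  obtains C :: "nat \<Rightarrow> nat \<Rightarrow> rat" where
    "\<And>i j. i \<in> {1..rk} \<Longrightarrow> j \<in> {1..rk} \<Longrightarrow> (\<Sum>k = 1..rk. entry A i k * C k j) = (if i = j then 1 else 0)"
    "\<And>i j. i \<in> {1..rk} \<Longrightarrow> j \<in> {1..rk} \<Longrightarrow> (\<Sum>k = 1..rk. C i k * entry A k j) = (if i = j then 1 else 0)"
proof -
  obtain C :: "nat \<Rightarrow> nat \<Rightarrow> rat" where
    C: "\<And>i j. i < rk \<Longrightarrow> j < rk \<Longrightarrow> (\<Sum>k<rk. A $$ (i, k) * C k j) = (if i = j then 1 else 0)"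
      "\<And>i j. i < rk \<Longrightarrow> j < rk \<Longrightarrow> (\<Sum>k<rk. C i k * A $$ (k, j)) = (if i = j then 1 else 0)"
    by (rule block_inverse0) blast
  show thesis
  proof (rule that[of "\<lambda>i j. C (i - 1) (j - 1)"])
    fix i j assume "i \<in> {1..rk}" "j \<in> {1..rk}"
    then have ij: "i - 1 < rk" "j - 1 < rk" "(i - 1 = j - 1) = (i = j)" by auto
    show "(\<Sum>k = 1..rk. entry A i k * C (k - 1) (j - 1)) = (if i = j then 1 else 0)"
      using C(1)[OF ij(1,2)] ij(3) by (simp add: entry_def sum.atLeast1_atMost_eq One_nat_def)
    show "(\<Sum>k = 1..rk. C (i - 1) (k - 1) * entry A k j) = (if i = j then 1 else 0)"
      using C(2)[OF ij(1,2)] ij(3) by (simp add: entry_def sum.atLeast1_atMost_eq One_nat_def)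
  qed
qed

lemma column_in_span:
  assumes k: "k \<in> {rk<..dim_col A}"
  obtains c where "\<And>j. j \<in> {1..dim_row A} \<Longrightarrow> entry A j k = (\<Sum>i = 1..rk. c i * entry A j i)"
proof -
  obtain c where c: "\<And>i. i < dim_row A \<Longrightarrow> A $$ (i, k - 1) = (\<Sum>k<rk. A $$ (i, k) * c k)"
  proof -
    have "rk \<le> k - 1" "k - 1 < dim_col A" using k by auto
    from column_in_span0[OF this] show thesis using that by blast
  qed
  show thesis
  proof (rule that[of "\<lambda>i. c (i - 1)"])
    fix j assume "j \<in> {1..dim_row A}"
    then have "j - 1 < dim_row A" by auto
    from c[OF this] show "entry A j k = (\<Sum>i = 1..rk. c (i - 1) * entry A j i)"
      by (simp add: entry_def sum.atLeast1_atMost_eq One_nat_def mult.commute)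
  qed
qed

text \<open>Stated over any field of characteristic 0 because it is applied both to rational
  exponents and to real logarithms.\<close>

lemma block_injective:
  fixes d :: "nat \<Rightarrow> 'a::field_char_0"
  assumes "\<And>k. k \<in> {1..rk} \<Longrightarrow> (\<Sum>j = 1..rk. of_rat (entry A j k) * d j) = 0" and i: "i \<in> {1..rk}"
  shows "d i = 0"
proof -
  obtain C :: "nat \<Rightarrow> nat \<Rightarrow> rat" where
    C: "\<And>i j. i \<in> {1..rk} \<Longrightarrow> j \<in> {1..rk} \<Longrightarrow> (\<Sum>k = 1..rk. entry A i k * C k j) = (if i = j then 1 else 0)"
    by (rule block_inverse) blast
  have "0 = (\<Sum>k = 1..rk. of_rat (C k i) * (\<Sum>j = 1..rk. of_rat (entry A j k) * d j))"
    using assms(1) by simp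
  also have "\<dots> = (\<Sum>k = 1..rk. \<Sum>j = 1..rk. of_rat (entry A j k * C k i) * d j)"
    by (simp add: sum_distrib_left of_rat_mult mult_ac)
  also have "\<dots> = (\<Sum>j = 1..rk. of_rat (\<Sum>k = 1..rk. entry A j k * C k i) * d j)"
    by (subst sum.swap) (simp add: sum_distrib_right of_rat_sum)
  also have "\<dots> = (\<Sum>j = 1..rk. (if j = i then 1 else 0) * d j)"
    using i by (intro sum.cong) (auto simp: C)
  also have "\<dots> = d i"
    using i by (simp add: if_distrib[of "\<lambda>x. x * _"] cong: if_cong)
  finally show ?thesis ..
qed

lemma sum_rows_split:
  "(\<Sum>j = 1..dim_row A. g j) = (\<Sum>j = 1..rk. g j) + (\<Sum>j\<in>{rk<..dim_row A}. g j)"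
proof -
  have "{1..dim_row A} = {1..rk} \<union> {rk<..dim_row A}" using rank_le_row by auto
  moreover have "{1..rk} \<inter> {rk<..dim_row A} = {}" by auto
  ultimately show ?thesis by (simp add: sum.union_disjoint)
qed

section \<open>The monomials inverse to \<phi> and the quotients \<psi>_k\<close>

definition phi_inv_spec :: "(nat \<Rightarrow> monomial) \<Rightarrow> bool" where
  "phi_inv_spec u \<longleftrightarrow>
     (\<forall>j\<in>{1..rk}. \<forall>i. u j i \<noteq> 0 \<longrightarrow> i \<in> Tau ` {1..rk} \<union> Lam ` {rk<..dim_row A}) \<and>
     (\<forall>j. j \<notin> {1..rk} \<longrightarrow> u j = mono_var (Lam j)) \<and>
     (\<forall>k\<in>{1..rk}. phi_subst A k u = mono_var (Tau k))"

lemma phi_inv_spec_unique: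
  assumes "phi_inv_spec u" "phi_inv_spec u'"
  shows "u = u'"
proof
  fix j
  show "u j = u' j"
  proof (cases "j \<in> {1..rk}")
    case True
    have "u j i - u' j i = 0" for i
    proof (rule block_injective[OF _ True, of "\<lambda>j. u j i - u' j i"])
      fix k assume k: "k \<in> {1..rk}"
      have "phi_subst A k u i = phi_subst A k u' i"
        using assms k by (simp add: phi_inv_spec_def)
      moreover have "(\<Sum>j\<in>{rk<..dim_row A}. entry A j k * u j i) = (\<Sum>j\<in>{rk<..dim_row A}. entry A j k * u' j i)"
        using assms by (intro sum.cong) (auto simp: phi_inv_spec_def)
      ultimately show "(\<Sum>j = 1..rk. of_rat (entry A j k) * (u j i - u' j i)) = (0::rat)"
        by (simp add: phi_subst_def sum_rows_split algebra_simps sum_subtractf of_rat_eq_id)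
    qed
    then show ?thesis by (intro ext) simp
  next
    case False
    then show ?thesis using assms by (simp add: phi_inv_spec_def)
  qed
qed

lemma phi_inv_spec_exists: "\<exists>u. phi_inv_spec u"
proof -
  obtain C :: "nat \<Rightarrow> nat \<Rightarrow> rat" where
    C: "\<And>i j. i \<in> {1..rk} \<Longrightarrow> j \<in> {1..rk} \<Longrightarrow> (\<Sum>k = 1..rk. C i k * entry A k j) = (if i = j then 1 else 0)"
    by (rule block_inverse) blast
  \<comment> \<open>Exponents of the right-hand side once \<lambda>'' has been moved over; the
    inverse block then solves for \<lambda>'.\<close>
  define r where "r k w = mono_var (Tau k) w - (\<Sum>j\<in>{rk<..dim_row A}. entry A j k * mono_var (Lam j) w)"
    for k w
  define u where "u j = (if j \<in> {1..rk} then (\<lambda>w. \<Sum>k = 1..rk. C k j * r k w) else mono_var (Lam j))" for j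
  have "phi_inv_spec u"
    unfolding phi_inv_spec_def
  proof (intro conjI ballI allI impI)
    fix j i assume j: "j \<in> {1..rk}" and ne: "u j i \<noteq> 0"
    show "i \<in> Tau ` {1..rk} \<union> Lam ` {rk<..dim_row A}"
    proof (rule ccontr)
      assume i: "i \<notin> Tau ` {1..rk} \<union> Lam ` {rk<..dim_row A}"
      have "r k i = 0" if "k \<in> {1..rk}" for k
      proof -
        have "(\<Sum>j\<in>{rk<..dim_row A}. entry A j k * mono_var (Lam j) i) = 0"
          using i by (intro sum.neutral) (auto simp: mono_var_def)
        then show ?thesis using i that by (auto simp: r_def mono_var_def)
      qed
      then have "u j i = 0" using j by (simp add: u_def)
      then show False using ne by simp
    qed
  next
    fix k assume k: "k \<in> {1..rk}"
    show "phi_subst A k u = mono_var (Tau k)"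
    proof
      fix w
      have "(\<Sum>j = 1..rk. entry A j k * u j w) = (\<Sum>j = 1..rk. \<Sum>k' = 1..rk. C k' j * entry A j k * r k' w)"
        by (simp add: u_def sum_distrib_left mult_ac)
      also have "\<dots> = (\<Sum>k' = 1..rk. (\<Sum>j = 1..rk. C k' j * entry A j k) * r k' w)"
        by (subst sum.swap) (simp add: sum_distrib_right)
      also have "\<dots> = (\<Sum>k' = 1..rk. (if k' = k then 1 else 0) * r k' w)"
        using k by (intro sum.cong) (auto simp: C)
      also have "\<dots> = r k w"
        using k by (simp add: if_distrib[of "\<lambda>x. x * _"] cong: if_cong)
      finally have "(\<Sum>j = 1..rk. entry A j k * u j w) = r k w" .
      moreover have "(\<Sum>j\<in>{rk<..dim_row A}. entry A j k * u j w)
          = (\<Sum>j\<in>{rk<..dim_row A}. entry A j k * mono_var (Lam j) w)"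
        by (intro sum.cong) (auto simp: u_def)
      ultimately show "phi_subst A k u w = mono_var (Tau k) w"
        by (simp add: phi_subst_def sum_rows_split r_def)
    qed
  next
    fix j assume "j \<notin> {1..rk}"
    then show "u j = mono_var (Lam j)" unfolding u_def by (rule if_not_P)
  qed
  then show ?thesis by blast
qed

lemma phi_inv_spec_phi_inv: "phi_inv_spec (phi_inv A)"
proof -
  have "phi_inv A = (THE u. phi_inv_spec u)"
    by (simp add: phi_inv_def phi_inv_spec_def)
  moreover have "\<exists>!u. phi_inv_spec u"
    using phi_inv_spec_exists phi_inv_spec_unique by blast
  ultimately show ?thesis using theI'[of phi_inv_spec] by simp
qed

lemma phi_inv_support:
  "j \<in> {1..rk} \<Longrightarrow> supported (Tau ` {1..rk} \<union> Lam ` {rk<..dim_row A}) (phi_inv A j)"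
  using phi_inv_spec_phi_inv unfolding phi_inv_spec_def supported_def by blast

lemma phi_inv_Lam: "j \<notin> {1..rk} \<Longrightarrow> phi_inv A j = mono_var (Lam j)"
  using phi_inv_spec_phi_inv unfolding phi_inv_spec_def by blast

lemma phi_subst_phi_inv: "k \<in> {1..rk} \<Longrightarrow> phi_subst A k (phi_inv A) = mono_var (Tau k)"
  using phi_inv_spec_phi_inv unfolding phi_inv_spec_def by blast

text \<open>The \<open>k\<close>-th column is a combination of the first \<open>rk\<close> ones, so that \<open>\<lambda>''\<close> cancels in \<open>\<psi>\<^sub>k\<close>.\<close>

lemma psi_exponents:
  assumes k: "k \<in> {rk<..dim_col A}"
  obtains c where "\<And>w. psi A k w = mono_var (Tau k) w - (\<Sum>i = 1..rk. c i * mono_var (Tau i) w)"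
proof -
  obtain c where c: "\<And>j. j \<in> {1..dim_row A} \<Longrightarrow> entry A j k = (\<Sum>i = 1..rk. c i * entry A j i)"
    using column_in_span[OF k] by blast
  have "phi_subst A k (phi_inv A) w = (\<Sum>i = 1..rk. c i * mono_var (Tau i) w)" for w
  proof -
    have "phi_subst A k (phi_inv A) w
        = (\<Sum>j = 1..dim_row A. \<Sum>i = 1..rk. c i * (entry A j i * phi_inv A j w))"
      by (simp add: phi_subst_def c sum_distrib_right mult.assoc)
    also have "\<dots> = (\<Sum>i = 1..rk. c i * phi_subst A i (phi_inv A) w)"
      by (subst sum.swap) (simp add: phi_subst_def sum_distrib_left)
    also have "\<dots> = (\<Sum>i = 1..rk. c i * mono_var (Tau i) w)"
      by (intro sum.cong) (simp_all add: phi_subst_phi_inv)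
    finally show ?thesis .
  qed
  then show thesis
    by (intro that[of c]) (simp add: psi_def mono_mult_def mono_inv_def)
qed

lemma psi_Tau_self:
  assumes "k \<in> {rk<..dim_col A}"
  shows "psi A k (Tau k) = 1"
proof -
  obtain c where c: "\<And>w. psi A k w = mono_var (Tau k) w - (\<Sum>i = 1..rk. c i * mono_var (Tau i) w)"
    using psi_exponents[OF assms] by blast
  have "(\<Sum>i = 1..rk. c i * mono_var (Tau i) (Tau k)) = 0"
    using assms by (intro sum.neutral) (auto simp: mono_var_def)
  then show ?thesis by (simp add: c mono_var_def)
qed

lemma psi_eq_0:
  assumes "k \<in> {rk<..dim_col A}" "w \<notin> Tau ` {1..rk}" "w \<noteq> Tau k"
  shows "psi A k w = 0"
proof -
  obtain c where c: "\<And>w. psi A k w = mono_var (Tau k) w - (\<Sum>i = 1..rk. c i * mono_var (Tau i) w)"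
    using psi_exponents[OF assms(1)] by blast
  have "(\<Sum>i = 1..rk. c i * mono_var (Tau i) w) = 0"
    using assms by (intro sum.neutral) (auto simp: mono_var_def)
  then show ?thesis using assms by (simp add: c mono_var_def)
qed

section \<open>Logarithmic form of the relations between \<phi>, its inverse and \<psi>_k\<close>

definition indets :: "indet set" where
  "indets = Tau ` {1..dim_col A} \<union> Lam ` {rk<..dim_row A}"

lemma finite_indets [simp]: "finite indets"
  by (simp add: indets_def)

lemma psi_support:
  assumes "k \<in> {rk<..dim_col A}"
  shows "psi A k w \<noteq> 0 \<Longrightarrow> w \<in> Tau ` {1..rk} \<union> {Tau k}"
  using psi_eq_0[OF assms] by blast

lemma supported_psi:
  assumes "k \<in> {rk<..dim_col A}"
  shows "supported indets (psi A k)"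
  unfolding supported_def indets_def using psi_support[OF assms] assms rank_le_col by fastforce

lemma supported_phi_inv:
  assumes "j \<in> {1..dim_row A}"
  shows "supported indets (phi_inv A j)"
proof (cases "j \<in> {1..rk}")
  case True
  have "Tau ` {1..rk} \<union> Lam ` {rk<..dim_row A} \<subseteq> indets"
    unfolding indets_def using rank_le_col by auto
  then show ?thesis using phi_inv_support[OF True] unfolding supported_def by blast
next
  case False
  then show ?thesis using assms by (auto simp: phi_inv_Lam supported_def indets_def mono_var_def)
qed

text \<open>By its definition, \<psi>_k is the discrepancy between \<tau>_k and \<phi>_k taken at
  the inverse monomials. In this form the relation yields the scaling factors of the blocks from
  recovered indeterminates.\<close>

lemma phi_of_phi_inv:
  assumes k: "k \<in> {1..dim_col A}"
  shows "(\<Sum>j = 1..dim_row A. real_of_rat (entry A j k) * logval indets (phi_inv A j) L)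
    = L (Tau k) - (if k \<le> rk then 0 else logval indets (psi A k) L)"
proof -
  have Tau: "logval indets (mono_var (Tau k)) L = L (Tau k)"
    using k by (intro logval_mono_var) (auto simp: indets_def)
  show ?thesis
  proof (cases "k \<le> rk")
    case True
    then show ?thesis
      using k Tau by (simp add: logval_phi_subst[symmetric] phi_subst_phi_inv)
  next
    case False
    then show ?thesis
      by (simp add: logval_phi_subst[symmetric] psi_def logval_mult logval_inv Tau)
  qed
qed

text \<open>If \<tau> comes from \<phi>, the inverse monomials return the original values, because
  the invertible block admits only one solution with given \<lambda>''.\<close>

lemma logval_phi_inv:
  assumes T: "\<And>k. k \<in> {1..dim_col A} \<Longrightarrow> T (Tau k) = (\<Sum>j = 1..dim_row A. real_of_rat (entry A j k) * l j)"
    and Lam: "\<And>j. j \<in> {rk<..dim_row A} \<Longrightarrow> T (Lam j) = l j"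
    and j: "j \<in> {1..dim_row A}"
  shows "logval indets (phi_inv A j) T = l j"
proof -
  have above: "logval indets (phi_inv A j) T = l j" if "j \<in> {rk<..dim_row A}" for j
    using that Lam by (simp add: phi_inv_Lam logval_mono_var indets_def)
  show ?thesis
  proof (cases "j \<in> {1..rk}")
    case True
    have "logval indets (phi_inv A j) T - l j = 0"
    proof (rule block_injective[OF _ True, of "\<lambda>j. logval indets (phi_inv A j) T - l j"])
      fix k assume k: "k \<in> {1..rk}"
      then have k': "k \<in> {1..dim_col A}" using rank_le_col by auto
      have "(\<Sum>j = 1..dim_row A. real_of_rat (entry A j k) * logval indets (phi_inv A j) T)
          = (\<Sum>j = 1..dim_row A. real_of_rat (entry A j k) * l j)"
        using phi_of_phi_inv[OF k', of T] k T[OF k'] by simp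
      moreover have "(\<Sum>j\<in>{rk<..dim_row A}. real_of_rat (entry A j k) * logval indets (phi_inv A j) T)
          = (\<Sum>j\<in>{rk<..dim_row A}. real_of_rat (entry A j k) * l j)"
        by (intro sum.cong) (simp_all add: above)
      ultimately show "(\<Sum>j = 1..rk. real_of_rat (entry A j k) * (logval indets (phi_inv A j) T - l j)) = 0"
        by (simp add: sum_rows_split algebra_simps sum_subtractf)
    qed
    then show ?thesis by simp
  next
    case False
    then show ?thesis using above j by auto
  qed
qed

text \<open>\<psi>_k is trivial on the image of \<phi>, so its limit along a sequence measures only
  how the block norms deviate from their scaling factors.\<close>

lemma logval_psi:
  assumes T: "\<And>k. k \<in> {1..dim_col A} \<Longrightarrow> T (Tau k) = (\<Sum>j = 1..dim_row A. real_of_rat (entry A j k) * l j)"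
    and Lam: "\<And>j. j \<in> {rk<..dim_row A} \<Longrightarrow> T (Lam j) = l j"
    and k: "k \<in> {rk<..dim_col A}"
  shows "logval indets (psi A k) T = 0"
proof -
  have k': "k \<in> {1..dim_col A}" using k by auto
  have "(\<Sum>j = 1..dim_row A. real_of_rat (entry A j k) * logval indets (phi_inv A j) T) = T (Tau k)"
  proof (unfold T[OF k'], intro sum.cong refl)
    fix j assume "j \<in> {1..dim_row A}"
    then have "logval indets (phi_inv A j) T = l j" using T Lam by (intro logval_phi_inv) auto
    then show "real_of_rat (entry A j k) * logval indets (phi_inv A j) T = real_of_rat (entry A j k) * l j"
      by simp
  qed
  then show ?thesis using phi_of_phi_inv[OF k', of T] k by simp
qed

end

section \<open>Evaluation of monomials\<close>

lemma mono_eval_eq_exp: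
  assumes "\<And>k. k \<in> {1..dim_col A} \<Longrightarrow> r k > 0"
  shows "mono_eval A f r = exp (\<Sum>k = 1..dim_col A. real_of_rat (f (Tau k)) * ln (r k))"
  unfolding mono_eval_def exp_sum[OF finite_atLeastAtMost]
proof (rule prod.cong[OF refl])
  fix k assume "k \<in> {1..dim_col A}"
  then have "r k > 0" by (rule assms)
  then show "(if f (Tau k) = 0 then 1 else r k powr real_of_rat (f (Tau k))) = exp (real_of_rat (f (Tau k)) * ln (r k))"
    by (simp add: powr_def)
qed

lemma mono_eval_nonneg: "mono_eval A f r \<ge> 0"
  unfolding mono_eval_def by (intro prod_nonneg) simp

lemma mono_eval_pow:
  assumes "N > 0"
  shows "mono_eval A (mono_pow f N) r = mono_eval A f r ^ N"
  unfolding mono_eval_def prod_power_distrib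
proof (rule prod.cong[OF refl])
  fix k
  show "(if mono_pow f N (Tau k) = 0 then 1 else r k powr real_of_rat (mono_pow f N (Tau k)))
      = (if f (Tau k) = 0 then 1 else r k powr real_of_rat (f (Tau k))) ^ N"
    using assms by (cases "r k = 0") (simp_all add: mono_pow_def of_rat_mult powr_power zero_power)
qed

text \<open>\<open>powr\<close> with a fixed exponent is continuous at 0 only if the exponent is
  positive and the argument approaches from the nonnegative side.\<close>

lemma tendsto_mono_eval:
  assumes lim: "\<And>k. k \<in> {1..dim_col A} \<Longrightarrow> f (Tau k) \<noteq> 0 \<Longrightarrow> ((\<lambda>n. r n k) \<longlongrightarrow> r0 k) F"
    and pos: "\<And>k. k \<in> {1..dim_col A} \<Longrightarrow> f (Tau k) \<noteq> 0 \<Longrightarrow>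
      r0 k \<noteq> 0 \<or> (f (Tau k) > 0 \<and> eventually (\<lambda>n. r n k \<ge> 0) F)"
  shows "((\<lambda>n. mono_eval A f (r n)) \<longlongrightarrow> mono_eval A f r0) F"
  unfolding mono_eval_def
proof (rule tendsto_prod)
  fix k assume k: "k \<in> {1..dim_col A}"
  show "((\<lambda>n. if f (Tau k) = 0 then 1 else r n k powr real_of_rat (f (Tau k)))
      \<longlongrightarrow> (if f (Tau k) = 0 then 1 else r0 k powr real_of_rat (f (Tau k)))) F"
  proof (cases "f (Tau k) = 0")
    case False
    then have "((\<lambda>n. r n k powr real_of_rat (f (Tau k))) \<longlongrightarrow> r0 k powr real_of_rat (f (Tau k))) F"
      using pos[OF k False] by (intro tendsto_powr'[OF lim[OF k False] tendsto_const]) auto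
    then show ?thesis using False by simp
  qed simp
qed

text \<open>
  Vanishing arguments are replaced by tiny positive ones, so that logarithms can be taken.
\<close>

lemma positive_perturbation:
  assumes r: "\<And>k. r k \<ge> 0" and fin: "finite M"
    and M: "\<And>f k. f \<in> M \<Longrightarrow> k \<in> {1..dim_col A} \<Longrightarrow> r k = 0 \<Longrightarrow> f (Tau k) \<ge> 0"
    and e: "\<epsilon> > 0" "\<And>k. e k > 0"
  shows "\<exists>r'. (\<forall>k. r' k > 0) \<and> (\<forall>k. r k \<le> r' k) \<and> (\<forall>k. r k > 0 \<longrightarrow> r' k = r k) \<and>
    (\<forall>k\<in>{1..dim_col A}. r' k \<le> r k + e k) \<and> (\<forall>f\<in>M. \<bar>mono_eval A f r' - mono_eval A f r\<bar> < \<epsilon>)"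
proof -
  define R where "R \<delta> k = (if r k = 0 then \<delta> else r k)" for \<delta> k
  have "\<forall>\<^sub>F \<delta> in at_right 0. \<bar>mono_eval A f (R \<delta>) - mono_eval A f r\<bar> < \<epsilon>" if f: "f \<in> M" for f
  proof -
    have "((\<lambda>\<delta>. mono_eval A f (R \<delta>)) \<longlongrightarrow> mono_eval A f r) (at_right 0)"
    proof (rule tendsto_mono_eval)
      fix k assume k: "k \<in> {1..dim_col A}" "f (Tau k) \<noteq> 0"
      show "((\<lambda>\<delta>. R \<delta> k) \<longlongrightarrow> r k) (at_right 0)"
        by (cases "r k = 0") (auto simp: R_def intro: tendsto_ident_at)
      have "\<forall>\<^sub>F \<delta> in at_right 0. R \<delta> k \<ge> 0"
        using eventually_at_right_less[of "0::real"] by (rule eventually_mono) (use r[of k] in \<open>auto simp: R_def\<close>)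
      then show "r k \<noteq> 0 \<or> (f (Tau k) > 0 \<and> (\<forall>\<^sub>F \<delta> in at_right 0. R \<delta> k \<ge> 0))"
        using M[OF f k(1)] k(2) by auto
    qed
    from tendstoD[OF this e(1)] show ?thesis by (simp add: dist_real_def)
  qed
  then have "\<forall>\<^sub>F \<delta> in at_right 0. \<forall>f\<in>M. \<bar>mono_eval A f (R \<delta>) - mono_eval A f r\<bar> < \<epsilon>"
    using fin by (intro eventually_ball_finite) auto
  moreover have "\<forall>\<^sub>F \<delta> in at_right 0. \<forall>k\<in>{1..dim_col A}. \<delta> < e k"
    using order_tendstoD(2)[OF tendsto_ident_at e(2)] by (intro eventually_ball_finite) auto
  ultimately have "\<forall>\<^sub>F \<delta> in at_right 0. \<delta> > 0 \<and> (\<forall>k\<in>{1..dim_col A}. \<delta> < e k) \<and>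
      (\<forall>f\<in>M. \<bar>mono_eval A f (R \<delta>) - mono_eval A f r\<bar> < \<epsilon>)"
    using eventually_at_right_less[of "0::real"] by eventually_elim auto
  then obtain \<delta> where "\<delta> > 0" "\<forall>k\<in>{1..dim_col A}. \<delta> < e k"
      "\<forall>f\<in>M. \<bar>mono_eval A f (R \<delta>) - mono_eval A f r\<bar> < \<epsilon>"
    using eventually_happens'[OF trivial_limit_at_right_real] by blast
  moreover have "R \<delta> k \<le> r k + e k" if "\<delta> < e k" for k
    using that e(2)[of k] by (simp add: R_def)
  ultimately show ?thesis
    using r by (intro exI[of _ "R \<delta>"]) (auto simp: R_def order_less_le)
qed


section \<open>The semigroup of a point\<close>

text \<open>\<open>\<xi> k\<close> is the norm of the \<open>k\<close>-th block of the point. The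
  semigroup depends on norms alone; directions enter only through the cones of a multicone.\<close>

locale weighted_matrix = ordered_matrix +
  fixes \<xi> :: "nat \<Rightarrow> real"
  assumes \<xi>_nonneg: "\<xi> k \<ge> 0"
begin

definition J :: "nat set" where
  "J = {k \<in> {1..rk}. \<xi> k = 0}"

definition rad :: "nat \<Rightarrow> real" where
  "rad i = (if i \<in> J then 1 else \<xi> i)"

definition gens :: "wmono set" where
  "gens = Q_closure (
     (\<lambda>j. (phi_inv A j, 0)) ` {1..rk} \<union>
     (\<lambda>k. (psi A k, mono_eval A (psi A k) rad)) ` {rk<..dim_col A} \<union>
     (\<lambda>j. (mono_var (Lam j), 0)) ` {rk<..dim_row A})"

lemma finite_J [simp]: "finite J"
  by (simp add: J_def)

lemma rad_pos: "i \<in> {1..rk} \<Longrightarrow> rad i > 0"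
  using \<xi>_nonneg[of i] by (auto simp: rad_def J_def)

lemma rad_above: "i > rk \<Longrightarrow> rad i = \<xi> i"
  by (auto simp: rad_def J_def)

lemma logval_psi_eq_sum:
  assumes "k \<in> {rk<..dim_col A}"
  shows "logval indets (psi A k) L = (\<Sum>i = 1..dim_col A. real_of_rat (psi A k (Tau i)) * L (Tau i))"
proof -
  have "logval indets (psi A k) L = (\<Sum>w\<in>Tau ` {1..dim_col A}. real_of_rat (psi A k w) * L w)"
    unfolding logval_def indets_def
  proof (intro sum.mono_neutral_right ballI)
    fix w assume "w \<in> Tau ` {1..dim_col A} \<union> Lam ` {rk<..dim_row A} - Tau ` {1..dim_col A}"
    then show "real_of_rat (psi A k w) * L w = 0"
      using psi_eq_0[OF assms, of w] by auto
  qed auto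
  then show ?thesis by (simp add: sum.reindex inj_on_def)
qed

text \<open>\<tau>_k has exponent 1 in \<psi>_k and is its only indeterminate beyond the first
  \<open>rk\<close>, so the factor \<open>\<xi> k\<close> splits off; what remains is a value at
  positive numbers and has a logarithm.\<close>

lemma weight_psi:
  assumes k: "k \<in> {rk<..dim_col A}"
    and s: "\<And>i. i \<in> {1..rk} \<Longrightarrow> s (Tau i) = ln (rad i)" "\<And>i. i > rk \<Longrightarrow> s (Tau i) = 0"
  shows "mono_eval A (psi A k) rad = \<xi> k * exp (logval indets (psi A k) s)"
proof -
  let ?g = "\<lambda>i. if psi A k (Tau i) = 0 then 1 else rad i powr real_of_rat (psi A k (Tau i))"
  let ?I = "{1..dim_col A} - {k}"
  have mem: "k \<in> {1..dim_col A}" using k by auto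
  have "(\<Prod>i\<in>?I. ?g i) = (\<Prod>i\<in>?I. exp (real_of_rat (psi A k (Tau i)) * s (Tau i)))"
  proof (rule prod.cong[OF refl])
    fix i assume i: "i \<in> ?I"
    show "?g i = exp (real_of_rat (psi A k (Tau i)) * s (Tau i))"
    proof (cases "i \<le> rk")
      case True
      then have "i \<in> {1..rk}" using i by auto
      then show ?thesis using rad_pos[of i] s(1)[of i] by (simp add: powr_def)
    next
      case False
      then have "psi A k (Tau i) = 0" using i by (intro psi_eq_0[OF k]) auto
      then show ?thesis by simp
    qed
  qed
  also have "\<dots> = exp (\<Sum>i\<in>?I. real_of_rat (psi A k (Tau i)) * s (Tau i))"
    by (simp add: exp_sum)
  also have "(\<Sum>i\<in>?I. real_of_rat (psi A k (Tau i)) * s (Tau i)) = logval indets (psi A k) s"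
    unfolding logval_psi_eq_sum[OF k] 
    using sum.remove[OF finite_atLeastAtMost mem, of "\<lambda>i. real_of_rat (psi A k (Tau i)) * s (Tau i)"] s(2)[of k] k
    by simp
  finally have "(\<Prod>i\<in>?I. ?g i) = exp (logval indets (psi A k) s)" .
  moreover have "?g k = \<xi> k"
    using k \<xi>_nonneg[of k] by (simp add: psi_Tau_self rad_above)
  ultimately show ?thesis
    unfolding mono_eval_def prod.remove[OF finite_atLeastAtMost mem, of ?g] by simp
qed

lemma weight_psi_eq_0: "k \<in> {rk<..dim_col A} \<Longrightarrow> \<xi> k = 0 \<Longrightarrow> mono_eval A (psi A k) rad = 0"
  using weight_psi[of k "\<lambda>w. case w of Tau i \<Rightarrow> if i \<le> rk then ln (rad i) else 0 | Lam j \<Rightarrow> 0"] by simp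

text \<open>The \<lambda>_j with \<open>j > rk\<close> are \<open>phi_inv A j\<close> and merge with
  the first family. Only a \<psi>_k can contribute an inverse, and this forces
  \<open>\<xi> k \<noteq> 0\<close>, since otherwise the exponent 1 of \<tau>_k makes its weight
  0.\<close>

lemma gens_cases:
  assumes "(f, v) \<in> gens"
  obtains (phi) j where "j \<in> {1..dim_row A}" "f = phi_inv A j" "v = 0"
    | (psi) k where "k \<in> {rk<..dim_col A}" "f = psi A k" "v = mono_eval A (psi A k) rad"
    | (inv) k where "k \<in> {rk<..dim_col A}" "\<xi> k \<noteq> 0" "f = mono_inv (psi A k)"
        "v = inverse (mono_eval A (psi A k) rad)" "mono_eval A (psi A k) rad \<noteq> 0"
proof -
  have Lam: "mono_var (Lam j) = phi_inv A j" if "j \<in> {rk<..dim_row A}" for j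
    using that by (subst phi_inv_Lam) auto
  from assms consider j where "j \<in> {1..rk}" "f = phi_inv A j" "v = 0"
    | k where "k \<in> {rk<..dim_col A}" "f = psi A k" "v = mono_eval A (psi A k) rad"
    | j where "j \<in> {rk<..dim_row A}" "f = mono_var (Lam j)" "v = 0"
    | k where "k \<in> {rk<..dim_col A}" "f = mono_inv (psi A k)"
        "v = inverse (mono_eval A (psi A k) rad)" "mono_eval A (psi A k) rad \<noteq> 0"
    unfolding gens_def Q_closure_def by auto
  then show thesis
  proof cases
    case 1
    then show thesis using phi[of j] rank_le_row by auto
  next
    case 2
    then show thesis using psi by blast
  next
    case 3
    then show thesis using phi[of j] Lam[of j] by auto
  next
    case 4
    then show thesis using inv[of k] weight_psi_eq_0[of k] by auto
  qed
qed

lemma phi_inv_gens: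
  assumes "j \<in> {1..dim_row A}"
  shows "(phi_inv A j, 0) \<in> gens"
proof (cases "j \<in> {1..rk}")
  case True
  then show ?thesis unfolding gens_def Q_closure_def by blast
next
  case False
  then have "phi_inv A j = mono_var (Lam j)" "j \<in> {rk<..dim_row A}"
    using assms phi_inv_Lam[OF False] by auto
  then show ?thesis unfolding gens_def Q_closure_def by blast
qed

lemma psi_gens:
  assumes "k \<in> {rk<..dim_col A}"
  shows "(psi A k, mono_eval A (psi A k) rad) \<in> gens"
  using assms unfolding gens_def Q_closure_def by blast

lemma finite_gens: "finite gens"
proof -
  have "Q_closure S \<subseteq> S \<union> (\<lambda>(f, v). (mono_inv f, inverse v)) ` S" for S
    unfolding Q_closure_def by force
  then have "finite S \<Longrightarrow> finite (Q_closure S)" for S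
    by (meson finite_UnI finite_imageI finite_subset)
  then show ?thesis unfolding gens_def by simp
qed

lemma weights_nonneg_gens: "weights_nonneg gens"
  unfolding weights_nonneg_def
proof
  fix x assume "x \<in> gens"
  then have "(fst x, snd x) \<in> gens" by simp
  then show "snd x \<ge> 0"
    by (rule gens_cases) (simp_all add: mono_eval_nonneg)
qed

lemma supported_gens: "x \<in> gens \<Longrightarrow> supported indets (fst x)"
proof -
  assume "x \<in> gens"
  then have "(fst x, snd x) \<in> gens" by simp
  then show ?thesis
  proof (cases rule: gens_cases)
    case (phi j)
    then show ?thesis using supported_phi_inv by simp
  next
    case (psi k)
    then show ?thesis using supported_psi by simp
  next
    case (inv k)
    then show ?thesis using supported_psi[of k] by (simp add: supported_def mono_inv_def)
  qed
qed

text \<open>Among the generators, \<tau>_k with \<open>k > rk\<close> can occur only in \<psi>_k and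
  its inverse. For \<open>\<xi> k = 0\<close> the weight of \<psi>_k is 0, so the inverse is
  absent.\<close>

lemma exponent_above_rank_nonneg:
  assumes "x \<in> generated gens" "k \<in> {rk<..dim_col A}" "\<xi> k = 0"
  shows "fst x (Tau k) \<ge> 0"
  using assms(1)
proof (induction rule: generated_induct)
  case one
  then show ?case by (simp add: mono_one_def)
next
  case (mult x h)
  have Tau_k: "Tau k \<notin> Tau ` {1..rk}" using assms(2) by auto
  have "(fst x, snd x) \<in> gens" using mult.hyps by simp
  then have "fst x (Tau k) \<ge> 0"
  proof (cases rule: gens_cases)
    case (phi j)
    have "phi_inv A j (Tau k) = 0"
    proof (cases "j \<in> {1..rk}")
      case True
      show ?thesis
        using phi_inv_support[OF True] assms(2) unfolding supported_def by fastforce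
    qed (simp add: phi_inv_Lam mono_var_def)
    then show ?thesis using phi by simp
  next
    case (psi i)
    then show ?thesis
      using psi_Tau_self[of i] psi_eq_0[of i "Tau k"] Tau_k by (cases "i = k") auto
  next
    case (inv i)
    then have "psi A i (Tau k) = 0"
      using psi_eq_0[of i "Tau k"] Tau_k assms(3) by auto
    then show ?thesis using inv by (simp add: mono_inv_def)
  qed
  then show ?case using mult.IH by (simp add: fst_wmono_mult)
qed

section \<open>Elimination for the generators attached to the point\<close>

definition lams :: "nat list" where "lams = [Suc rk..<Suc (dim_row A)]"
definition taus :: "nat list" where "taus = sorted_list_of_set J"

lemma set_lams: "set lams = {rk<..dim_row A}"
  by (auto simp: lams_def)

lemma set_taus: "set taus = J"
  by (simp add: taus_def)

sublocale elimination A lams taus gens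
proof
  show "\<forall>x\<in>gens. supported (Tau ` {1..dim_col A} \<union> Lam ` set lams) (fst x)"
    using supported_gens unfolding set_lams indets_def by blast
qed (rule finite_gens weights_nonneg_gens)+

text \<open>Up to \<open>rk\<close> this is the sign condition defining the semigroup, beyond
  \<open>rk\<close> it comes from the shape of the generators. It keeps monomials continuous where
  such a block norm is 0.\<close>

lemma exponents_nonneg:
  assumes "(f, v) \<in> semi" "k \<in> {1..dim_col A}" "\<xi> k = 0"
  shows "f (Tau k) \<ge> 0"
proof (cases "k \<le> rk")
  case True
  then have "k \<in> set taus" using assms by (simp add: set_taus J_def)
  then show ?thesis using assms(1) unfolding mem_semi_iff admissible_iff by blast
next
  case False
  then show ?thesis
    using assms exponent_above_rank_nonneg[of "(f, _)" k] unfolding mem_semi_iff by auto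
qed

lemma exp_logval_eq_mono_eval:
  assumes "\<And>k. k \<in> {1..dim_col A} \<Longrightarrow> L (Tau k) = ln (r k) \<and> r k > 0"
    and "\<And>j. j \<in> {rk<..dim_row A} \<Longrightarrow> L (Lam j) = 0"
  shows "exp (logval indets f L) = mono_eval A f r"
proof -
  have "logval indets f L = (\<Sum>w\<in>Tau ` {1..dim_col A}. real_of_rat (f w) * L w)"
    unfolding logval_def indets_def by (intro sum.mono_neutral_right) (auto simp: assms(2))
  also have "\<dots> = (\<Sum>k = 1..dim_col A. real_of_rat (f (Tau k)) * L (Tau k))"
    by (simp add: sum.reindex inj_on_def)
  also have "\<dots> = (\<Sum>k = 1..dim_col A. real_of_rat (f (Tau k)) * ln (r k))"
    using assms(1) by (intro sum.cong) simp_all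
  finally show ?thesis using assms(1) by (subst mono_eval_eq_exp) auto
qed

lemma generated_converges:
  assumes "converges indets gens L"
  shows "converges indets (generated gens) L"
  unfolding converges_def
proof
  fix x assume "x \<in> generated gens"
  then show "(\<lambda>n. exp (logval indets (fst x) (L n))) \<longlonglongrightarrow> snd x"
  proof (induction rule: generated_induct)
    case one
    then show ?case by (simp add: logval_one)
  next
    case (mult x h)
    have "(\<lambda>n. exp (logval indets (fst x) (L n)) * exp (logval indets (fst h) (L n))) \<longlonglongrightarrow> snd x * snd h"
      using assms mult by (intro tendsto_mult) (auto simp: converges_def)
    then show ?case
      by (cases x; cases h) (simp add: logval_mult exp_add)
  qed
qed

end

section \<open>Limits of the semigroup along sequences\<close>

definition log_phi :: "rat mat \<Rightarrow> (nat \<Rightarrow> real) \<Rightarrow> nat \<Rightarrow> real" where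
  "log_phi A l k = (\<Sum>j = 1..dim_row A. real_of_rat (entry A j k) * l j)"

context weighted_matrix
begin

text \<open>
  With \<open>l j = \<sigma> ln t\<^sub>j\<close> and \<open>r k = |x\<^sup>(\<^sup>k\<^sup>)|\<close>, this is the convergence of \<open>(x; t)\<close> to a point of \<open>S\<^sub>\<chi>\<close> with
  \<open>|\<xi>\<^sup>(\<^sup>k\<^sup>)| = \<xi> k\<close>, directions being left aside.
\<close>

definition limit_data :: "(nat \<Rightarrow> nat \<Rightarrow> real) \<Rightarrow> (nat \<Rightarrow> nat \<Rightarrow> real) \<Rightarrow> bool" where
  "limit_data r l \<longleftrightarrow> (\<forall>j\<in>{1..dim_row A}. filterlim (\<lambda>n. l n j) at_bot sequentially) \<and>
    (\<forall>k\<in>{1..dim_col A}. (\<lambda>n. r n k / exp (log_phi A (l n) k)) \<longlonglongrightarrow> \<xi> k)"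

lemma perturbed_sequence:
  assumes r: "\<forall>n k. r n k \<ge> 0" and fin: "finite M"
    and M: "\<forall>n. \<forall>f\<in>M. \<forall>k\<in>{1..dim_col A}. r n k = 0 \<longrightarrow> f (Tau k) \<ge> 0"
    and e: "\<forall>n k. e n k > 0"
  shows "\<exists>r' :: nat \<Rightarrow> nat \<Rightarrow> real. (\<forall>n k. r' n k > 0) \<and> (\<forall>n k. r n k \<le> r' n k) \<and>
    (\<forall>n k. r n k > 0 \<longrightarrow> r' n k = r n k) \<and> (\<forall>n. \<forall>k\<in>{1..dim_col A}. r' n k \<le> r n k + e n k) \<and>
    (\<forall>f\<in>M. \<forall>v. (\<lambda>n. mono_eval A f (r' n)) \<longlonglongrightarrow> v \<longleftrightarrow> (\<lambda>n. mono_eval A f (r n)) \<longlonglongrightarrow> v)"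
proof -
  have "\<exists>r'. (\<forall>k. r' k > 0) \<and> (\<forall>k. r n k \<le> r' k) \<and> (\<forall>k. r n k > 0 \<longrightarrow> r' k = r n k) \<and>
    (\<forall>k\<in>{1..dim_col A}. r' k \<le> r n k + e n k) \<and>
    (\<forall>f\<in>M. \<bar>mono_eval A f r' - mono_eval A f (r n)\<bar> < inverse (real (Suc n)))" for n
  proof (rule positive_perturbation)
    show "f (Tau k) \<ge> 0" if "f \<in> M" "k \<in> {1..dim_col A}" "r n k = 0" for f k
      using M that by blast
  qed (simp_all add: r fin e)
  then obtain r' where r': "\<And>n. (\<forall>k. r' n k > 0) \<and> (\<forall>k. r n k \<le> r' n k) \<and> (\<forall>k. r n k > 0 \<longrightarrow> r' n k = r n k) \<and>
    (\<forall>k\<in>{1..dim_col A}. r' n k \<le> r n k + e n k) \<and>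
    (\<forall>f\<in>M. \<bar>mono_eval A f (r' n) - mono_eval A f (r n)\<bar> < inverse (real (Suc n)))"
    by metis
  have "(\<lambda>n. mono_eval A f (r' n)) \<longlonglongrightarrow> v \<longleftrightarrow> (\<lambda>n. mono_eval A f (r n)) \<longlonglongrightarrow> v" if f: "f \<in> M" for f v
  proof -
    have "(\<lambda>n. mono_eval A f (r' n) - mono_eval A f (r n)) \<longlonglongrightarrow> 0"
    proof (rule Lim_null_comparison[OF _ LIMSEQ_inverse_real_of_nat])
      show "\<forall>\<^sub>F n in sequentially. norm (mono_eval A f (r' n) - mono_eval A f (r n)) \<le> inverse (real (Suc n))"
        using r' f by (intro always_eventually allI) (simp add: less_imp_le)
    qed
    then show ?thesis by (rule Lim_transform_eq)
  qed
  then show ?thesis using r' by blast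
qed

text \<open>\<open>L\<close> is a point in the image of \<phi> plus the correction
  \<open>ln d\<close>. On the image an inverse monomial is \<open>exp (l n j)\<close>, which tends
  to 0, and \<psi>_k is 1; the correction multiplies by the value of the monomial at
  \<open>d\<close>, which converges to its value at \<open>rad\<close>.\<close>

lemma gens_converge:
  assumes l: "\<And>j. j \<in> {1..dim_row A} \<Longrightarrow> filterlim (\<lambda>n. l n j) at_bot sequentially"
    and d: "\<And>k. k \<in> {1..dim_col A} \<Longrightarrow> (\<lambda>n. d n k) \<longlonglongrightarrow> rad k" "\<And>n k. d n k > 0"
    and L: "\<And>n k. k \<in> {1..dim_col A} \<Longrightarrow> L n (Tau k) = log_phi A (l n) k + ln (d n k)"
      "\<And>n j. j \<in> {rk<..dim_row A} \<Longrightarrow> L n (Lam j) = l n j"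
  shows "converges indets gens L"
proof -
  define T where "T n w = (case w of Tau k \<Rightarrow> log_phi A (l n) k | Lam j \<Rightarrow> l n j)" for n w
  have split: "exp (logval indets f (L n)) = exp (logval indets f (T n)) * mono_eval A f (d n)" for f n
  proof -
    have "exp (logval indets f (\<lambda>w. L n w - T n w)) = mono_eval A f (d n)"
      by (rule exp_logval_eq_mono_eval) (simp_all add: L T_def d(2))
    then show ?thesis by (simp add: logval_diff exp_diff field_simps)
  qed
  have phi: "logval indets (phi_inv A j) (T n) = l n j" if "j \<in> {1..dim_row A}" for j n
    using that by (intro logval_phi_inv) (simp_all add: T_def log_phi_def)
  have psi: "logval indets (psi A k) (T n) = 0" if "k \<in> {rk<..dim_col A}" for k n
    using that by (intro logval_psi[of _ "l n"]) (simp_all add: T_def log_phi_def)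
  have lim_psi: "(\<lambda>n. exp (logval indets (psi A k) (L n))) \<longlonglongrightarrow> mono_eval A (psi A k) rad"
    if k: "k \<in> {rk<..dim_col A}" for k
  proof -
    have "(\<lambda>n. mono_eval A (psi A k) (d n)) \<longlonglongrightarrow> mono_eval A (psi A k) rad"
    proof (rule tendsto_mono_eval)
      fix i assume i: "i \<in> {1..dim_col A}" "psi A k (Tau i) \<noteq> 0"
      then have "i \<in> {1..rk} \<or> i = k" using psi_support[OF k i(2)] by auto
      then show "rad i \<noteq> 0 \<or> (psi A k (Tau i) > 0 \<and> (\<forall>\<^sub>F n in sequentially. d n i \<ge> 0))"
        using rad_pos[of i] psi_Tau_self[OF k] d(2) by (auto intro!: always_eventually less_imp_le)
    qed (use d(1) in simp)
    then show ?thesis by (simp add: split psi[OF k])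
  qed
  show ?thesis
    unfolding converges_def
  proof
    fix x assume "x \<in> gens"
    then have "(fst x, snd x) \<in> gens" by simp
    then show "(\<lambda>n. exp (logval indets (fst x) (L n))) \<longlonglongrightarrow> snd x"
    proof (cases rule: gens_cases)
      case (phi j)
      have "(\<lambda>n. mono_eval A (phi_inv A j) (d n)) \<longlonglongrightarrow> mono_eval A (phi_inv A j) rad"
      proof (rule tendsto_mono_eval)
        fix i assume i: "i \<in> {1..dim_col A}" "phi_inv A j (Tau i) \<noteq> 0"
        have "i \<in> {1..rk}"
        proof (cases "j \<in> {1..rk}")
          case True
          then show ?thesis using phi_inv_support[OF True] i(2) unfolding supported_def by blast
        next
          case False
          then show ?thesis using i(2) by (simp add: phi_inv_Lam mono_var_def)
        qed
        then show "rad i \<noteq> 0 \<or> (phi_inv A j (Tau i) > 0 \<and> (\<forall>\<^sub>F n in sequentially. d n i \<ge> 0))"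
          using rad_pos[of i] by auto
      qed (use d(1) in simp)
      moreover have "(\<lambda>n. exp (l n j)) \<longlonglongrightarrow> 0"
        using l[OF phi(1)] by (simp add: exp_tendsto_0_iff)
      ultimately have "(\<lambda>n. exp (l n j) * mono_eval A (phi_inv A j) (d n)) \<longlonglongrightarrow> 0 * mono_eval A (phi_inv A j) rad"
        by (intro tendsto_mult)
      then show ?thesis
        using phi \<open>\<And>j n. j \<in> {1..dim_row A} \<Longrightarrow> logval indets (phi_inv A j) (T n) = l n j\<close>[OF phi(1)]
        by (simp add: split)
    next
      case (psi k)
      then show ?thesis using lim_psi by simp
    next
      case (inv k)
      then have "(\<lambda>n. inverse (exp (logval indets (psi A k) (L n)))) \<longlonglongrightarrow> snd x"
        using lim_psi[OF inv(1)] by (simp add: tendsto_inverse)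
      then show ?thesis using inv by (simp add: logval_inv exp_minus)
    qed
  qed
qed

lemma mono_eval_H_tau:
  assumes f: "f \<in> H_tau A" and L: "\<And>k. k \<in> {1..dim_col A} \<Longrightarrow> L (Tau k) = ln (r k) \<and> r k > 0"
  shows "exp (logval indets f L) = mono_eval A f r"
proof -
  define L0 where "L0 w = (case w of Tau k \<Rightarrow> L (Tau k) | Lam j \<Rightarrow> 0)" for w
  have "logval indets f L = logval indets f L0"
    unfolding logval_def
  proof (rule sum.cong[OF refl])
    fix w
    have "f (Lam j) = 0" for j using f by (auto simp: H_tau_def)
    then show "real_of_rat (f w) * L w = real_of_rat (f w) * L0 w"
      by (cases w) (simp_all add: L0_def)
  qed
  also have "exp \<dots> = mono_eval A f r"
    by (rule exp_logval_eq_mono_eval) (simp_all add: L0_def L)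
  finally show ?thesis .
qed

lemma semi_subset_H_tau: "(f, v) \<in> semi \<Longrightarrow> f \<in> H_tau A"
  unfolding semi_def mem_semigroup_iff by blast

text \<open>For \<open>k \<in> J\<close> the block norm is first replaced by its scaling factor,
  which makes the generators converge. Restoring the norms multiplies by a monomial in quotients
  that tend to 0, with nonnegative exponents: it tends to 0 if one of them is positive and is 1
  otherwise, which is the weight rule of the semigroup.\<close>

lemma semi_converges:
  assumes r: "\<And>n k. r n k \<ge> 0" "\<And>n k. k \<in> {1..dim_col A} \<Longrightarrow> \<xi> k \<noteq> 0 \<Longrightarrow> r n k > 0"
    and lim: "limit_data r l" and f: "(f, v) \<in> semi"
  shows "(\<lambda>n. mono_eval A f (r n)) \<longlonglongrightarrow> v"
proof -
  define E where "E n k = exp (log_phi A (l n) k)" for n k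
  have E: "E n k > 0" "ln (E n k) = log_phi A (l n) k" for n k by (simp_all add: E_def)
  obtain w where w: "(f, w) \<in> generated gens" "admissible (set us) f"
      "v = (if degenerate (set us) f then 0 else w)"
    using f unfolding mem_semi_iff by blast
  have nonneg: "f (Tau k) \<ge> 0" if "k \<in> {1..dim_col A}" "\<xi> k = 0" for k
    using exponents_nonneg[OF f that] .
  have "f (Tau k) \<ge> 0" if "k \<in> {1..dim_col A}" "r n k = 0" for n k
    using nonneg[OF that(1)] r(2)[OF that(1), of n] that by (cases "\<xi> k = 0") auto
  then have c1: "\<forall>n. \<forall>f'\<in>{f}. \<forall>k\<in>{1..dim_col A}. r n k = 0 \<longrightarrow> f' (Tau k) \<ge> 0" by blast
  \<comment> \<open>The perturbation is measured in units of the scaling factor, so that it still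
    vanishes after division by it.\<close>
  have c2: "\<forall>n k. E n k * inverse (real (Suc n)) > 0" using E by simp
  have c0: "\<forall>n k. r n k \<ge> 0" using r(1) by blast
  have c3: "finite {f}" by simp
  obtain r' :: "nat \<Rightarrow> nat \<Rightarrow> real" where r': "\<And>n k. r' n k > 0" "\<And>n k. r n k \<le> r' n k"
    "\<And>n k. k \<in> {1..dim_col A} \<Longrightarrow> r' n k \<le> r n k + E n k * inverse (real (Suc n))"
    "(\<lambda>n. mono_eval A f (r' n)) \<longlonglongrightarrow> v \<longleftrightarrow> (\<lambda>n. mono_eval A f (r n)) \<longlonglongrightarrow> v"
    using perturbed_sequence[where r = r and M = "{f}" and e = "\<lambda>n k. E n k * inverse (real (Suc n))",
        OF c0 c3 c1 c2] by blast
  define q where "q n k = r' n k / E n k" for n k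
  have q_pos: "q n k > 0" for n k using r'(1) E(1) by (simp add: q_def)
  have ln_q: "log_phi A (l n) k + ln (q n k) = ln (r' n k)" for n k
    using r'(1)[of n k] E(1)[of n k] E(2)[of n k] by (simp add: q_def ln_div)
  have q_lim: "(\<lambda>n. q n k) \<longlonglongrightarrow> \<xi> k" if k: "k \<in> {1..dim_col A}" for k
  proof (rule tendsto_sandwich)
    show lim_r: "(\<lambda>n. r n k / E n k) \<longlonglongrightarrow> \<xi> k"
      using lim k by (simp add: limit_data_def E_def)
    show "(\<lambda>n. r n k / E n k + inverse (real (Suc n))) \<longlonglongrightarrow> \<xi> k"
      using tendsto_add[OF lim_r LIMSEQ_inverse_real_of_nat] by simp
    show "\<forall>\<^sub>F n in sequentially. r n k / E n k \<le> q n k"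
      unfolding q_def using r'(2) less_imp_le[OF E(1)] by (intro always_eventually allI divide_right_mono)
    show "\<forall>\<^sub>F n in sequentially. q n k \<le> r n k / E n k + inverse (real (Suc n))"
    proof (intro always_eventually allI)
      fix n
      have "q n k \<le> (r n k + E n k * inverse (real (Suc n))) / E n k"
        unfolding q_def using r'(3)[OF k] E(1)[of n k] by (intro divide_right_mono) auto
      also have "\<dots> = r n k / E n k + inverse (real (Suc n))"
        using E(1)[of n k] by (simp add: add_divide_distrib)
      finally show "q n k \<le> r n k / E n k + inverse (real (Suc n))" .
    qed
  qed
  \<comment> \<open>\<open>q\<close> is the product of \<open>d\<close>, whose limit is positive on
    \<open>{1..rk}\<close>, and of \<open>\<rho>\<close>, which carries the decay on
    \<open>J\<close>.\<close>
  define d where "d n k = (if k \<in> J then 1 else q n k)" for n k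
  define \<rho> where "\<rho> n k = (if k \<in> J then q n k else 1)" for n k
  define L where "L n u = (case u of Tau k \<Rightarrow> log_phi A (l n) k + ln (d n k) | Lam j \<Rightarrow> l n j)" for n u
  define L' where "L' n u = (case u of Tau k \<Rightarrow> ln (r' n k) | Lam j \<Rightarrow> l n j)" for n u
  have "converges indets gens L"
  proof (rule gens_converge)
    fix k assume "k \<in> {1..dim_col A}"
    then show "(\<lambda>n. d n k) \<longlonglongrightarrow> rad k"
      using q_lim by (cases "k \<in> J") (simp_all add: d_def rad_def)
  qed (use lim q_pos in \<open>simp_all add: limit_data_def L_def d_def\<close>)
  from generated_converges[OF this] w(1)
  have lim_w: "(\<lambda>n. exp (logval indets f (L n))) \<longlonglongrightarrow> w"
    by (force simp: converges_def)
  have fac: "mono_eval A f (r' n) = exp (logval indets f (L n)) * mono_eval A f (\<rho> n)" for n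
  proof -
    have "exp (logval indets f (\<lambda>u. L' n u - L n u)) = mono_eval A f (\<rho> n)"
    proof (rule exp_logval_eq_mono_eval)
      fix k
      show "L' n (Tau k) - L n (Tau k) = ln (\<rho> n k) \<and> \<rho> n k > 0"
        using ln_q[of n k] q_pos[of n k] by (auto simp: L'_def L_def \<rho>_def d_def)
    qed (simp add: L'_def L_def)
    moreover have "exp (logval indets f (L' n)) = mono_eval A f (r' n)"
      using semi_subset_H_tau[OF f] r'(1) by (intro mono_eval_H_tau) (auto simp: L'_def)
    ultimately show ?thesis by (simp add: logval_diff exp_diff field_simps)
  qed
  have J: "k \<in> {1..dim_col A}" "\<xi> k = 0" if "k \<in> J" for k
    using that rank_le_col by (auto simp: J_def)
  have "(\<lambda>n. mono_eval A f (\<rho> n)) \<longlonglongrightarrow> mono_eval A f (\<lambda>k. if k \<in> J then 0 else 1)"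
  proof (rule tendsto_mono_eval)
    fix k assume k: "k \<in> {1..dim_col A}" "f (Tau k) \<noteq> 0"
    show "(\<lambda>n. \<rho> n k) \<longlonglongrightarrow> (if k \<in> J then 0 else 1)"
      using q_lim[OF k(1)] J(2)[of k] by (cases "k \<in> J") (simp_all add: \<rho>_def)
    have "f (Tau k) > 0" if "k \<in> J" using nonneg[OF J[OF that]] k(2) by simp
    moreover have "\<rho> n k \<ge> 0" for n using q_pos[of n k] by (simp add: \<rho>_def less_imp_le)
    ultimately show "(if k \<in> J then 0 else 1) \<noteq> (0::real) \<or>
        (f (Tau k) > 0 \<and> (\<forall>\<^sub>F n in sequentially. \<rho> n k \<ge> 0))" by simp
  qed
  moreover have "mono_eval A f (\<lambda>k. if k \<in> J then 0 else 1) = (if degenerate (set us) f then 0 else 1)"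
  proof (cases "degenerate (set us) f")
    case True
    then obtain k where k: "k \<in> J" "f (Tau k) > 0" unfolding degenerate_iff set_taus by auto
    then show ?thesis
      using True J(1)[OF k(1)] unfolding mono_eval_def by (auto intro!: prod_zero bexI[of _ k])
  next
    case False
    have "f (Tau k) = 0" if "k \<in> J" for k
    proof -
      have "\<not> f (Tau k) > 0" using False that unfolding degenerate_iff set_taus by auto
      then show ?thesis using nonneg[OF J[OF that]] by simp
    qed
    then show ?thesis using False unfolding mono_eval_def by (auto intro!: prod.neutral)
  qed
  ultimately have "(\<lambda>n. mono_eval A f (r' n)) \<longlonglongrightarrow> w * (if degenerate (set us) f then 0 else 1)"
    unfolding fac using lim_w by (intro tendsto_mult) auto
  moreover have "w * (if degenerate (set us) f then 0 else 1) = v" using w(3) by simp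
  ultimately show ?thesis using r'(4) by simp
qed

text \<open>Undoing the elimination yields indeterminates that satisfy all conditions of G. Those
  from \<open>phi_inv\<close> say that the \<open>l j\<close> tend to minus infinity, those from
  \<open>psi\<close> give the limits of the blocks beyond \<open>rk\<close>, and the comparison of
  old and new \<tau>_k handles \<open>J\<close>.\<close>

lemma limit_data_exists:
  assumes r: "\<And>n k. r n k \<ge> 0" "\<And>n k. k \<in> {1..dim_col A} \<Longrightarrow> \<xi> k \<noteq> 0 \<Longrightarrow> r n k > 0"
    and lim: "\<And>f v. (f, v) \<in> elims us gens \<Longrightarrow> (\<lambda>n. mono_eval A f (r n)) \<longlonglongrightarrow> v"
  shows "\<exists>l. limit_data r l"
proof -
  define M where "M = fst ` elims us gens"
  have nonneg: "f (Tau k) \<ge> 0" if f: "f \<in> M" and k: "k \<in> {1..dim_col A}" "r n k = 0" for n f k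
  proof -
    obtain v where "(f, v) \<in> semi" using f elims_subset_semi by (auto simp: M_def)
    moreover have "\<xi> k = 0" using r(2)[OF k(1), of n] k(2) by auto
    ultimately show ?thesis using exponents_nonneg k(1) by blast
  qed
  then have c1: "\<forall>n. \<forall>f\<in>M. \<forall>k\<in>{1..dim_col A}. r n k = 0 \<longrightarrow> f (Tau k) \<ge> 0" by blast
  have c0: "\<forall>n k. r n k \<ge> 0" using r(1) by blast
  have c2: "\<forall>(n::nat) (k::nat). 0 < (1::real)" by simp
  have fin: "finite M" by (simp add: M_def finite_elims finite_gens)
  obtain r' :: "nat \<Rightarrow> nat \<Rightarrow> real" where r': "\<And>n k. r' n k > 0" "\<And>n k. r n k \<le> r' n k"
    "\<And>n k. r n k > 0 \<Longrightarrow> r' n k = r n k"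
    "\<And>f v. f \<in> M \<Longrightarrow> (\<lambda>n. mono_eval A f (r' n)) \<longlonglongrightarrow> v \<longleftrightarrow> (\<lambda>n. mono_eval A f (r n)) \<longlonglongrightarrow> v"
    using perturbed_sequence[where r = r and M = M and e = "\<lambda>n k. 1", OF c0 fin c1 c2] by blast
  \<comment> \<open>The value 0 for the \<lambda>_j is a placeholder: monomials of
    \<open>H_tau A\<close> do not contain them, and the undoing of the elimination overwrites
    it.\<close>
  define L where "L n u = (case u of Tau k \<Rightarrow> ln (r' n k) | Lam j \<Rightarrow> 0)" for n u
  have conv: "converges indets (elims us gens) L"
    unfolding converges_def
  proof
    fix x assume x: "x \<in> elims us gens"
    then have "fst x \<in> H_tau A" using elims_subset_H_tau by auto
    then have "exp (logval indets (fst x) (L n)) = mono_eval A (fst x) (r' n)" for n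
      using r'(1) by (intro mono_eval_H_tau) (auto simp: L_def)
    moreover have "(\<lambda>n. mono_eval A (fst x) (r' n)) \<longlonglongrightarrow> snd x"
      using x lim[of "fst x" "snd x"] r'(4)[of "fst x"] by (simp add: M_def)
    ultimately show "(\<lambda>n. exp (logval indets (fst x) (L n))) \<longlonglongrightarrow> snd x" by simp
  qed
  have sub: "snd ` set us \<subseteq> indets"
  proof -
    have "J \<subseteq> {1..dim_col A}" using rank_le_col by (auto simp: J_def)
    then show ?thesis unfolding snd_us set_lams set_taus indets_def by blast
  qed
  have dist: "distinct (map snd us)"
    by (intro distinct_us) (simp_all add: lams_def taus_def)
  have inv: "inv_closed gens" unfolding gens_def by (rule inv_closed_Q_closure)
  obtain L' where L': "converges indets gens L'"
      "\<And>n u. u \<notin> Lam ` {rk<..dim_row A} \<union> Tau ` J \<Longrightarrow> L' n u = L n u"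
      "\<And>u. (True, u) \<in> set us \<Longrightarrow> (\<lambda>n. exp (L n u - L' n u)) \<longlonglongrightarrow> 0"
    using converges_undo_elims[OF finite_indets sub dist finite_gens inv weights_nonneg_gens conv]
    unfolding snd_us set_lams set_taus by blast
  \<comment> \<open>Subtracting \<open>ln (rad i)\<close> passes from block norms to scaling factors
    on the first \<open>rk\<close> indices, so that the quotient of the two tends to
    \<open>\<xi> k\<close> and not to 1. On \<open>J\<close>, where \<open>rad\<close> is 1, nothing
    changes: there \<tau>_k already is the scaling factor.\<close>
  define s where "s u = (case u of Tau i \<Rightarrow> if i \<in> {1..rk} then ln (rad i) else 0 | Lam j \<Rightarrow> 0)" for u
  define L2 where "L2 n u = L' n u - s u" for n u
  define l where "l n j = logval indets (phi_inv A j) (L2 n)" for n j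
  have gen_lim: "(\<lambda>n. exp (logval indets f (L' n))) \<longlonglongrightarrow> v" if "(f, v) \<in> gens" for f v
    using L'(1) that by (force simp: converges_def)
  have gen_lim2: "(\<lambda>n. exp (logval indets f (L2 n))) \<longlonglongrightarrow> v / exp (logval indets f s)" if "(f, v) \<in> gens" for f v
    unfolding L2_def logval_diff exp_diff by (intro tendsto_divide gen_lim[OF that] tendsto_const) simp
  have l_lim: "filterlim (\<lambda>n. l n j) at_bot sequentially" if "j \<in> {1..dim_row A}" for j
    using gen_lim2[OF phi_inv_gens[OF that]] by (simp add: l_def exp_tendsto_0_iff)
  have log_phi_l: "log_phi A (l n) k = L2 n (Tau k) - (if k \<le> rk then 0 else logval indets (psi A k) (L2 n))"
    if "k \<in> {1..dim_col A}" for n k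
    unfolding log_phi_def l_def by (rule phi_of_phi_inv[OF that])
  have above: "L' n (Tau k) = ln (r' n k)" if "k \<notin> J" for n k
    using L'(2)[of "Tau k" n] that by (auto simp: L_def)
  have lim': "(\<lambda>n. r' n k / exp (log_phi A (l n) k)) \<longlonglongrightarrow> \<xi> k" if k: "k \<in> {1..dim_col A}" for k
  proof -
    consider "k \<in> J" | "k \<notin> J" "k \<le> rk" | "k > rk" by linarith
    then show ?thesis
    proof cases
      case 1
      \<comment> \<open>Here \<tau>_k was recovered as an unknown, with the block norm negligible
        against it.\<close>
      then have "k \<le> rk" "s (Tau k) = 0" "\<xi> k = 0" by (auto simp: J_def s_def rad_def)
      then have "r' n k / exp (log_phi A (l n) k) = exp (L n (Tau k) - L' n (Tau k))" for n
        using r'(1)[of n k] by (simp add: log_phi_l[OF k] L2_def L_def exp_diff)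
      moreover have "(True, Tau k) \<in> set us" using 1 by (simp add: True_mem_us set_taus)
      ultimately show ?thesis using L'(3) \<open>\<xi> k = 0\<close> by simp
    next
      case 2
      then have "k \<in> {1..rk}" using k by auto
      then have "s (Tau k) = ln (\<xi> k)" "\<xi> k > 0"
        using 2 rad_pos[of k] by (simp_all add: s_def rad_def)
      then have "r' n k / exp (log_phi A (l n) k) = \<xi> k" for n
        using r'(1)[of n k] 2 by (simp add: log_phi_l[OF k] L2_def above exp_diff)
      then show ?thesis by simp
    next
      case 3
      then have k': "k \<in> {rk<..dim_col A}" "k \<notin> J" "s (Tau k) = 0" using k by (auto simp: J_def s_def)
      have "r' n k / exp (log_phi A (l n) k) = exp (logval indets (psi A k) (L2 n))" for n
        using r'(1)[of n k] 3 k' by (simp add: log_phi_l[OF k] L2_def above exp_diff)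
      moreover have "mono_eval A (psi A k) rad / exp (logval indets (psi A k) s) = \<xi> k"
        using weight_psi[OF k'(1), of s] by (simp add: s_def)
      ultimately show ?thesis using gen_lim2[OF psi_gens[OF k'(1)]] by simp
    qed
  qed
  \<comment> \<open>Back from \<open>r'\<close> to \<open>r\<close>: the two agree where
    \<open>\<xi> k \<noteq> 0\<close>, and elsewhere \<open>r\<close> lies between 0 and
    \<open>r'\<close>.\<close>
  have "(\<lambda>n. r n k / exp (log_phi A (l n) k)) \<longlonglongrightarrow> \<xi> k" if k: "k \<in> {1..dim_col A}" for k
  proof (cases "\<xi> k = 0")
    case True
    show ?thesis
    proof (rule tendsto_sandwich)
      show "(\<lambda>n. 0) \<longlonglongrightarrow> \<xi> k" using True by simp
      show "(\<lambda>n. r' n k / exp (log_phi A (l n) k)) \<longlonglongrightarrow> \<xi> k" by (rule lim'[OF k])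
      show "\<forall>\<^sub>F n in sequentially. 0 \<le> r n k / exp (log_phi A (l n) k)" using r(1) by simp
      show "\<forall>\<^sub>F n in sequentially. r n k / exp (log_phi A (l n) k) \<le> r' n k / exp (log_phi A (l n) k)"
        using r'(2) by (intro always_eventually allI divide_right_mono) simp_all
    qed
  next
    case False
    then have "r' n k = r n k" for n using r(2)[OF k] r'(3) by simp
    then show ?thesis using lim'[OF k] by simp
  qed
  then show ?thesis using l_lim unfolding limit_data_def by blast
qed

end

section \<open>Sequential description of the multi-normal cone\<close>

lemma block_nth: "vec_nth (block blk k x) i = (if blk i = k then vec_nth x i else 0)"
  by (simp add: block_def)

lemma block_in_block_space: "block blk k x \<in> block_space blk k"
  by (simp add: block_space_def block_nth)

lemma tendsto_block:
  assumes "(f \<longlongrightarrow> y) F"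
  shows "((\<lambda>n. block blk k (f n)) \<longlongrightarrow> block blk k y) F"
proof (rule vec_tendstoI)
  fix i
  show "((\<lambda>n. vec_nth (block blk k (f n)) i) \<longlongrightarrow> vec_nth (block blk k y) i) F"
    using tendsto_vec_nth[OF assms, of i] by (simp add: block_nth)
qed

text \<open>Only finitely many coordinates are involved, so a smallest radius exists and can replace
  the neighbourhoods of the product topology.\<close>

lemma Xtilde_closure_iff:
  assumes p: "(x, t) \<in> topspace (Xtilde A)" and t: "\<And>j. j \<in> {1..dim_row A} \<Longrightarrow> t j = 0"
  shows "(x, t) \<in> Xtilde A closure_of S \<longleftrightarrow>
    (\<forall>e>0. \<exists>y s. (y, s) \<in> S \<and> (y, s) \<in> topspace (Xtilde A) \<and> dist y x < e \<and> (\<forall>j\<in>{1..dim_row A}. \<bar>s j\<bar> < e))"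
proof (intro iffI allI impI)
  fix e :: real
  assume cl: "(x, t) \<in> Xtilde A closure_of S" and e: "e > 0"
  let ?T = "ball x e \<times> PiE {1..dim_row A} (\<lambda>_. {- e<..<e})"
  have "openin (Xtilde A) ?T"
    unfolding Xtilde_def openin_prod_Times_iff by (simp add: openin_PiE)
  moreover have "(x, t) \<in> ?T"
    using p t e by (auto simp: Xtilde_def PiE_iff)
  moreover have "\<forall>T. (x, t) \<in> T \<and> openin (Xtilde A) T \<longrightarrow> (\<exists>q. q \<in> S \<and> q \<in> T)"
    using cl unfolding in_closure_of by (rule conjunct2)
  ultimately obtain q where q: "q \<in> S" "q \<in> ?T" by meson
  have "q \<in> topspace (Xtilde A)"
    using q openin_subset[OF \<open>openin (Xtilde A) ?T\<close>] by blast
  show "\<exists>y s. (y, s) \<in> S \<and> (y, s) \<in> topspace (Xtilde A) \<and> dist y x < e \<and> (\<forall>j\<in>{1..dim_row A}. \<bar>s j\<bar> < e)"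
  proof (intro exI conjI ballI)
    show "(fst q, snd q) \<in> S" "(fst q, snd q) \<in> topspace (Xtilde A)"
      using \<open>q \<in> topspace (Xtilde A)\<close> q by simp_all
    show "dist (fst q) x < e" using q by (auto simp: dist_commute)
    fix j assume "j \<in> {1..dim_row A}"
    then have "snd q j \<in> {- e<..<e}" using q(2) by (auto simp: PiE_iff)
    then show "\<bar>snd q j\<bar> < e" by auto
  qed
next
  assume *: "\<forall>e>0. \<exists>y s. (y, s) \<in> S \<and> (y, s) \<in> topspace (Xtilde A) \<and> dist y x < e \<and>
    (\<forall>j\<in>{1..dim_row A}. \<bar>s j\<bar> < e)"
  show "(x, t) \<in> Xtilde A closure_of S"
    unfolding in_closure_of
  proof (intro conjI p allI impI)
    fix T assume T: "(x, t) \<in> T \<and> openin (Xtilde A) T"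
    then have prod: "openin (prod_topology euclidean (powertop_real {1..dim_row A})) T" by (simp add: Xtilde_def)
    have "\<exists>U V. openin euclidean U \<and> openin (powertop_real {1..dim_row A}) V \<and> x \<in> U \<and> t \<in> V \<and> U \<times> V \<subseteq> T"
      using T by (intro prod[unfolded openin_prod_topology_alt, rule_format]) simp
    then obtain U V where "openin euclidean U" and UV: "openin (powertop_real {1..dim_row A}) V" "x \<in> U" "t \<in> V" "U \<times> V \<subseteq> T"
      by (elim exE conjE)
    then have U: "open U" by (simp only: open_openin)
    obtain W where "\<forall>j\<in>{1..dim_row A}. openin euclideanreal (W j)" and W: "t \<in> PiE {1..dim_row A} W" "PiE {1..dim_row A} W \<subseteq> V"
      using UV(1)[unfolded openin_product_topology_alt, rule_format, OF UV(3)] by (elim exE conjE)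
    then have W_open: "open (W j)" if "j \<in> {1..dim_row A}" for j using that by (simp only: open_openin)
    obtain e0 where e0: "e0 > 0" "ball x e0 \<subseteq> U" using U UV(2) openE by blast
    have "\<exists>e>0. ball 0 e \<subseteq> W j" if "j \<in> {1..dim_row A}" for j
    proof -
      have "t j \<in> W j" using W(1) that by (rule PiE_mem)
      then have "0 \<in> W j" by (simp only: t[OF that])
      then show ?thesis using W_open[OF that] openE by blast
    qed
    then obtain d where d: "\<And>j. j \<in> {1..dim_row A} \<Longrightarrow> d j > 0 \<and> ball 0 (d j) \<subseteq> W j" by metis
    \<comment> \<open>\<open>e0\<close> keeps the set nonempty even if the matrix has no
      rows.\<close>
    define e where "e = Min (insert e0 (d ` {1..dim_row A}))"
    have e: "e > 0" "e \<le> e0" "\<And>j. j \<in> {1..dim_row A} \<Longrightarrow> e \<le> d j"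
    proof -
      show "e > 0" unfolding e_def using e0(1) d by (subst Min_gr_iff) auto
      show "e \<le> e0" unfolding e_def by (rule Min_le) simp_all
      show "e \<le> d j" if "j \<in> {1..dim_row A}" for j
        unfolding e_def
      proof (rule Min_le)
        show "d j \<in> insert e0 (d ` {1..dim_row A})" using that by (intro insertI2 imageI)
      qed simp
    qed
    obtain y s where ys: "(y, s) \<in> S" "(y, s) \<in> topspace (Xtilde A)" "dist y x < e"
        "\<forall>j\<in>{1..dim_row A}. \<bar>s j\<bar> < e"
      using * e(1) by blast
    have "y \<in> U" using ys(3) e(2) e0(2) by (auto simp: dist_commute)
    moreover have "s \<in> V"
    proof -
      have "s j \<in> W j" if "j \<in> {1..dim_row A}" for j
      proof -
        have "s j \<in> ball 0 (d j)" using bspec[OF ys(4) that] e(3)[OF that] by (simp add: dist_real_def)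
        then show ?thesis using d[OF that] by blast
      qed
      moreover have "s \<in> extensional {1..dim_row A}" using ys(2) by (simp add: Xtilde_def PiE_def)
      ultimately have "s \<in> PiE {1..dim_row A} W" unfolding PiE_iff by blast
      then show ?thesis using W(2) by blast
    qed
    ultimately show "\<exists>y. y \<in> S \<and> y \<in> T" using ys(1) UV(4) by blast
  qed
qed

text \<open>\<open>\<sigma> * entry A j k\<close> is a nonnegative integer, so \<open>nat\<close>
  and the floor lose nothing, and \<sigma> is absorbed into \<open>l\<close>.\<close>

lemma deform_factor:
  assumes nonneg: "\<forall>j\<in>{1..dim_row A}. \<forall>k\<in>{1..dim_col A}. entry A j k \<ge> 0"
    and sigma: "normalizer A \<sigma>" and k: "k \<in> {1..dim_col A}"
    and s: "\<And>j. j \<in> {1..dim_row A} \<Longrightarrow> s j > 0 \<and> l j = real_of_rat \<sigma> * ln (s j)"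
  shows "(\<Prod>j = 1..dim_row A. s j ^ nat \<lfloor>\<sigma> * entry A j k\<rfloor>) = exp (log_phi A l k)"
  unfolding log_phi_def exp_sum[OF finite_atLeastAtMost]
proof (rule prod.cong[OF refl])
  fix j assume j: "j \<in> {1..dim_row A}"
  have "\<sigma> * entry A j k \<in> \<int>" "\<sigma> > 0" using sigma j k by (auto simp: normalizer_def)
  moreover have "\<sigma> * entry A j k \<ge> 0" using nonneg j k \<open>\<sigma> > 0\<close> by simp
  ultimately have "of_nat (nat \<lfloor>\<sigma> * entry A j k\<rfloor>) = \<sigma> * entry A j k"
    by (metis Ints_cases floor_of_int of_int_of_nat_eq of_int_0_le_iff int_nat_eq)
  from arg_cong[OF this, of real_of_rat]
  have N: "real (nat \<lfloor>\<sigma> * entry A j k\<rfloor>) = real_of_rat \<sigma> * real_of_rat (entry A j k)"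
    by (simp add: of_rat_mult)
  have "s j ^ nat \<lfloor>\<sigma> * entry A j k\<rfloor> = exp (ln (s j)) ^ nat \<lfloor>\<sigma> * entry A j k\<rfloor>"
    using s[OF j] by simp
  also have "\<dots> = exp (real (nat \<lfloor>\<sigma> * entry A j k\<rfloor>) * ln (s j))"
    by (rule exp_of_nat_mult[symmetric])
  also have "real (nat \<lfloor>\<sigma> * entry A j k\<rfloor>) * ln (s j) = real_of_rat (entry A j k) * l j"
    unfolding N using s[OF j] by simp
  finally show "s j ^ nat \<lfloor>\<sigma> * entry A j k\<rfloor> = exp (real_of_rat (entry A j k) * l j)" .
qed

text \<open>The sequence lives in \<open>X\<close> and not in \<open>Xtilde A\<close>: for positive
  \<open>t\<close> the map \<open>deform\<close> is invertible in the space variable, so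
  \<open>z\<close> and \<open>l\<close> determine the points of \<open>Omega A\<close>.\<close>

definition cone_sequence ::
  "rat mat \<Rightarrow> ('n::finite \<Rightarrow> nat) \<Rightarrow> real ^ 'n \<Rightarrow> (nat \<Rightarrow> real ^ 'n) \<Rightarrow> (nat \<Rightarrow> nat \<Rightarrow> real) \<Rightarrow> bool" where
  "cone_sequence A blk x z l \<longleftrightarrow>
    (\<forall>j\<in>{1..dim_row A}. filterlim (\<lambda>n. l n j) at_bot sequentially) \<and>
    (\<lambda>n. block blk 0 (z n)) \<longlonglongrightarrow> block blk 0 x \<and>
    (\<forall>k\<in>{1..dim_col A}. (\<lambda>n. block blk k (z n) /\<^sub>R exp (log_phi A (l n) k)) \<longlonglongrightarrow> block blk k x)"

lemma multinormal_cone_iff: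
  fixes blk :: "'n::finite \<Rightarrow> nat"
  assumes nonneg: "\<forall>j\<in>{1..dim_row A}. \<forall>k\<in>{1..dim_col A}. entry A j k \<ge> 0"
    and sigma: "normalizer A \<sigma>" and blocks: "\<forall>i. blk i \<le> dim_col A"
    and p: "p \<in> S_chi A"
  shows "p \<in> multinormal_cone A \<sigma> blk Z \<longleftrightarrow> (\<exists>z l. (\<forall>n. z n \<in> Z) \<and> cone_sequence A blk (fst p) z l)"
proof -
  obtain x t where pt: "p = (x, t)" by (cases p)
  have top: "(x, t) \<in> topspace (Xtilde A)" and t0: "\<And>j. j \<in> {1..dim_row A} \<Longrightarrow> t j = 0"
    using p by (auto simp: S_chi_def pt)
  have \<sigma>: "real_of_rat \<sigma> > 0" using sigma by (simp add: normalizer_def)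
  let ?S = "{q \<in> Omega A. deform A \<sigma> blk q \<in> Z}"
  have deform_block: "block blk k (deform A \<sigma> blk (y, s))
      = (if k = 0 then block blk 0 y else exp (log_phi A l k) *\<^sub>R block blk k y)"
    if "k \<le> dim_col A" "\<And>j. j \<in> {1..dim_row A} \<Longrightarrow> s j > 0 \<and> l j = real_of_rat \<sigma> * ln (s j)" for k y s l
  proof (cases "k = 0")
    case True
    then show ?thesis by (simp add: Finite_Cartesian_Product.vec_eq_iff block_nth deform_def)
  next
    case False
    then have "k \<in> {1..dim_col A}" using that(1) by auto
    from deform_factor[OF nonneg sigma this that(2)] show ?thesis
      using False by (simp add: Finite_Cartesian_Product.vec_eq_iff block_nth deform_def)
  qed
  have "p \<in> multinormal_cone A \<sigma> blk Z \<longleftrightarrow>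
      (\<forall>e>0. \<exists>y s. (y, s) \<in> ?S \<and> (y, s) \<in> topspace (Xtilde A) \<and> dist y x < e \<and> (\<forall>j\<in>{1..dim_row A}. \<bar>s j\<bar> < e))"
    using p Xtilde_closure_iff[OF top t0, of ?S] by (simp add: multinormal_cone_def pt)
  also have "\<dots> \<longleftrightarrow> (\<exists>z l. (\<forall>n. z n \<in> Z) \<and> cone_sequence A blk x z l)"
  proof
    assume near: "\<forall>e>0. \<exists>y s. (y, s) \<in> ?S \<and> (y, s) \<in> topspace (Xtilde A) \<and> dist y x < e \<and>
      (\<forall>j\<in>{1..dim_row A}. \<bar>s j\<bar> < e)"
    have "\<exists>q. q \<in> ?S \<and> dist (fst q) x < inverse (real (Suc n)) \<and>
        (\<forall>j\<in>{1..dim_row A}. \<bar>snd q j\<bar> < inverse (real (Suc n)))" for n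
    proof -
      have pos: "inverse (real (Suc n)) > 0" by simp
      obtain y s where "(y, s) \<in> ?S" "dist y x < inverse (real (Suc n))"
          "\<forall>j\<in>{1..dim_row A}. \<bar>s j\<bar> < inverse (real (Suc n))"
        using near[rule_format, OF pos] by (elim exE conjE)
      then show ?thesis by (intro exI[of _ "(y, s)"]) simp
    qed
    then have "\<forall>n. \<exists>q. q \<in> ?S \<and> dist (fst q) x < inverse (real (Suc n)) \<and>
        (\<forall>j\<in>{1..dim_row A}. \<bar>snd q j\<bar> < inverse (real (Suc n)))" by (rule allI)
    from choice[OF this] obtain q where q: "\<forall>n. q n \<in> ?S \<and> dist (fst (q n)) x < inverse (real (Suc n)) \<and>
        (\<forall>j\<in>{1..dim_row A}. \<bar>snd (q n) j\<bar> < inverse (real (Suc n)))" by (elim exE)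
    define y s where "y n = fst (q n)" and "s n = snd (q n)" for n
    have ys: "(y n, s n) \<in> ?S" "dist (y n) x < inverse (real (Suc n))"
        "\<And>j. j \<in> {1..dim_row A} \<Longrightarrow> \<bar>s n j\<bar> < inverse (real (Suc n))" for n
      using spec[OF q, of n] by (auto simp only: y_def s_def prod.collapse)
    have s_pos: "s n j > 0" if "j \<in> {1..dim_row A}" for n j
      using ys(1)[of n] that by (auto simp: Omega_def)
    define l where "l n j = real_of_rat \<sigma> * ln (s n j)" for n j
    define z where "z n = deform A \<sigma> blk (y n, s n)" for n
    have y_lim: "y \<longlonglongrightarrow> x"
      unfolding tendsto_dist_iff[of y]
    proof (rule tendsto_sandwich[OF _ _ tendsto_const LIMSEQ_inverse_real_of_nat])
      show "\<forall>\<^sub>F n in sequentially. dist (y n) x \<le> inverse (real (Suc n))"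
        by (intro always_eventually allI less_imp_le ys(2))
    qed simp
    have "filterlim (\<lambda>n. l n j) at_bot sequentially" if j: "j \<in> {1..dim_row A}" for j
    proof -
      have "(\<lambda>n. s n j) \<longlonglongrightarrow> 0"
      proof (rule Lim_null_comparison[OF _ LIMSEQ_inverse_real_of_nat])
        show "\<forall>\<^sub>F n in sequentially. norm (s n j) \<le> inverse (real (Suc n))"
          unfolding real_norm_def by (intro always_eventually allI less_imp_le ys(3) j)
      qed
      then have "filterlim (\<lambda>n. s n j) (at_right 0) sequentially"
        using s_pos[OF j] by (intro tendsto_imp_filterlim_at_right) auto
      from filterlim_compose[OF ln_at_0 this] show ?thesis
        unfolding l_def by (intro filterlim_tendsto_pos_mult_at_bot[OF tendsto_const \<sigma>])
    qed
    moreover have blk_z: "block blk k (z n) = (if k = 0 then block blk 0 (y n) else exp (log_phi A (l n) k) *\<^sub>R block blk k (y n))"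
      if "k \<le> dim_col A" for k n
      unfolding z_def using that by (rule deform_block) (use s_pos l_def in auto)
    moreover have "(\<lambda>n. block blk k (z n) /\<^sub>R exp (log_phi A (l n) k)) \<longlonglongrightarrow> block blk k x"
      if "k \<in> {1..dim_col A}" for k
      using tendsto_block[OF y_lim, of blk k] that blk_z[of k] by simp
    moreover have "(\<lambda>n. block blk 0 (z n)) \<longlonglongrightarrow> block blk 0 x"
      using tendsto_block[OF y_lim, of blk 0] blk_z[of 0] by simp
    moreover have "z n \<in> Z" for n using ys(1) by (simp add: z_def)
    ultimately show "\<exists>z l. (\<forall>n. z n \<in> Z) \<and> cone_sequence A blk x z l"
      unfolding cone_sequence_def by blast
  next
    assume "\<exists>z l. (\<forall>n. z n \<in> Z) \<and> cone_sequence A blk x z l"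
    then obtain z l where z: "\<And>n. z n \<in> Z"
      and l: "\<And>j. j \<in> {1..dim_row A} \<Longrightarrow> filterlim (\<lambda>n. l n j) at_bot sequentially"
      and z0: "(\<lambda>n. block blk 0 (z n)) \<longlonglongrightarrow> block blk 0 x"
      and zk: "\<And>k. k \<in> {1..dim_col A} \<Longrightarrow> (\<lambda>n. block blk k (z n) /\<^sub>R exp (log_phi A (l n) k)) \<longlonglongrightarrow> block blk k x"
      unfolding cone_sequence_def by blast
    \<comment> \<open>\<open>restrict\<close> makes \<open>s n\<close> extensional, hence a
      legitimate parameter in \<open>Xtilde A\<close>; \<open>y n\<close> is the preimage of
      \<open>z n\<close> for this parameter.\<close>
    define s where "s n = restrict (\<lambda>j. exp (l n j / real_of_rat \<sigma>)) {1..dim_row A}" for n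
    define y where "y n = (\<chi> i. if blk i = 0 then vec_nth (z n) i else vec_nth (z n) i / exp (log_phi A (l n) (blk i)))" for n
    have s: "s n j > 0 \<and> l n j = real_of_rat \<sigma> * ln (s n j)" if "j \<in> {1..dim_row A}" for n j
      using that \<sigma> by (simp add: s_def)
    have deform_z: "deform A \<sigma> blk (y n, s n) = z n" for n
    proof -
      have "vec_nth (deform A \<sigma> blk (y n, s n)) i = vec_nth (z n) i" for i
      proof (cases "blk i = 0")
        case False
        then have "blk i \<in> {1..dim_col A}" using blocks by (simp add: Suc_le_eq)
        from deform_factor[OF nonneg sigma this s] show ?thesis
          using False by (simp add: deform_def y_def)
      qed (simp add: deform_def y_def)
      then show ?thesis by (simp add: Finite_Cartesian_Product.vec_eq_iff)
    qed
    have Om: "(y n, s n) \<in> Omega A" for n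
      using s by (auto simp: Omega_def Xtilde_def s_def)
    have "y \<longlonglongrightarrow> x"
    proof (rule vec_tendstoI)
      fix i
      show "(\<lambda>n. vec_nth (y n) i) \<longlonglongrightarrow> vec_nth x i"
      proof (cases "blk i = 0")
        case True
        then show ?thesis using tendsto_vec_nth[OF z0, of i] by (simp add: block_nth y_def)
      next
        case False
        then have "blk i \<in> {1..dim_col A}" using blocks by (simp add: Suc_le_eq)
        from tendsto_vec_nth[OF zk[OF this], of i] show ?thesis
          using False by (simp add: block_nth y_def divide_inverse mult.commute)
      qed
    qed
    moreover have "(\<lambda>n. s n j) \<longlonglongrightarrow> 0" if j: "j \<in> {1..dim_row A}" for j
    proof -
      have "filterlim (\<lambda>n. 1 / real_of_rat \<sigma> * l n j) at_bot sequentially"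
        using \<sigma> by (intro filterlim_tendsto_pos_mult_at_bot[OF tendsto_const _ l[OF j]]) simp
      then have "(\<lambda>n. exp (1 / real_of_rat \<sigma> * l n j)) \<longlonglongrightarrow> 0" by (simp only: exp_tendsto_0_iff)
      then show ?thesis using j by (simp add: s_def)
    qed
    ultimately show "\<forall>e>0. \<exists>y s. (y, s) \<in> ?S \<and> (y, s) \<in> topspace (Xtilde A) \<and> dist y x < e \<and>
      (\<forall>j\<in>{1..dim_row A}. \<bar>s j\<bar> < e)"
    proof (intro allI impI)
      fix e :: real assume e: "e > 0"
      assume y: "y \<longlonglongrightarrow> x" and s0: "\<And>j. j \<in> {1..dim_row A} \<Longrightarrow> (\<lambda>n. s n j) \<longlonglongrightarrow> 0"
      have "\<forall>\<^sub>F n in sequentially. dist (y n) x < e \<and> (\<forall>j\<in>{1..dim_row A}. \<bar>s n j\<bar> < e)"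
        using tendstoD[OF y e] tendstoD[OF s0 e]
        by (intro eventually_conj eventually_ball_finite) auto
      then obtain n where "dist (y n) x < e" "\<forall>j\<in>{1..dim_row A}. \<bar>s n j\<bar> < e"
        by (auto simp: eventually_sequentially)
      moreover have "(y n, s n) \<in> topspace (Xtilde A)" using Om[of n] by (simp add: Omega_def)
      ultimately show "\<exists>y s. (y, s) \<in> ?S \<and> (y, s) \<in> topspace (Xtilde A) \<and> dist y x < e \<and>
          (\<forall>j\<in>{1..dim_row A}. \<bar>s j\<bar> < e)"
        using Om[of n] deform_z[of n] z[of n] by (intro exI[of _ "y n"] exI[of _ "s n"]) simp
    qed
  qed
  finally show ?thesis by (simp add: pt)
qed

section \<open>Multicones along sequences\<close>

locale cone_point = ordered_matrix +
  fixes blk :: "'n::finite \<Rightarrow> nat" and x :: "real ^ 'n"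
  assumes nonneg: "\<forall>j\<in>{1..dim_row A}. \<forall>k\<in>{1..dim_col A}. entry A j k \<ge> 0"
    and blocks: "\<forall>i. blk i \<le> dim_col A"
    and zero_columns: "\<forall>k\<in>{1..dim_col A}.
      (\<forall>j\<in>{1..dim_row A}. entry A j k = 0) \<longrightarrow> block blk k x = 0"
begin

sublocale weighted_matrix A "\<lambda>k. norm (block blk k x)"
  by unfold_locales simp

lemma J_eq: "J = J_L A blk x"
  using rank_le_col by (auto simp: J_def J_L_def J_Z_def)

lemma gens_eq: "gens = G_set A blk x"
proof -
  have "rad = (\<lambda>i. if i \<in> J_L A blk x then 1 else norm (block blk i x))"
    by (rule ext) (simp add: rad_def J_eq)
  then show ?thesis by (simp add: gens_def G_set_def n_xi_def)
qed

lemma semi_eq: "semi = G_semi A blk x"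
  unfolding G_semi_def gens_eq[symmetric] J_eq[symmetric] semi_def set_taus ..

lemma elims_eq: "elims us gens = Fq_set A blk x"
proof -
  have "elims us gens = fold (elim True \<circ> Tau) taus (fold (elim False \<circ> Lam) lams gens)"
    by (simp add: elims_def us_def fold_map comp_def del: fold_simps)
  moreover have "elim True \<circ> Tau = elim_tau" "elim False \<circ> Lam = elim_lambda"
    by (simp_all add: fun_eq_iff elim_tau_eq elim_lambda_eq)
  ultimately show ?thesis
    by (simp only: Fq_set_def F0_set_def taus_def lams_def J_eq gens_eq)
qed

lemma multicones_Fq_subset: "multicones A blk x (Fq_set A blk x) \<subseteq> all_multicones A blk x"
proof -
  have "finite (Fq_set A blk x) \<and> Fq_set A blk x \<subseteq> H_tau A \<times> {0..} \<and>
      equivalent (generated (Fq_set A blk x)) (G_semi A blk x)"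
    using finite_elims[OF finite_gens, of us] elims_subset_H_tau equivalent_elims
    unfolding elims_eq semi_eq by blast
  then show ?thesis unfolding all_multicones_def by blast
qed

lemma cone_sequence_shift:
  assumes "cone_sequence A blk x z l"
  shows "cone_sequence A blk x (\<lambda>n. z (n + N)) (\<lambda>n. l (n + N))"
proof -
  have shift: "filterlim (\<lambda>n. f (n + N)) F sequentially" if "filterlim f F sequentially"
    for f :: "nat \<Rightarrow> 'b" and F
    by (rule filterlim_compose[OF that filterlim_add_const_nat_at_top])
  show ?thesis
    using assms unfolding cone_sequence_def by (auto intro!: shift)
qed

lemma cone_sequence_norm:
  assumes "cone_sequence A blk x z l" "k \<in> {1..dim_col A}"
  shows "(\<lambda>n. norm (block blk k (z n)) / exp (log_phi A (l n) k)) \<longlonglongrightarrow> norm (block blk k x)"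
proof -
  have "(\<lambda>n. norm (block blk k (z n) /\<^sub>R exp (log_phi A (l n) k))) \<longlonglongrightarrow> norm (block blk k x)"
    using assms by (intro tendsto_norm) (simp add: cone_sequence_def)
  then show ?thesis by (simp add: divide_inverse mult.commute)
qed

lemma log_phi_at_bot:
  assumes l: "\<And>j. j \<in> {1..dim_row A} \<Longrightarrow> filterlim (\<lambda>n. l n j) at_bot sequentially"
    and k: "k \<in> {1..dim_col A}" and i: "i \<in> {1..dim_row A}" "entry A i k \<noteq> 0"
  shows "filterlim (\<lambda>n. log_phi A (l n) k) at_bot sequentially"
proof -
  have pos: "real_of_rat (entry A i k) > 0" using nonneg i k by (simp add: order_less_le)
  have "\<forall>\<^sub>F n in sequentially. \<forall>j\<in>{1..dim_row A}. l n j \<le> 0"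
    using l by (intro eventually_ball_finite) (auto simp: filterlim_at_bot)
  then have "\<forall>\<^sub>F n in sequentially. log_phi A (l n) k \<le> real_of_rat (entry A i k) * l n i"
  proof (rule eventually_mono)
    fix n assume *: "\<forall>j\<in>{1..dim_row A}. l n j \<le> 0"
    have "(\<Sum>j\<in>{1..dim_row A} - {i}. real_of_rat (entry A j k) * l n j) \<le> 0"
      using * nonneg k by (intro sum_nonpos mult_nonneg_nonpos) auto
    then show "log_phi A (l n) k \<le> real_of_rat (entry A i k) * l n i"
      unfolding log_phi_def using sum.remove[OF finite_atLeastAtMost i(1), of "\<lambda>j. real_of_rat (entry A j k) * l n j"] by simp
  qed
  then show ?thesis
    by (rule filterlim_at_bot_mono[OF filterlim_tendsto_pos_mult_at_bot[OF tendsto_const pos l[OF i(1)]]])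
qed

text \<open>A column with a nonzero entry has a scaling factor tending to 0. For a zero column the
  factor is 1, and there the block of the point is 0 by assumption.\<close>

lemma cone_sequence_tendsto_base_point:
  assumes z: "cone_sequence A blk x z l"
  shows "z \<longlonglongrightarrow> block blk 0 x"
proof (rule vec_tendstoI)
  fix i
  show "(\<lambda>n. vec_nth (z n) i) \<longlonglongrightarrow> vec_nth (block blk 0 x) i"
  proof (cases "blk i = 0")
    case True
    have "(\<lambda>n. block blk 0 (z n)) \<longlonglongrightarrow> block blk 0 x" using z by (simp add: cone_sequence_def)
    from tendsto_vec_nth[OF this, of i] show ?thesis using True by (simp add: block_nth)
  next
    case False
    define k where "k = blk i"
    have k: "k \<in> {1..dim_col A}" using False blocks by (simp add: k_def Suc_le_eq)
    let ?E = "\<lambda>n. exp (log_phi A (l n) k)"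
    have lim: "(\<lambda>n. block blk k (z n) /\<^sub>R ?E n) \<longlonglongrightarrow> block blk k x"
      using z k by (simp add: cone_sequence_def)
    have "(\<lambda>n. ?E n *\<^sub>R (block blk k (z n) /\<^sub>R ?E n)) \<longlonglongrightarrow> 0"
    proof (cases "\<forall>j\<in>{1..dim_row A}. entry A j k = 0")
      case True
      then have "?E n = 1" for n by (simp add: log_phi_def)
      then show ?thesis using lim zero_columns True k by simp
    next
      case nz: False
      then obtain j where "j \<in> {1..dim_row A}" "entry A j k \<noteq> 0" by blast
      then have "filterlim (\<lambda>n. log_phi A (l n) k) at_bot sequentially"
        using z k by (intro log_phi_at_bot) (auto simp: cone_sequence_def)
      then have "?E \<longlonglongrightarrow> 0" by (simp add: exp_tendsto_0_iff)
      from tendsto_scaleR[OF this lim] show ?thesis by simp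
    qed
    then have "(\<lambda>n. block blk k (z n)) \<longlonglongrightarrow> 0" by simp
    from tendsto_vec_nth[OF this, of i] show ?thesis using False by (simp add: block_nth k_def)
  qed
qed

text \<open>The rescaled blocks converge to a point of the relatively open set \<open>W\<close>, and
  conicity undoes the rescaling by a positive factor.\<close>

lemma eventually_in_cone:
  assumes z: "cone_sequence A blk x z l" and k: "k \<in> {1..dim_col A}" and W: "cone_at A blk x k W"
  shows "\<forall>\<^sub>F n in sequentially. block blk k (z n) \<in> W"
proof (cases "k \<in> J_Z A blk x")
  case True
  then show ?thesis using W by (simp add: cone_at_def block_in_block_space)
next
  case False
  then have W: "pos_conic W" "openin (top_of_set (block_space blk k)) W" "block blk k x \<in> W"
    using W by (simp_all add: cone_at_def)
  let ?E = "\<lambda>n. exp (log_phi A (l n) k)"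
  obtain T where T: "open T" "W = block_space blk k \<inter> T" using W(2) unfolding openin_open by blast
  have lim: "(\<lambda>n. block blk k (z n) /\<^sub>R ?E n) \<longlonglongrightarrow> block blk k x"
    using z k by (simp add: cone_sequence_def)
  have "block blk k x \<in> T" using W(3) T(2) by blast
  from topological_tendstoD[OF lim T(1) this]
  have "\<forall>\<^sub>F n in sequentially. block blk k (z n) /\<^sub>R ?E n \<in> T" .
  then show ?thesis
  proof (rule eventually_mono)
    fix n assume "block blk k (z n) /\<^sub>R ?E n \<in> T"
    moreover have "block blk k (z n) /\<^sub>R ?E n \<in> block_space blk k"
      by (simp add: block_space_def block_nth)
    ultimately have "block blk k (z n) /\<^sub>R ?E n \<in> W" using T(2) by blast
    then have "?E n *\<^sub>R (block blk k (z n) /\<^sub>R ?E n) \<in> W"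
      using W(1) unfolding pos_conic_def by (metis exp_gt_zero)
    then show "block blk k (z n) \<in> W" by simp
  qed
qed

text \<open>Elements of \<open>H\<close> have common powers with elements of the semigroup, so they share its limits.\<close>

lemma weights_converge:
  assumes r: "\<And>f v. (f, v) \<in> semi \<Longrightarrow> (\<lambda>n. mono_eval A f (r n)) \<longlonglongrightarrow> v"
    and H: "H \<subseteq> H_tau A \<times> {0..}" "equivalent (generated H) (G_semi A blk x)" and g: "(g, v) \<in> H"
  shows "(\<lambda>n. mono_eval A g (r n)) \<longlonglongrightarrow> v"
proof -
  obtain N1 N2 where N: "N1 > 0" "N2 > 0" "wmono_pow N1 ` generated H \<subseteq> wmono_pow N2 ` semi"
    using H(2) unfolding equivalent_def semi_eq by blast
  have "wmono_pow N1 (g, v) \<in> wmono_pow N2 ` semi"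
    using N(3) generated_base[OF g] by blast
  then obtain f w where f: "(f, w) \<in> semi" "wmono_pow N1 (g, v) = wmono_pow N2 (f, w)" by force
  then have eq: "mono_pow g N1 = mono_pow f N2" "v ^ N1 = w ^ N2" by simp_all
  have "(\<lambda>n. mono_eval A f (r n) ^ N2) \<longlonglongrightarrow> w ^ N2"
    by (intro tendsto_power r f(1))
  then have "(\<lambda>n. mono_eval A g (r n) ^ N1) \<longlonglongrightarrow> v ^ N1"
    using mono_eval_pow[OF N(1), of A g] mono_eval_pow[OF N(2), of A f] eq by simp
  from tendsto_real_root[OF this, of N1] show ?thesis
    using N(1) H(1) g by (auto simp: real_root_power_cancel mono_eval_nonneg)
qed

lemma cone_sequence_meets_multicone:
  assumes z: "cone_sequence A blk x z l" "\<And>n. z n \<in> Z"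
    and V: "V \<in> all_multicones A blk x" and U: "open U" "block blk 0 x \<in> U"
  shows "Z \<inter> V \<inter> U \<noteq> {}"
proof -
  \<comment> \<open>\<open>semi_converges\<close> wants blocks with nonzero limit to be nonzero for
    all \<open>n\<close>, not only eventually; hence the shift by \<open>N\<close>.\<close>
  have "\<forall>\<^sub>F n in sequentially. \<forall>k\<in>{1..dim_col A}. block blk k x \<noteq> 0 \<longrightarrow> block blk k (z n) \<noteq> 0"
  proof (intro eventually_ball_finite ballI)
    fix k assume k: "k \<in> {1..dim_col A}"
    show "\<forall>\<^sub>F n in sequentially. block blk k x \<noteq> 0 \<longrightarrow> block blk k (z n) \<noteq> 0"
    proof (cases "block blk k x = 0")
      case False
      have "\<forall>\<^sub>F n in sequentially. 0 < norm (block blk k (z n)) / exp (log_phi A (l n) k)"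
        using order_tendstoD(1)[OF cone_sequence_norm[OF z(1) k], of 0] False by simp
      then show ?thesis by (rule eventually_mono) auto
    qed simp
  qed simp
  then obtain N where N: "\<And>n k. n \<ge> N \<Longrightarrow> k \<in> {1..dim_col A} \<Longrightarrow> block blk k x \<noteq> 0 \<Longrightarrow> block blk k (z n) \<noteq> 0"
    unfolding eventually_sequentially by blast
  define z' l' where "z' n = z (n + N)" and "l' n = l (n + N)" for n
  have z': "cone_sequence A blk x z' l'"
    unfolding z'_def l'_def using z(1) by (rule cone_sequence_shift)
  define r where "r n k = norm (block blk k (z' n))" for n k
  have "limit_data r l'"
    using z' cone_sequence_norm[OF z'] by (simp add: limit_data_def r_def cone_sequence_def)
  moreover have "r n k \<ge> 0" for n k by (simp add: r_def)
  moreover have "r n k > 0" if "k \<in> {1..dim_col A}" "norm (block blk k x) \<noteq> 0" for n k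
    using N[of "n + N" k] that by (simp add: r_def z'_def)
  ultimately have semi_lim: "(\<lambda>n. mono_eval A f (r n)) \<longlonglongrightarrow> v" if "(f, v) \<in> semi" for f v
    using that by (intro semi_converges)
  obtain H \<epsilon> W where H: "finite H" "H \<subseteq> H_tau A \<times> {0..}" "equivalent (generated H) (G_semi A blk x)"
    and \<epsilon>: "\<epsilon> > 0" and W: "\<forall>k\<in>{1..dim_col A}. cone_at A blk x k (W k)"
    and V_eq: "V = {y. (\<forall>k\<in>{1..dim_col A}. block blk k y \<in> W k) \<and>
             (\<forall>(g, v)\<in>H. v - \<epsilon> < mono_eval A g (\<lambda>k. norm (block blk k y)) \<and>
                         mono_eval A g (\<lambda>k. norm (block blk k y)) < v + \<epsilon>)}"
    using V unfolding all_multicones_def multicones_def by blast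
  have "\<forall>\<^sub>F n in sequentially. \<forall>k\<in>{1..dim_col A}. block blk k (z' n) \<in> W k"
    using W z' by (intro eventually_ball_finite ballI eventually_in_cone) auto
  moreover have "\<forall>\<^sub>F n in sequentially. \<forall>x\<in>H. snd x - \<epsilon> < mono_eval A (fst x) (r n) \<and> mono_eval A (fst x) (r n) < snd x + \<epsilon>"
  proof (intro eventually_ball_finite ballI H(1))
    fix y assume "y \<in> H"
    then have "(\<lambda>n. mono_eval A (fst y) (r n)) \<longlonglongrightarrow> snd y"
      by (intro weights_converge[OF semi_lim H(2,3)]) simp_all
    from tendstoD[OF this \<epsilon>]
    show "\<forall>\<^sub>F n in sequentially. snd y - \<epsilon> < mono_eval A (fst y) (r n) \<and> mono_eval A (fst y) (r n) < snd y + \<epsilon>"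
      by (rule eventually_mono) (auto simp: dist_real_def abs_less_iff)
  qed
  moreover have "\<forall>\<^sub>F n in sequentially. z' n \<in> U"
    using topological_tendstoD[OF cone_sequence_tendsto_base_point[OF z'] U] .
  ultimately have "\<forall>\<^sub>F n in sequentially. z' n \<in> V \<inter> U"
  proof eventually_elim
    case (elim n)
    have "r n = (\<lambda>k. norm (block blk k (z' n)))" by (rule ext) (simp add: r_def)
    with elim show ?case unfolding V_eq by (auto simp: split_beta)
  qed
  then obtain n where "z' n \<in> V \<inter> U" by (auto simp: eventually_sequentially)
  moreover have "z' n \<in> Z" using z(2) by (simp add: z'_def)
  ultimately show ?thesis by blast
qed

text \<open>One point of \<open>Z\<close> is taken from each of a shrinking family of multicones and
  balls. The weights produce \<open>l\<close> and with it the limits of the norms; the cones add the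
  convergence of directions where the limit block is nonzero.\<close>

lemma cone_sequence_exists:
  assumes meets: "\<And>V U. V \<in> multicones A blk x (Fq_set A blk x) \<Longrightarrow> open U \<Longrightarrow> block blk 0 x \<in> U \<Longrightarrow> Z \<inter> V \<inter> U \<noteq> {}"
  shows "\<exists>z l. (\<forall>n. z n \<in> Z) \<and> cone_sequence A blk x z l"
proof -
  define \<epsilon> where "\<epsilon> n = inverse (real (Suc n))" for n
  \<comment> \<open>Vectors whose direction is within \<open>\<epsilon> n\<close> of that of the
    point; normalising makes the set conic.\<close>
  define W where "W n k = (if k \<in> J_Z A blk x then block_space blk k
    else {w \<in> block_space blk k - {0}. norm (w /\<^sub>R norm w - block blk k x /\<^sub>R norm (block blk k x)) < \<epsilon> n})" for n k
  define V where "V n = {y. (\<forall>k\<in>{1..dim_col A}. block blk k y \<in> W n k) \<and>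
      (\<forall>(g, v)\<in>Fq_set A blk x. v - \<epsilon> n < mono_eval A g (\<lambda>k. norm (block blk k y)) \<and>
         mono_eval A g (\<lambda>k. norm (block blk k y)) < v + \<epsilon> n)}" for n
  have \<epsilon>: "\<epsilon> n > 0" for n by (simp add: \<epsilon>_def)
  have \<epsilon>_lim: "\<epsilon> \<longlonglongrightarrow> 0" unfolding \<epsilon>_def by (rule LIMSEQ_inverse_real_of_nat)
  have cone: "cone_at A blk x k (W n k)" if k: "k \<in> {1..dim_col A}" for n k
  proof (cases "k \<in> J_Z A blk x")
    case False
    then have x0: "block blk k x \<noteq> 0" using k by (simp add: J_Z_def)
    let ?B = "block_space blk k"
    let ?d = "\<lambda>w. norm (w /\<^sub>R norm w - block blk k x /\<^sub>R norm (block blk k x))"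
    have W: "W n k = {w \<in> ?B - {0}. ?d w < \<epsilon> n}" using False by (simp add: W_def)
    have "pos_conic (W n k)"
      unfolding pos_conic_def
    proof (intro ballI allI impI)
      fix w and c :: real assume w: "w \<in> W n k" and c: "c > 0"
      have "(c *\<^sub>R w) /\<^sub>R norm (c *\<^sub>R w) = w /\<^sub>R norm w" using c by simp
      then have "?d (c *\<^sub>R w) = ?d w" by (simp only:)
      moreover have "c *\<^sub>R w \<in> ?B - {0}" using w c unfolding W by (simp add: block_space_def)
      ultimately show "c *\<^sub>R w \<in> W n k" using w unfolding W mem_Collect_eq by (simp only:)
    qed
    moreover have "open {w \<in> - {0}. ?d w < \<epsilon> n}"
    proof -
      have "continuous_on (- {0}) ?d" by (intro continuous_intros) auto
      from continuous_open_preimage[OF this _ open_lessThan[of "\<epsilon> n"]]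
      have "open (- {0} \<inter> ?d -` {..<\<epsilon> n})" by (simp add: open_Compl)
      moreover have "- {0} \<inter> ?d -` {..<\<epsilon> n} = {w \<in> - {0}. ?d w < \<epsilon> n}" by blast
      ultimately show ?thesis by simp
    qed
    then have "openin (top_of_set ?B) (?B \<inter> {w \<in> - {0}. ?d w < \<epsilon> n})" by (rule openin_open_Int)
    moreover have "?B \<inter> {w \<in> - {0}. ?d w < \<epsilon> n} = W n k" unfolding W by blast
    moreover have "block blk k x \<in> W n k" unfolding W using x0 \<epsilon> by (simp add: block_in_block_space)
    moreover have "W n k \<subseteq> ?B - {0}" unfolding W by blast
    ultimately show ?thesis using False unfolding cone_at_def by simp
  qed (simp add: cone_at_def W_def)
  have "V n \<in> multicones A blk x (Fq_set A blk x)" for n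
    unfolding multicones_def
  proof (intro CollectI exI conjI)
    show "\<epsilon> n > 0" by (rule \<epsilon>)
    show "\<forall>k\<in>{1..dim_col A}. cone_at A blk x k (W n k)" using cone by blast
  qed (rule V_def)
  then have "\<exists>y. y \<in> Z \<inter> V n \<inter> ball (block blk 0 x) (\<epsilon> n)" for n
    using meets[of "V n" "ball (block blk 0 x) (\<epsilon> n)"] \<epsilon> by fastforce
  then obtain z where z: "\<And>n. z n \<in> Z \<inter> V n \<inter> ball (block blk 0 x) (\<epsilon> n)" by metis
  have z_W: "block blk k (z n) \<in> W n k" if "k \<in> {1..dim_col A}" for n k
    using z[of n] that by (auto simp: V_def)
  have z_lim: "z \<longlonglongrightarrow> block blk 0 x"
    unfolding tendsto_dist_iff[of z]
    by (rule tendsto_sandwich[OF _ _ tendsto_const \<epsilon>_lim])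
      (use z in \<open>auto intro!: always_eventually simp: dist_commute less_imp_le\<close>)
  define r where "r n k = norm (block blk k (z n))" for n k
  have "\<exists>l. limit_data r l"
  proof (rule limit_data_exists)
    show "r n k \<ge> 0" for n k by (simp add: r_def)
    show "r n k > 0" if "k \<in> {1..dim_col A}" "norm (block blk k x) \<noteq> 0" for n k
      using z_W[OF that(1), of n] that by (simp add: W_def J_Z_def r_def)
    show "(\<lambda>n. mono_eval A f (r n)) \<longlonglongrightarrow> v" if f: "(f, v) \<in> elims us gens" for f v
    proof -
      have "\<bar>mono_eval A f (r n) - v\<bar> < \<epsilon> n" for n
      proof -
        have "v - \<epsilon> n < mono_eval A f (r n) \<and> mono_eval A f (r n) < v + \<epsilon> n"
          using z[of n] f unfolding elims_eq V_def r_def by blast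
        then show ?thesis by (simp add: abs_less_iff)
      qed
      then have "(\<lambda>n. mono_eval A f (r n) - v) \<longlonglongrightarrow> 0"
        by (intro Lim_null_comparison[OF _ \<epsilon>_lim] always_eventually) (simp add: less_imp_le)
      then show ?thesis by (simp only: LIM_zero_iff)
    qed
  qed
  then obtain l where l: "limit_data r l" by blast
  have "(\<lambda>n. block blk k (z n) /\<^sub>R exp (log_phi A (l n) k)) \<longlonglongrightarrow> block blk k x"
    if k: "k \<in> {1..dim_col A}" for k
  proof -
    let ?E = "\<lambda>n. exp (log_phi A (l n) k)"
    have r_lim: "(\<lambda>n. r n k / ?E n) \<longlonglongrightarrow> norm (block blk k x)"
      using l k by (simp add: limit_data_def)
    show ?thesis
    proof (cases "block blk k x = 0")
      case True
      have "(\<lambda>n. norm (block blk k (z n) /\<^sub>R ?E n)) \<longlonglongrightarrow> 0"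
        using r_lim True by (simp add: r_def divide_inverse mult.commute)
      then show ?thesis using True by (simp only: tendsto_norm_zero_iff)
    next
      case False
      then have JZ: "k \<notin> J_Z A blk x" by (simp add: J_Z_def)
      let ?x = "block blk k x /\<^sub>R norm (block blk k x)"
      have w: "block blk k (z n) \<noteq> 0" "norm (block blk k (z n) /\<^sub>R r n k - ?x) < \<epsilon> n" for n
        using z_W[OF k, of n] JZ by (simp_all add: W_def r_def)
      have "(\<lambda>n. block blk k (z n) /\<^sub>R r n k - ?x) \<longlonglongrightarrow> 0"
        by (intro Lim_null_comparison[OF _ \<epsilon>_lim] always_eventually allI less_imp_le w(2))
      then have "(\<lambda>n. block blk k (z n) /\<^sub>R r n k) \<longlonglongrightarrow> ?x" by (simp only: LIM_zero_iff)
      \<comment> \<open>Norm and direction converge separately, and their product is the rescaled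
        block.\<close>
      from tendsto_scaleR[OF r_lim this]
      have "(\<lambda>n. (r n k / ?E n) *\<^sub>R (block blk k (z n) /\<^sub>R r n k)) \<longlonglongrightarrow> block blk k x"
        using False by simp
      moreover have "(r n k / ?E n) *\<^sub>R (block blk k (z n) /\<^sub>R r n k) = block blk k (z n) /\<^sub>R ?E n" for n
        using w(1)[of n] by (simp add: r_def divide_inverse)
      ultimately show ?thesis by (simp only:)
    qed
  qed
  moreover have "(\<lambda>n. block blk 0 (z n)) \<longlonglongrightarrow> block blk 0 x"
    using tendsto_block[OF z_lim, of blk 0] by (simp add: block_def if_distrib cong: if_cong)
  ultimately have "cone_sequence A blk x z l"
    using l by (simp add: cone_sequence_def limit_data_def)
  then show ?thesis using z by blast
qed

end

theorem theorem2p27: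
  fixes A :: "rat mat" and \<sigma> :: rat
    and blk :: "'n::finite \<Rightarrow> nat"
    and p :: "(real ^ 'n) \<times> (nat \<Rightarrow> real)"
    and Z :: "(real ^ 'n) set"
  assumes nonneg: "\<forall>j\<in>{1..dim_row A}. \<forall>k\<in>{1..dim_col A}. entry A j k \<ge> 0"
    and sigma: "normalizer A \<sigma>"
    and ordered: "invertible_mat (submatrix A {..<mat_rank A} {..<mat_rank A})"
    and blocks: "\<forall>i. blk i \<le> dim_col A"
    and p: "p \<in> S_chi A"
    and zero_columns: "\<forall>k\<in>{1..dim_col A}.
      (\<forall>j\<in>{1..dim_row A}. entry A j k = 0) \<longrightarrow> block blk k (fst p) = 0"
  shows "(p \<notin> multinormal_cone A \<sigma> blk Z \<longleftrightarrow>
           (\<exists>V\<in>all_multicones A blk (fst p). \<exists>U. open U \<and> base_point blk p \<in> U \<and> Z \<inter> V \<inter> U = {})) \<and>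
         (p \<notin> multinormal_cone A \<sigma> blk Z \<longleftrightarrow>
           (\<exists>V\<in>multicones A blk (fst p) (Fq_set A blk (fst p)).
              \<exists>U. open U \<and> base_point blk p \<in> U \<and> Z \<inter> V \<inter> U = {}))"
    (is "(?i \<longleftrightarrow> ?ii) \<and> (?i \<longleftrightarrow> ?iii)")
proof -
  interpret cone_point A blk "fst p"
    using nonneg ordered blocks zero_columns by unfold_locales
  note cone_iff = multinormal_cone_iff[OF nonneg sigma blocks p, of Z]
  have "?i \<Longrightarrow> ?iii"
    using cone_sequence_exists[of Z] unfolding cone_iff base_point_def by blast
  moreover have "?iii \<Longrightarrow> ?ii"
    using multicones_Fq_subset by blast
  moreover have "?ii \<Longrightarrow> ?i"
    using cone_sequence_meets_multicone unfolding cone_iff base_point_def by blast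
  ultimately show ?thesis by blast
qed

end
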